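(* Let $W$ be an open subset of a non-compact semisimple Lie group $G$ equipped with its standard Riemannian metric, and let $U$ be the compact dual of $G$ equipped with its dual semi-Riemannian metric. Let $\mathcal B$ be a family of real analytic maps $\phi:W\to\mathbb C$ and let $\mathcal B^*$ be the dual family consisting of the maps $\phi^*:W^*\to\mathbb C$. Then $\mathcal B^*$ is a bi-eigenfamily if and only if $\mathcal B$ is a bi-eigenfamily.
   Context: Construction of $\phi^*$: let $G^{\mathbb C}$ denote the complexification of $G$. A real analytic map $\phi:W\to\mathbb C$ extends uniquely to a holomorphic map $\phi^{\mathbb C}:W^{\mathbb C}\to\mathbb C$ from some open subset $W^{\mathbb C}$ of $G^{\mathbb C}$. Restricting to $W^*=U\cap W^{\mathbb C}$ gives a real analytic map $\phi^*:W^*\to\mathbb C$ from an open subset $W^*$ of $U$. Let $\mathfrak g=\mathfrak k+\mathfrak p$ be a Cartan decomposition of the Lie algebra of $G$, with $\mathfrak k$ the Lie algebra of a maximal compact subgroup. The standard Riemannian metric on $G$ is left-invariant, and $\mathfrak k$ and $\mathfrak p$ are orthogonal; for the classical matrix groups it is induced by the scalar product $g(Z,W)=\mathrm{Re}\,\mathrm{trace}(ZW^* )$ on $\mathfrak g$. The compact dual $U\subset G^{\mathbb C}$ has Lie algebra $\mathfrak u=\mathfrak k+i\mathfrak p$, and its dual semi-Riemannian metric is the left-invariant one given on $\mathfrak u$ by $\langle Y+iX,Y'+iX'\rangle=-g(Y,Y')+g(X,X')$ for $Y,Y'\in\mathfrak k$, $X,X'\in\mathfrak p$. Thus if $Y_1,\dots,Y_m$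 and $X_1,\dots,X_n$ are orthonormal bases of $\mathfrak k$ and $\mathfrak p$ (left-invariant vector fields), then on $G$: $\tau(\phi)=\sum_kY_k^2(\phi)+\sum_kX_k^2(\phi)$, $\kappa(\phi,\psi)=\sum_kY_k(\phi)Y_k(\psi)+\sum_kX_k(\phi)X_k(\psi)$; and on $U$: $\tau(\phi)=-\sum_kY_k^2(\phi)+\sum_k(iX_k)^2(\phi)$, $\kappa(\phi,\psi)=-\sum_kY_k(\phi)Y_k(\psi)+\sum_k(iX_k)(\phi)(iX_k)(\psi)$. Here $\tau$ is the Laplacian and $\kappa(\phi,\psi)$ is the complex bilinear product of the gradients. A set $\mathcal E$ of complex valued functions is an eigenfamily if there exist $\lambda,\mu\in\mathbb C$ with $\tau(\phi)=\lambda\phi$ and $\kappa(\phi,\psi)=\mu\phi\psi$ for all $\phi,\psi\in\mathcal E$. The union of two non-empty eigenfamilies $\mathcal E_1,\mathcal E_2$ (with possibly different constants) is a bi-eigenfamily if there exists $\mu\in\mathbb C$ with $\kappa(\phi,\psi)=\mu\phi\psi$ for all $\phi\in\mathcal E_1$, $\psi\in\mathcal E_2$.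
   Formalization: The formal theorem assumes a common domain W^C for the family, each of whose connected components meets both W and U; if W* is empty or a component of W^C misses U, the dual family loses information and the "only if" part is false. *)

theory Defs
  imports "HOL-Analysis.Analysis" "HOL-Algebra.Group"
begin

section \<open>Complex Lie groups\<close>

text \<open>
  A complex manifold of dimension \<open>CARD('n)\<close> is a topology together with an atlas, whose members are
  pairs of a domain and a chart map.  Charts are total functions; only their values on the domain
  matter.
\<close>

record ('g, 'n::finite) cx_group = "'g monoid" +
  mtop :: "'g topology"
  atlas :: "('g set \<times> ('g \<Rightarrow> complex ^ 'n)) set"

text \<open>
  Holomorphy in several variables with respect to complex structures \<open>J\<close> and \<open>J'\<close> on source and
  target: the real derivative exists and is complex linear.
\<close>

definition holomorphic_wrt ::
  "('a::real_normed_vector \<Rightarrow> 'a) \<Rightarrow> ('b::real_normed_vector \<Rightarrow> 'b) \<Rightarrow> ('a \<Rightarrow> 'b) \<Rightarrow> 'a set \<Rightarrow> bool" where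
  "holomorphic_wrt J J' f S \<longleftrightarrow>
     (\<forall>x\<in>S. \<exists>f'. (f has_derivative f') (at x) \<and> (\<forall>h. f' (J h) = J' (f' h)))"

definition Jvec :: "complex ^ 'n \<Rightarrow> complex ^ 'n" where
  "Jvec v = \<i> *s v"

definition is_chart :: "'g topology \<Rightarrow> 'g set \<Rightarrow> ('g \<Rightarrow> complex ^ 'n) \<Rightarrow> bool" where
  "is_chart T D c \<longleftrightarrow> openin T D \<and> open (c ` D) \<and>
     homeomorphic_map (subtopology T D) (top_of_set (c ` D)) c"

definition complex_manifold :: "'g topology \<Rightarrow> ('g set \<times> ('g \<Rightarrow> complex ^ 'n::finite)) set \<Rightarrow> bool" where
  "complex_manifold T A \<longleftrightarrow>
     Hausdorff_space T \<and> second_countable T \<and>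
     (\<forall>(D, c)\<in>A. is_chart T D c) \<and> (\<Union>(D, c)\<in>A. D) = topspace T \<and>
     (\<forall>(D, c)\<in>A. \<forall>(E, d)\<in>A.
        holomorphic_wrt Jvec Jvec (d \<circ> inv_into D c) (c ` (D \<inter> E)))"

definition complex_lie_group :: "('g, 'n::finite) cx_group \<Rightarrow> bool" where
  "complex_lie_group L \<longleftrightarrow>
     group L \<and> topspace (mtop L) = carrier L \<and> complex_manifold (mtop L) (atlas L) \<and>
     continuous_map (prod_topology (mtop L) (mtop L)) (mtop L) (\<lambda>(x, y). x \<otimes>\<^bsub>L\<^esub> y) \<and>
     continuous_map (mtop L) (mtop L) (\<lambda>x. inv\<^bsub>L\<^esub> x) \<and>
     (\<forall>(D, c)\<in>atlas L. \<forall>(E, d)\<in>atlas L. \<forall>(R, r)\<in>atlas L.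
        holomorphic_wrt (\<lambda>(u, v). (Jvec u, Jvec v)) Jvec
          (\<lambda>(u, v). r (inv_into D c u \<otimes>\<^bsub>L\<^esub> inv_into E d v))
          {(u, v). u \<in> c ` D \<and> v \<in> d ` E \<and> inv_into D c u \<otimes>\<^bsub>L\<^esub> inv_into E d v \<in> R}) \<and>
     (\<forall>(D, c)\<in>atlas L. \<forall>(E, d)\<in>atlas L.
        holomorphic_wrt Jvec Jvec (\<lambda>u. d (inv\<^bsub>L\<^esub> (inv_into D c u)))
          {u \<in> c ` D. inv\<^bsub>L\<^esub> (inv_into D c u) \<in> E})"

definition holomorphic_fun :: "('g, 'n::finite) cx_group \<Rightarrow> 'g set \<Rightarrow> ('g \<Rightarrow> complex) \<Rightarrow> bool" where
  "holomorphic_fun L S F \<longleftrightarrow>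
     (\<forall>(D, c)\<in>atlas L. holomorphic_wrt Jvec (\<lambda>z. \<i> * z) (F \<circ> inv_into D c) (c ` (D \<inter> S)))"


section \<open>Lie algebras of closed subgroups\<close>

text \<open>
  The tangent space at the identity, that is the Lie algebra of the whole group, is identified with
  \<open>complex ^ 'n\<close> through one chart of the atlas around the identity; multiplication by \<open>\<i>\<close> is its
  complex structure.  The chart need not send the identity to \<open>0\<close>.
\<close>

definition id_chart :: "('g, 'n::finite) cx_group \<Rightarrow> 'g set \<times> ('g \<Rightarrow> complex ^ 'n)" where
  "id_chart L = (SOME p. p \<in> atlas L \<and> \<one>\<^bsub>L\<^esub> \<in> fst p)"

definition coord :: "('g, 'n::finite) cx_group \<Rightarrow> 'g \<Rightarrow> complex ^ 'n" where
  "coord L = snd (id_chart L)"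

definition coord_inv :: "('g, 'n::finite) cx_group \<Rightarrow> complex ^ 'n \<Rightarrow> 'g" where
  "coord_inv L = inv_into (fst (id_chart L)) (snd (id_chart L))"

definition one_param ::
  "('g, 'n::finite) cx_group \<Rightarrow> 'g set \<Rightarrow> complex ^ 'n \<Rightarrow> (real \<Rightarrow> 'g) \<Rightarrow> bool" where
  "one_param L H v \<gamma> \<longleftrightarrow>
     range \<gamma> \<subseteq> H \<and> (\<forall>s t. \<gamma> (s + t) = \<gamma> s \<otimes>\<^bsub>L\<^esub> \<gamma> t) \<and>
     continuous_map euclideanreal (mtop L) \<gamma> \<and>
     ((\<lambda>t. coord L (\<gamma> t)) has_vector_derivative v) (at 0)"

text \<open>
  By the closed subgroup theorem a closed subgroup \<open>H\<close> is an embedded real Lie subgroup, and the set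
  below is its Lie algebra.
\<close>

definition lie_alg :: "('g, 'n::finite) cx_group \<Rightarrow> 'g set \<Rightarrow> (complex ^ 'n) set" where
  "lie_alg L H = {v. \<exists>\<gamma>. one_param L H v \<gamma>}"

text \<open>\<open>one_param_sub L H v t\<close> is \<open>exp (t v)\<close>, for \<open>v\<close> in the Lie algebra of \<open>H\<close>.\<close>

definition one_param_sub :: "('g, 'n::finite) cx_group \<Rightarrow> 'g set \<Rightarrow> complex ^ 'n \<Rightarrow> real \<Rightarrow> 'g" where
  "one_param_sub L H v = (SOME \<gamma>. one_param L H v \<gamma>)"

definition lie_exp :: "('g, 'n::finite) cx_group \<Rightarrow> 'g set \<Rightarrow> complex ^ 'n \<Rightarrow> 'g" where
  "lie_exp L H v = one_param_sub L H v 1"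

definition left_inv_deriv ::
  "('g, 'n::finite) cx_group \<Rightarrow> 'g set \<Rightarrow> complex ^ 'n \<Rightarrow> ('g \<Rightarrow> complex) \<Rightarrow> 'g \<Rightarrow> complex" where
  "left_inv_deriv L H v \<phi> x =
     vector_derivative (\<lambda>t. \<phi> (x \<otimes>\<^bsub>L\<^esub> one_param_sub L H v t)) (at 0)"

definition Ad :: "('g, 'n::finite) cx_group \<Rightarrow> 'g \<Rightarrow> complex ^ 'n \<Rightarrow> complex ^ 'n" where
  "Ad L x w = frechet_derivative
     (\<lambda>u. coord L (x \<otimes>\<^bsub>L\<^esub> coord_inv L u \<otimes>\<^bsub>L\<^esub> inv\<^bsub>L\<^esub> x)) (at (coord L \<one>\<^bsub>L\<^esub>)) w"

text \<open>The Lie bracket is obtained from \<open>ad\<close>, the differential of \<open>Ad\<close> at the identity.\<close>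

definition bracket :: "('g, 'n::finite) cx_group \<Rightarrow> complex ^ 'n \<Rightarrow> complex ^ 'n \<Rightarrow> complex ^ 'n" where
  "bracket L v w = frechet_derivative
     (\<lambda>u. Ad L (coord_inv L u) w) (at (coord L \<one>\<^bsub>L\<^esub>)) v"

definition trace_on :: "'v::real_vector set \<Rightarrow> ('v \<Rightarrow> 'v) \<Rightarrow> real" where
  "trace_on V f =
     (let B = (SOME B. independent B \<and> span B = V) in \<Sum>b\<in>B. representation B (f b) b)"

definition killing :: "('g, 'n::finite) cx_group \<Rightarrow> (complex ^ 'n) set \<Rightarrow> complex ^ 'n \<Rightarrow> complex ^ 'n \<Rightarrow> real" where
  "killing L V X Y = trace_on V (\<lambda>Z. bracket L X (bracket L Y Z))"

definition semisimple :: "('g, 'n::finite) cx_group \<Rightarrow> (complex ^ 'n) set \<Rightarrow> bool" where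
  "semisimple L V \<longleftrightarrow> (\<forall>X\<in>V. (\<forall>Y\<in>V. killing L V X Y = 0) \<longrightarrow> X = 0)"

definition maximal_compact_subgroup :: "('g, 'n::finite) cx_group \<Rightarrow> 'g set \<Rightarrow> 'g set \<Rightarrow> bool" where
  "maximal_compact_subgroup L G K \<longleftrightarrow>
     subgroup K L \<and> K \<subseteq> G \<and> compactin (mtop L) K \<and>
     (\<forall>K'. subgroup K' L \<and> K' \<subseteq> G \<and> compactin (mtop L) K' \<and> K \<subseteq> K' \<longrightarrow> K' = K)"

definition cartan_decomposition ::
  "('g, 'n::finite) cx_group \<Rightarrow> (complex ^ 'n) set \<Rightarrow> (complex ^ 'n) set \<Rightarrow> (complex ^ 'n) set \<Rightarrow> bool" where
  "cartan_decomposition L V k p \<longleftrightarrow>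
     subspace k \<and> subspace p \<and> k \<inter> p = {0} \<and> V = {Y + X | Y X. Y \<in> k \<and> X \<in> p} \<and>
     (\<forall>Y\<in>k. \<forall>Y'\<in>k. bracket L Y Y' \<in> k) \<and>
     (\<forall>Y\<in>k. \<forall>X\<in>p. bracket L Y X \<in> p) \<and>
     (\<forall>X\<in>p. \<forall>X'\<in>p. bracket L X X' \<in> k) \<and>
     (\<forall>Y\<in>k - {0}. killing L V Y Y < 0) \<and> (\<forall>X\<in>p - {0}. killing L V X X > 0)"

text \<open>
  \<open>L\<close> is a complexification of its closed subgroup \<open>G\<close>: the Lie algebra of \<open>L\<close> is the direct sum of
  \<open>\<gg>\<close> and \<open>\<i>\<gg>\<close>.
\<close>

definition is_complexification :: "('g, 'n::finite) cx_group \<Rightarrow> 'g set \<Rightarrow> bool" where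
  "is_complexification L G \<longleftrightarrow>
     complex_lie_group L \<and> subgroup G L \<and> closedin (mtop L) G \<and>
     (\<forall>Z. \<exists>!(X, Y). X \<in> lie_alg L G \<and> Y \<in> lie_alg L G \<and> Z = X + \<i> *s Y)"

definition dual_alg :: "(complex ^ 'n) set \<Rightarrow> (complex ^ 'n) set \<Rightarrow> (complex ^ 'n) set" where
  "dual_alg k p = {Y + \<i> *s X | Y X. Y \<in> k \<and> X \<in> p}"

text \<open>The compact dual is not required to be connected.\<close>

definition is_compact_dual ::
  "('g, 'n::finite) cx_group \<Rightarrow> (complex ^ 'n) set \<Rightarrow> (complex ^ 'n) set \<Rightarrow> 'g set \<Rightarrow> bool" where
  "is_compact_dual L k p U \<longleftrightarrow>
     subgroup U L \<and> compactin (mtop L) U \<and> lie_alg L U = dual_alg k p"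


section \<open>Left-invariant semi-Riemannian metrics\<close>

text \<open>A left-invariant metric is given by its scalar product on the Lie algebra.\<close>

definition inner_product_on :: "'v::real_vector set \<Rightarrow> ('v \<Rightarrow> 'v \<Rightarrow> real) \<Rightarrow> bool" where
  "inner_product_on V m \<longleftrightarrow>
     (\<forall>x\<in>V. \<forall>y\<in>V. \<forall>z\<in>V. \<forall>a. m (a *\<^sub>R x + y) z = a * m x z + m y z) \<and>
     (\<forall>x\<in>V. \<forall>y\<in>V. m x y = m y x) \<and>
     (\<forall>x\<in>V. x \<noteq> 0 \<longrightarrow> m x x > 0)"

text \<open>
  The standard Riemannian metric enters only as a left-invariant one for which \<open>\<kk>\<close> and \<open>\<pp>\<close> are
  orthogonal. This covers \<open>Re trace (Z W\<^sup>*)\<close> on the classical groups as well as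
  the metric induced by the Killing form and the Cartan involution.
\<close>

definition standard_metric ::
  "(complex ^ 'n) set \<Rightarrow> (complex ^ 'n) set \<Rightarrow> (complex ^ 'n) set \<Rightarrow>
     (complex ^ 'n \<Rightarrow> complex ^ 'n \<Rightarrow> real) \<Rightarrow> bool" where
  "standard_metric V k p m \<longleftrightarrow> inner_product_on V m \<and> (\<forall>Y\<in>k. \<forall>X\<in>p. m Y X = 0)"

definition dual_metric ::
  "(complex ^ 'n) set \<Rightarrow> (complex ^ 'n) set \<Rightarrow> (complex ^ 'n \<Rightarrow> complex ^ 'n \<Rightarrow> real) \<Rightarrow>
     complex ^ 'n \<Rightarrow> complex ^ 'n \<Rightarrow> real" where
  "dual_metric k p m Z Z' =
     (THE r. \<exists>Y\<in>k. \<exists>X\<in>p. \<exists>Y'\<in>k. \<exists>X'\<in>p.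
        Z = Y + \<i> *s X \<and> Z' = Y' + \<i> *s X' \<and> r = - m Y Y' + m X X')"

definition orthonormal_frame ::
  "'v::real_vector set \<Rightarrow> ('v \<Rightarrow> 'v \<Rightarrow> real) \<Rightarrow> 'v set \<Rightarrow> bool" where
  "orthonormal_frame V m E \<longleftrightarrow>
     independent E \<and> span E = V \<and> (\<forall>e\<in>E. \<bar>m e e\<bar> = 1) \<and> (\<forall>e\<in>E. \<forall>f\<in>E. e \<noteq> f \<longrightarrow> m e f = 0)"

definition frame :: "'v::real_vector set \<Rightarrow> ('v \<Rightarrow> 'v \<Rightarrow> real) \<Rightarrow> 'v set" where
  "frame V m = (SOME E. orthonormal_frame V m E)"

text \<open>The Levi-Civita connection on left-invariant vector fields, by Koszul's formula.\<close>

definition levi_civita ::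
  "('g, 'n::finite) cx_group \<Rightarrow> (complex ^ 'n) set \<Rightarrow> (complex ^ 'n \<Rightarrow> complex ^ 'n \<Rightarrow> real) \<Rightarrow>
     complex ^ 'n \<Rightarrow> complex ^ 'n \<Rightarrow> complex ^ 'n" where
  "levi_civita L V m X Y = (THE Z. Z \<in> V \<and> (\<forall>T\<in>V.
     2 * m Z T = m (bracket L X Y) T - m (bracket L Y T) X + m (bracket L T X) Y))"

text \<open>
  The Laplacian is the trace of the Hessian with respect to the metric; \<open>m e e\<close> is the sign of the
  frame vector \<open>e\<close>. On semisimple groups the first order terms cancel, leaving
  a signed sum of squares.
\<close>

definition laplacian ::
  "('g, 'n::finite) cx_group \<Rightarrow> 'g set \<Rightarrow> (complex ^ 'n \<Rightarrow> complex ^ 'n \<Rightarrow> real) \<Rightarrow>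
     ('g \<Rightarrow> complex) \<Rightarrow> 'g \<Rightarrow> complex" where
  "laplacian L H m \<phi> x = (\<Sum>e\<in>frame (lie_alg L H) m. complex_of_real (m e e) *
     (left_inv_deriv L H e (left_inv_deriv L H e \<phi>) x -
      left_inv_deriv L H (levi_civita L (lie_alg L H) m e e) \<phi> x))"

definition conformality ::
  "('g, 'n::finite) cx_group \<Rightarrow> 'g set \<Rightarrow> (complex ^ 'n \<Rightarrow> complex ^ 'n \<Rightarrow> real) \<Rightarrow>
     ('g \<Rightarrow> complex) \<Rightarrow> ('g \<Rightarrow> complex) \<Rightarrow> 'g \<Rightarrow> complex" where
  "conformality L H m \<phi> \<psi> x = (\<Sum>e\<in>frame (lie_alg L H) m. complex_of_real (m e e) *
     (left_inv_deriv L H e \<phi> x * left_inv_deriv L H e \<psi> x))"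


section \<open>Eigenfamilies\<close>

text \<open>Families of functions on an open subset \<open>W\<close> of \<open>H\<close>; values outside \<open>W\<close> are irrelevant.\<close>

definition eigenfamily ::
  "('g, 'n::finite) cx_group \<Rightarrow> 'g set \<Rightarrow> (complex ^ 'n \<Rightarrow> complex ^ 'n \<Rightarrow> real) \<Rightarrow>
     'g set \<Rightarrow> ('g \<Rightarrow> complex) set \<Rightarrow> bool" where
  "eigenfamily L H m W E \<longleftrightarrow> (\<exists>l \<mu>. \<forall>\<phi>\<in>E. \<forall>\<psi>\<in>E. \<forall>x\<in>W.
     laplacian L H m \<phi> x = l * \<phi> x \<and> conformality L H m \<phi> \<psi> x = \<mu> * \<phi> x * \<psi> x)"

definition bi_eigenfamily ::
  "('g, 'n::finite) cx_group \<Rightarrow> 'g set \<Rightarrow> (complex ^ 'n \<Rightarrow> complex ^ 'n \<Rightarrow> real) \<Rightarrow>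
     'g set \<Rightarrow> ('g \<Rightarrow> complex) set \<Rightarrow> bool" where
  "bi_eigenfamily L H m W B \<longleftrightarrow> (\<exists>E1 E2. E1 \<noteq> {} \<and> E2 \<noteq> {} \<and> B = E1 \<union> E2 \<and>
     eigenfamily L H m W E1 \<and> eigenfamily L H m W E2 \<and>
     (\<exists>\<mu>. \<forall>\<phi>\<in>E1. \<forall>\<psi>\<in>E2. \<forall>x\<in>W. conformality L H m \<phi> \<psi> x = \<mu> * \<phi> x * \<psi> x))"


section \<open>Real analytic maps and the dual family\<close>

text \<open>
  Around each point \<open>x\<close> of \<open>W\<close> the map is the sum of a convergent power series in the canonical
  coordinates \<open>h\<close> given by \<open>x \<otimes> exp (\<Sum>b. h b b)\<close>; \<open>\<alpha>\<close> ranges over multi-indices.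
\<close>

definition real_analytic_on ::
  "('g, 'n::finite) cx_group \<Rightarrow> 'g set \<Rightarrow> 'g set \<Rightarrow> ('g \<Rightarrow> complex) \<Rightarrow> bool" where
  "real_analytic_on L H W \<phi> \<longleftrightarrow> (\<forall>x\<in>W. \<exists>B a r.
     independent B \<and> span B = lie_alg L H \<and> r > 0 \<and>
     (\<forall>h. (\<forall>b\<in>B. \<bar>h b\<bar> < r) \<longrightarrow>
        ((\<lambda>\<alpha>. a \<alpha> * (\<Prod>b\<in>B. complex_of_real (h b) ^ \<alpha> b)) has_sum
           \<phi> (x \<otimes>\<^bsub>L\<^esub> lie_exp L H (\<Sum>b\<in>B. h b *\<^sub>R b)))
          (B \<rightarrow>\<^sub>E (UNIV :: nat set))))"

definition holomorphic_extension ::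
  "('g, 'n::finite) cx_group \<Rightarrow> 'g set \<Rightarrow> 'g set \<Rightarrow> ('g \<Rightarrow> complex) \<Rightarrow> ('g \<Rightarrow> complex) \<Rightarrow> bool" where
  "holomorphic_extension L W WC \<phi> F \<longleftrightarrow> holomorphic_fun L WC F \<and> (\<forall>x\<in>W. F x = \<phi> x)"

text \<open>
  The values of the extension on \<open>WC\<close> do not depend on the choice as soon as every connected
  component of \<open>WC\<close> meets \<open>W\<close>.
\<close>

definition dual_map ::
  "('g, 'n::finite) cx_group \<Rightarrow> 'g set \<Rightarrow> 'g set \<Rightarrow> 'g set \<Rightarrow> ('g \<Rightarrow> complex) \<Rightarrow> 'g \<Rightarrow> complex" where
  "dual_map L W WC U \<phi> = restrict (SOME F. holomorphic_extension L W WC \<phi> F) (U \<inter> WC)"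

end

theory Submission
  imports Defs "HOL-Complex_Analysis.Conformal_Mappings"
begin

text \<open>
  For a holomorphic function \<open>F\<close> on an open subset of \<open>L\<close>, the derivative along a left-invariant vector
  field \<open>v\<close> is complex linear in \<open>v\<close> and again holomorphic. Hence an orthonormal frame \<open>Y\<^sub>k, X\<^sub>k\<close> of
  \<open>\<kk> + \<pp>\<close> and the frame \<open>Y\<^sub>k, \<i> X\<^sub>k\<close> of \<open>\<kk> + \<i> \<pp>\<close> give the same holomorphic differential operators up
  to the sign \<open>- 1\<close>. The eigenfamily equations say that certain holomorphic functions vanish on \<open>W\<close> or on
  \<open>U \<inter> WC\<close>, and either is equivalent to vanishing on \<open>WC\<close>, since the tangent spaces of \<open>G\<close> and of \<open>U\<close>
  span that of \<open>L\<close> over the complex numbers.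
\<close>

section \<open>Holomorphic functions of several variables\<close>

text \<open>\<open>G\<close> and \<open>U\<close> come without charts of their own; they are
  accessible only through their one-parameter subgroups. So vanishing on \<open>W\<close> is never
  rewritten as vanishing on a real slice in coordinates. It is used only along the curves
  \<open>t \<mapsto> x exp (t v)\<close>, with one velocity at a time, and power series expansion at
  \<open>x\<close> has to extract everything from that. Holomorphy means that the real differential
  exists and is complex linear; continuity of the differential is not part of it. Second-order
  operators therefore make sense only once derivatives are known to be holomorphic again, which is
  where Cauchy's formula enters. The Laplacian also contains the Levi-Civita term. Summed over a
  frame it is the derivative along a single vector, the one representing
  \<open>t \<mapsto> trace (ad t)\<close>, and it has to be compared between \<open>G\<close> and
  \<open>U\<close> as well. Second-order part, first-order part and conformality operator all
  acquire the same factor -1, so constants \<lambda> and \<mu> on one side become -\<lambda> and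
  -\<mu> on the other. This includes the constant linking the two subfamilies.\<close>

locale complex_structure =
  fixes J :: "'a::euclidean_space \<Rightarrow> 'a"
  assumes linear_J: "linear J" and J_J: "\<And>x. J (J x) = - x"
begin

text \<open>Complex scalar multiplication as determined by \<open>J\<close>. Keeping
  \<open>J\<close> abstract lets the same results be applied on \<open>complex ^ 'n\<close>, on its
  square, and on its product with \<open>complex\<close>.\<close>

definition cscale :: "complex \<Rightarrow> 'a \<Rightarrow> 'a" where
  "cscale z v = Re z *\<^sub>R v + Im z *\<^sub>R J v"

lemma J_simps [simp]:
  "J (x + y) = J x + J y" "J (r *\<^sub>R x) = r *\<^sub>R J x" "J 0 = 0" "J (- x) = - J x" "J (x - y) = J x - J y"
  using linear_J by (auto simp: linear_add linear_scale linear_0 linear_neg linear_diff)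

lemma cscale_i: "cscale \<i> v = J v"
  by (simp add: cscale_def)

lemma cscale_of_real: "cscale (of_real r) v = r *\<^sub>R v"
  by (simp add: cscale_def)

lemma cscale_0 [simp]: "cscale 0 v = 0" "cscale z 0 = 0"
  by (simp_all add: cscale_def)

lemma bounded_bilinear_cscale: "bounded_bilinear cscale"
  unfolding bilinear_conv_bounded_bilinear[symmetric] bilinear_def
  by (auto intro!: linearI simp: cscale_def algebra_simps scaleR_add_left)

lemmas continuous_on_cscale [continuous_intros] =
  bounded_bilinear.continuous_on[OF bounded_bilinear_cscale]
lemmas has_derivative_cscale [derivative_intros] =
  bounded_bilinear.FDERIV[OF bounded_bilinear_cscale]

lemma linear_cscale: assumes "linear f" "\<And>h. f (J h) = \<i> * f h"
  shows "f (cscale z v) = z * f v"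
  using assms by (simp add: cscale_def linear_add linear_scale complex_eq_iff algebra_simps)

end

lemma holomorphic_wrt_frechet:
  assumes "holomorphic_wrt J J' f S" "x \<in> S"
  shows "(f has_derivative frechet_derivative f (at x)) (at x)"
    and "frechet_derivative f (at x) (J h) = J' (frechet_derivative f (at x) h)"
proof -
  obtain f' where f': "(f has_derivative f') (at x)" "\<And>h. f' (J h) = J' (f' h)"
    using assms by (auto simp: holomorphic_wrt_def)
  then have "f' = frechet_derivative f (at x)" by (simp add: frechet_derivative_at)
  with f' show "(f has_derivative frechet_derivative f (at x)) (at x)"
    "frechet_derivative f (at x) (J h) = J' (frechet_derivative f (at x) h)" by auto
qed

lemma holomorphic_wrt_continuous_on:
  assumes "holomorphic_wrt J J' f S" shows "continuous_on S f"
  using assms holomorphic_wrt_frechet(1) has_derivative_continuous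
  by (metis continuous_at_imp_continuous_on)

lemma holomorphic_wrt_subset:
  "holomorphic_wrt J J' f S \<Longrightarrow> T \<subseteq> S \<Longrightarrow> holomorphic_wrt J J' f T"
  by (auto simp: holomorphic_wrt_def)

context complex_structure
begin

text \<open>On a complex line a complex linear differential is multiplication by its value at
  \<open>v\<close>; this turns questions about \<open>f\<close> into one-variable complex
  analysis.\<close>

lemma has_field_derivative_line:
  assumes "holomorphic_wrt J ((*) \<i>) f S" "x + cscale z v \<in> S"
  shows "((\<lambda>z. f (x + cscale z v)) has_field_derivative frechet_derivative f (at (x + cscale z v)) v) (at z)"
proof -
  let ?D = "frechet_derivative f (at (x + cscale z v))"
  note D = holomorphic_wrt_frechet[OF assms]
  have "((\<lambda>z. f (x + cscale z v)) has_derivative (\<lambda>h. ?D (cscale h v))) (at z)"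
    by (rule derivative_eq_intros has_derivative_compose[where f = "\<lambda>z. x + cscale z v" and g = f] D(1) | simp)+
  moreover have "?D (cscale h v) = ?D v * h" for h
    using linear_cscale[of ?D h v] D has_derivative_linear by (auto simp: mult.commute)
  ultimately show ?thesis by (simp add: has_field_derivative_def)
qed

lemma norm_cscale_le: obtains C where "C > 0" "\<And>z v. norm (cscale z v) \<le> C * norm z * norm v"
proof -
  obtain C where "\<And>z v. norm (cscale z v) \<le> norm z * norm v * C" "C > 0"
    using bounded_bilinear.pos_bounded[OF bounded_bilinear_cscale] by blast
  then show ?thesis by (intro that[of C]) (auto simp: mult_ac)
qed

text \<open>Cauchy's formula for the first derivative on the circle of radius \<open>r\<close>, as
  an ordinary integral over \<open>{0..1}\<close>. The point \<open>x\<close> occurs only inside the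
  argument of \<open>f\<close>, so that continuity and differentiation under the integral sign
  become available.\<close>

lemma directional_derivative_integral:
  assumes f: "holomorphic_wrt J ((*) \<i>) f S" and r: "r > 0"
    and S: "\<And>z. z \<in> cball 0 r \<Longrightarrow> x + cscale z v \<in> S"
  shows "frechet_derivative f (at x) v =
    integral {0..1} (\<lambda>t. f (x + cscale (of_real r * exp (2 * of_real pi * \<i> * of_real t)) v) *
      (exp (- (2 * of_real pi * \<i> * of_real t)) / of_real r))"
proof -
  let ?g = "\<lambda>z. f (x + cscale z v)"
  let ?e = "\<lambda>t::real. exp (2 * of_real pi * \<i> * of_real t) :: complex"
  have d: "(?g has_field_derivative frechet_derivative f (at (x + cscale z v)) v) (at z)"
    if "z \<in> cball 0 r" for z
    using has_field_derivative_line[OF f] S that by blast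
  have hol: "?g holomorphic_on cball 0 r"
    unfolding holomorphic_on_def field_differentiable_def
    using d has_field_derivative_at_within by blast
  have "(?g has_field_derivative (1 / (2 * of_real pi * \<i>) *
      contour_integral (circlepath 0 r) (\<lambda>u. ?g u / (u - 0)^2))) (at 0)"
  proof (rule Cauchy_derivative_integral_circlepath(2))
    show "continuous_on (cball 0 r) ?g" by (rule holomorphic_on_imp_continuous_on[OF hol])
    show "?g holomorphic_on ball 0 r" by (rule holomorphic_on_subset[OF hol ball_subset_cball])
  qed (use r in simp)
  from DERIV_unique[OF d[of 0] this] r have "frechet_derivative f (at x) v = 1 / (2 * of_real pi * \<i>) *
      contour_integral (circlepath 0 r) (\<lambda>u. ?g u / (u - 0)^2)"
    by simp
  also have "\<dots> = 1 / (2 * of_real pi * \<i>) * integral {0..1} (\<lambda>t. ?g (of_real r * ?e t) / (of_real r * ?e t)^2 *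
      (2 * pi * \<i> * r * ?e t))"
    unfolding contour_integral_integral vector_derivative_circlepath by (simp add: circlepath)
  also have "\<dots> = integral {0..1} (\<lambda>t. 1 / (2 * of_real pi * \<i>) * (?g (of_real r * ?e t) / (of_real r * ?e t)^2 *
      (2 * pi * \<i> * r * ?e t)))"
    by (rule integral_mult_right[symmetric])
  also have "\<dots> = integral {0..1} (\<lambda>t. ?g (of_real r * ?e t) * (exp (- (2 * of_real pi * \<i> * of_real t)) / of_real r))"
    using r by (intro integral_cong) (simp add: exp_minus power2_eq_square field_simps)
  finally show ?thesis .
qed

text \<open>One radius must serve all \<open>x\<close> near \<open>x0\<close>, because Cauchy's
  formula is going to be differentiated in \<open>x\<close>.\<close>

lemma local_disc:
  assumes "open S" "x0 \<in> S"
  obtains d r where "d > 0" "r > 0" "\<And>x z. x \<in> ball x0 d \<Longrightarrow> z \<in> cball 0 r \<Longrightarrow> x + cscale z v \<in> S"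
proof -
  obtain e where e: "e > 0" "ball x0 e \<subseteq> S" using assms openE by blast
  obtain C where C: "C > 0" "\<And>z v. norm (cscale z v) \<le> C * norm z * norm v" using norm_cscale_le by blast
  \<comment> \<open>Chosen so that \<open>cscale z v\<close> has norm at most \<open>e / 2\<close>;
    the summand 1 keeps the denominator positive when \<open>v = 0\<close>.\<close>
  define r where "r = e / (2 * C * (norm v + 1))"
  have r: "r > 0" using e C by (simp add: r_def add_nonneg_pos)
  have "x + cscale z v \<in> S" if x: "x \<in> ball x0 (e/2)" and z: "z \<in> cball 0 r" for x z
  proof -
    have "norm (cscale z v) \<le> C * r * norm v"
      using C(2)[of z v] z C(1) by (smt (verit) mem_cball_0 mult_left_mono mult_right_mono norm_ge_zero)
    also have "\<dots> \<le> e / 2"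
    proof -
      have "C * r * norm v = (e / 2) * (norm v / (norm v + 1))"
        using C(1) by (simp add: r_def)
      also have "\<dots> \<le> (e / 2) * 1"
        using e(1) by (intro mult_left_mono) (auto simp: divide_le_eq_1 intro: add_nonneg_pos)
      finally show ?thesis by simp
    qed
    finally have "dist x (x + cscale z v) \<le> e / 2" by (simp add: dist_norm)
    then have "dist x0 (x + cscale z v) < e" using x dist_triangle[of x0 "x + cscale z v" x] by simp
    then show ?thesis using e(2) by auto
  qed
  with r e(1) show ?thesis by (intro that[of "e/2" r]) auto
qed

text \<open>Cauchy's formula expresses the derivative by values of \<open>f\<close> alone, and these
  are continuous.\<close>

lemma continuous_on_directional_derivative:
  assumes f: "holomorphic_wrt J ((*) \<i>) f S" and "open S"
  shows "continuous_on S (\<lambda>x. frechet_derivative f (at x) v)"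
proof (rule continuous_at_imp_continuous_on, intro ballI)
  fix x0 assume "x0 \<in> S"
  then obtain d r where dr: "d > 0" "r > 0"
      and S: "\<And>x z. x \<in> ball x0 d \<Longrightarrow> z \<in> cball 0 r \<Longrightarrow> x + cscale z v \<in> S"
    using local_disc[OF \<open>open S\<close>] by metis
  let ?F = "\<lambda>x t. f (x + cscale (of_real r * exp (2 * of_real pi * \<i> * of_real t)) v) *
      (exp (- (2 * of_real pi * \<i> * of_real t)) / of_real r)"
  have eq: "frechet_derivative f (at x) v = integral (cbox 0 1) (?F x)" if "x \<in> ball x0 d" for x
    using directional_derivative_integral[OF f dr(2) S] that by (simp add: cbox_interval)
  have "continuous_on (ball x0 d \<times> cbox 0 1) (\<lambda>(x, t). ?F x t)"
    unfolding split_beta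
    by (intro continuous_intros continuous_on_compose2[OF holomorphic_wrt_continuous_on[OF f]])
      (use dr in \<open>auto intro!: S simp: norm_mult\<close>)
  then have "continuous_on (ball x0 d) (\<lambda>x. integral (cbox 0 1) (?F x))"
    by (rule integral_continuous_on_param)
  then have "continuous_on (ball x0 d) (\<lambda>x. frechet_derivative f (at x) v)"
    by (rule continuous_on_eq) (simp add: eq)
  then show "isCont (\<lambda>x. frechet_derivative f (at x) v) x0"
    using dr(1) by (simp add: continuous_on_eq_continuous_at)
qed

text \<open>Differentiation under the integral in Cauchy's formula. It needs the differential of
  \<open>f\<close> to be jointly continuous in the point and the circle parameter; complex linearity
  then passes through the integral.\<close>

lemma holomorphic_directional_derivative:
  assumes f: "holomorphic_wrt J ((*) \<i>) f S" and "open S"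
  shows "holomorphic_wrt J ((*) \<i>) (\<lambda>x. frechet_derivative f (at x) v) S"
  unfolding holomorphic_wrt_def
proof
  fix x0 assume "x0 \<in> S"
  then obtain d r where dr: "d > 0" "r > 0"
      and S: "\<And>x z. x \<in> ball x0 d \<Longrightarrow> z \<in> cball 0 r \<Longrightarrow> x + cscale z v \<in> S"
    using local_disc[OF \<open>open S\<close>] by metis
  define w where "w t = cscale (of_real r * exp (2 * of_real pi * \<i> * of_real t)) v" for t :: real
  define k where "k t = exp (- (2 * of_real pi * \<i> * of_real t)) / (of_real r :: complex)" for t :: real
  \<comment> \<open>\<open>leibniz_rule\<close> takes the derivative as a bounded operator. Its
    joint continuity can be tested on basis vectors, that is, on directional derivatives.\<close>
  define D where "D x t = Blinfun (\<lambda>h. frechet_derivative f (at (x + w t)) h * k t)" for x t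
  have xw: "x + w t \<in> S" if "x \<in> ball x0 d" for x t
    using that dr unfolding w_def by (intro S) (auto simp: norm_mult)
  have fd: "((\<lambda>x. f (x + w t) * k t) has_derivative (\<lambda>h. frechet_derivative f (at (x + w t)) h * k t)) (at x)"
    if "x \<in> ball x0 d" for x t
    by (rule derivative_eq_intros has_derivative_compose[where f = "\<lambda>x. x + w t" and g = f]
          holomorphic_wrt_frechet(1)[OF f xw[OF that]] | simp)+
  have Dap: "blinfun_apply (D x t) = (\<lambda>h. frechet_derivative f (at (x + w t)) h * k t)"
    if "x \<in> ball x0 d" for x t
    unfolding D_def by (rule bounded_linear_Blinfun_apply[OF has_derivative_bounded_linear[OF fd[OF that]]])
  have cw: "continuous_on UNIV w" "continuous_on UNIV k"
    unfolding w_def k_def using dr by (intro continuous_intros; simp)+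
  have cont: "continuous_on (ball x0 d \<times> cbox 0 1) (\<lambda>(x, t). D x t)"
  proof (rule continuous_on_blinfun_componentwise)
    fix i :: 'a
    have "continuous_on (ball x0 d \<times> cbox 0 1) (\<lambda>p. frechet_derivative f (at (fst p + w (snd p))) i * k (snd p))"
      by (intro continuous_intros continuous_on_compose2[OF continuous_on_directional_derivative[OF f \<open>open S\<close>]]
          continuous_on_compose2[OF cw(1)] continuous_on_compose2[OF cw(2)]) (use xw in auto)
    then show "continuous_on (ball x0 d \<times> cbox 0 1) (\<lambda>x. blinfun_apply (case x of (x, t) \<Rightarrow> D x t) i)"
      by (rule continuous_on_eq) (auto simp: Dap)
  qed
  have x0: "x0 \<in> ball x0 d" using dr by simp
  have int: "(\<lambda>t. f (x + w t) * k t) integrable_on cbox 0 1" if "x \<in> ball x0 d" for x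
    by (intro integrable_continuous continuous_intros
          continuous_on_compose2[OF holomorphic_wrt_continuous_on[OF f]]
          continuous_on_compose2[OF cw(1)] continuous_on_compose2[OF cw(2)]) (use xw that in auto)
  have "continuous_on (cbox 0 1) (\<lambda>t::real. (x0, t))" by (intro continuous_intros)
  from continuous_on_compose2[OF cont this] x0 have "continuous_on (cbox 0 1) (D x0)"
    by (simp add: image_subset_iff)
  then have intD: "D x0 integrable_on cbox 0 1" by (rule integrable_continuous)
  have "((\<lambda>x. integral (cbox 0 1) (\<lambda>t. f (x + w t) * k t)) has_derivative
      blinfun_apply (integral (cbox 0 1) (D x0))) (at x0 within ball x0 d)"
  proof (rule leibniz_rule[OF _ int cont x0])
    show "((\<lambda>x. f (x + w t) * k t) has_derivative blinfun_apply (D x t)) (at x within ball x0 d)"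
      if "x \<in> ball x0 d" for x t
      unfolding Dap[OF that] by (rule has_derivative_at_withinI[OF fd[OF that]])
  qed auto
  then have "((\<lambda>x. integral (cbox 0 1) (\<lambda>t. f (x + w t) * k t)) has_derivative
      blinfun_apply (integral (cbox 0 1) (D x0))) (at x0)"
    using x0 at_within_open[of x0 "ball x0 d"] by simp
  then have der: "((\<lambda>x. frechet_derivative f (at x) v) has_derivative
      blinfun_apply (integral (cbox 0 1) (D x0))) (at x0)"
    by (rule has_derivative_transform_within_open[OF _ open_ball x0])
      (use directional_derivative_integral[OF f dr(2) S] in \<open>auto simp: w_def k_def cbox_interval\<close>)
  have "blinfun_apply (integral (cbox 0 1) (D x0)) (J h) = \<i> * blinfun_apply (integral (cbox 0 1) (D x0)) h" for h
    unfolding blinfun_apply_integral[OF intD] integral_mult_right[symmetric]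
    by (intro integral_cong) (simp add: Dap[OF x0] holomorphic_wrt_frechet(2)[OF f xw[OF x0]])
  with der show "\<exists>f'. ((\<lambda>x. frechet_derivative f (at x) v) has_derivative f') (at x0) \<and> (\<forall>h. f' (J h) = \<i> * f' h)"
    by blast
qed

end

lemma complex_structure_mult_i: "complex_structure ((*) \<i>)"
  by unfold_locales (auto intro!: linearI simp: algebra_simps)

lemma cscale_complex: "complex_structure.cscale ((*) \<i>) z w = z * w"
  by (simp add: complex_structure.cscale_def[OF complex_structure_mult_i] complex_eq_iff)

lemma complex_structure_prod:
  assumes "complex_structure J" "complex_structure J'"
  shows "complex_structure (\<lambda>(u, v). (J u, J' v))"
proof -
  interpret J: complex_structure J by fact
  interpret J': complex_structure J' by fact
  show ?thesis by unfold_locales (auto intro!: linearI simp: J.J_J J'.J_J)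
qed

lemma cscale_prod:
  assumes "complex_structure J" "complex_structure J'"
  shows "complex_structure.cscale (\<lambda>(u, v). (J u, J' v)) z (u, v) =
    (complex_structure.cscale J z u, complex_structure.cscale J' z v)"
  using assms by (simp add: complex_structure.cscale_def complex_structure_prod)

context complex_structure
begin

text \<open>
  The lowest order homogeneous part \<open>P\<close> of \<open>f\<close> at \<open>a\<close> satisfies \<open>P v = lim t\<^sup>-\<^sup>k f (c t)\<close> along a
  curve \<open>c\<close> with velocity \<open>v\<close>, so it vanishes on \<open>V\<close>, and hence everywhere.
\<close>

lemma vanishing_on_curves:
  assumes f: "holomorphic_wrt J ((*) \<i>) f S" and "open S" "a \<in> S"
    and V: "subspace V" "\<And>w. \<exists>x\<in>V. \<exists>y\<in>V. w = x + J y"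
    and c: "\<And>v. v \<in> V \<Longrightarrow> \<exists>c. c 0 = a \<and> (c has_vector_derivative v) (at (0::real)) \<and>
      (\<forall>\<^sub>F t in at 0. f (c t) = 0)"
  shows "\<forall>\<^sub>F x in nhds a. f x = 0"
proof -
  \<comment> \<open>\<open>f (a + z w)\<close> is studied as a function of the pair
    \<open>(w, z)\<close>: joint holomorphy makes every \<open>z\<close>-derivative continuous and
    holomorphic in the direction \<open>w\<close> too.\<close>
  define J2 :: "'a \<times> complex \<Rightarrow> 'a \<times> complex" where "J2 = (\<lambda>(u, z). (J u, \<i> * z))"
  interpret P: complex_structure J2
    unfolding J2_def by (intro complex_structure_prod complex_structure_mult_i) unfold_locales
  have csc2: "P.cscale z (u, v) = (cscale z u, z * v)" for z u v
    unfolding J2_def using cscale_prod[OF complex_structure_axioms complex_structure_mult_i]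
    by (simp add: cscale_complex)
  define S2 where "S2 = {p::'a \<times> complex. a + cscale (snd p) (fst p) \<in> S}"
  have "open ((\<lambda>p. a + cscale (snd p) (fst p)) -` S)"
    by (intro open_vimage \<open>open S\<close> continuous_intros)
  then have "open S2" by (simp add: S2_def vimage_def)
  have S20: "(w, 0) \<in> S2" "(0, z) \<in> S2" for w z using \<open>a \<in> S\<close> by (auto simp: S2_def)
  \<comment> \<open>\<open>Q k (w, z)\<close> is the \<open>k\<close>-th derivative in
    \<open>z\<close>. At \<open>z = 0\<close> it is \<open>k!\<close> times the homogeneous part of
    degree \<open>k\<close> of \<open>f\<close> at \<open>a\<close>, evaluated at
    \<open>w\<close>.\<close>
  define Q where "Q k = ((\<lambda>h p. frechet_derivative h (at p) (0, 1)) ^^ k) (\<lambda>p. f (a + cscale (snd p) (fst p)))" for k :: nat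
  have Q0: "Q 0 = (\<lambda>p. f (a + cscale (snd p) (fst p)))"
    and QS: "Q (Suc k) = (\<lambda>p. frechet_derivative (Q k) (at p) (0, 1))" for k
    by (simp_all add: Q_def)
  have Qhol: "holomorphic_wrt J2 ((*) \<i>) (Q k) S2" for k
  proof (induction k)
    case 0
    show ?case unfolding holomorphic_wrt_def
    proof
      fix p assume "p \<in> S2"
      then have p: "a + cscale (snd p) (fst p) \<in> S" by (simp add: S2_def)
      let ?D = "frechet_derivative f (at (a + cscale (snd p) (fst p)))"
      have "(Q 0 has_derivative (\<lambda>h. ?D (cscale (snd p) (fst h) + cscale (snd h) (fst p)))) (at p)"
        unfolding Q0
        by (rule derivative_eq_intros has_derivative_compose[where f = "\<lambda>p. a + cscale (snd p) (fst p)" and g = f]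
            holomorphic_wrt_frechet(1)[OF f p] | simp)+
      moreover have "?D (cscale (snd p) (fst (J2 h)) + cscale (snd (J2 h)) (fst p)) =
          \<i> * ?D (cscale (snd p) (fst h) + cscale (snd h) (fst p))" for h
      proof -
        have "cscale (snd p) (fst (J2 h)) + cscale (snd (J2 h)) (fst p) = J (cscale (snd p) (fst h) + cscale (snd h) (fst p))"
          by (cases h) (simp add: J2_def cscale_def J_J algebra_simps)
        then show ?thesis using holomorphic_wrt_frechet(2)[OF f p] by (simp del: J_simps)
      qed
      ultimately show "\<exists>f'. (Q 0 has_derivative f') (at p) \<and> (\<forall>h. f' (J2 h) = \<i> * f' h)" by blast
    qed
  next
    case (Suc k)
    then show ?case unfolding QS by (rule P.holomorphic_directional_derivative[OF _ \<open>open S2\<close>])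
  qed
  have Qcont: "isCont (Q k) p" if "p \<in> S2" for k p
    using holomorphic_wrt_continuous_on[OF Qhol] that \<open>open S2\<close> by (simp add: continuous_on_eq_continuous_at)
  have Qder: "((\<lambda>z. Q k (w, z)) has_field_derivative Q (Suc k) (w, z)) (at z)" if "(w, z) \<in> S2" for k w z
    using P.has_field_derivative_line[OF Qhol, of "(w, 0)" z "(0, 1)" k] that by (simp add: csc2 QS)
  have Q: "Q k (w, 0) = 0" for k w
  proof (induction k arbitrary: w rule: less_induct)
    case (less k)
    have QV: "Q k (v, 0) = 0" if v: "v \<in> V" for v
    proof -
      obtain c where c0: "c 0 = a" and cd: "(c has_vector_derivative v) (at (0::real))"
        and fc: "\<forall>\<^sub>F t in at 0. f (c t) = 0" using c[OF v] by blast
      \<comment> \<open>Since \<open>c t = a + t w t\<close> with \<open>w t\<close> tending to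
        \<open>v\<close>, the curve point is reached along the line in the moving direction
        \<open>w t\<close> at the real parameter \<open>t\<close>.\<close>
      define w where "w t = (c t - a) /\<^sub>R t" for t
      have w: "(w \<longlongrightarrow> v) (at 0)"
      proof (rule LIM_zero_cancel, rule tendsto_norm_zero_cancel, rule Lim_transform_eventually)
        show "((\<lambda>t. norm (c t - c 0 - t *\<^sub>R v) / norm t) \<longlongrightarrow> 0) (at 0)"
          using cd by (simp add: has_vector_derivative_def has_derivative_at)
        have "norm (c t - c 0 - t *\<^sub>R v) / norm t = norm (w t - v)" if "t \<noteq> 0" for t
        proof -
          have "w t - v = (c t - c 0 - t *\<^sub>R v) /\<^sub>R t"
            using that by (simp add: w_def c0 scaleR_diff_right)
          then show ?thesis by (simp add: divide_inverse mult.commute)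
        qed
        then show "\<forall>\<^sub>F t in at 0. norm (c t - c 0 - t *\<^sub>R v) / norm t = norm (w t - v)"
          by (simp add: eventually_at_filter)
      qed
      \<comment> \<open>The Taylor remainder needs a bound on the next derivative that is uniform
        for directions near \<open>v\<close> and for small \<open>z\<close>.\<close>
      have "isCont (Q (Suc k)) (v, 0)" by (rule Qcont[OF S20(1)])
      then have "\<forall>\<^sub>F p in nhds (v, 0). dist (Q (Suc k) p) (Q (Suc k) (v, 0)) < 1"
        unfolding isCont_def tendsto_at_iff_tendsto_nhds by (rule tendstoD) simp
      then have "\<forall>\<^sub>F p in nhds (v, 0). norm (Q (Suc k) p) \<le> norm (Q (Suc k) (v, 0)) + 1"
        by eventually_elim (smt (verit) dist_norm norm_triangle_ineq2)
      moreover have "\<forall>\<^sub>F p in nhds (v, 0). p \<in> S2"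
        using \<open>open S2\<close> S20 eventually_nhds_in_open by blast
      ultimately have "\<forall>\<^sub>F p in nhds v \<times>\<^sub>F nhds 0. norm (Q (Suc k) p) \<le> norm (Q (Suc k) (v, 0)) + 1 \<and> p \<in> S2"
        unfolding nhds_prod by (rule eventually_conj)
      then obtain A B where A: "eventually A (nhds v)" and B: "eventually B (nhds (0::complex))"
        and AB: "\<And>x y. A x \<Longrightarrow> B y \<Longrightarrow> norm (Q (Suc k) (x, y)) \<le> norm (Q (Suc k) (v, 0)) + 1 \<and> (x, y) \<in> S2"
        unfolding eventually_prod_filter by blast
      obtain e where e: "e > 0" "\<And>z::complex. z \<in> ball 0 e \<Longrightarrow> B z"
        using B unfolding eventually_nhds_metric by (auto simp: dist_commute)
      have "\<forall>\<^sub>F t in at 0. A (w t)" using w A by (simp add: filterlim_iff)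
      moreover have "\<forall>\<^sub>F t in at (0::real). norm t < e"
        using e(1) by (auto simp: eventually_at dist_norm)
      moreover have "\<forall>\<^sub>F t in at (0::real). t \<noteq> 0" by (simp add: eventually_at_filter)
      ultimately have bd: "\<forall>\<^sub>F t in at 0. norm (Q k (w t, 0)) \<le> (norm (Q (Suc k) (v, 0)) + 1) * norm t"
        using fc
      proof eventually_elim
        case (elim t)
        let ?B = "norm (Q (Suc k) (v, 0)) + 1"
        have mem: "(w t, z) \<in> S2" "norm (Q (Suc k) (w t, z)) \<le> ?B" if "z \<in> ball 0 e" for z
          using AB[OF elim(1) e(2)[OF that]] by auto
        \<comment> \<open>Taylor expansion of order \<open>k\<close>: the value is
          \<open>f (c t) = 0\<close> and the terms below degree \<open>k\<close> vanish by
          induction. One term of order \<open>t^k\<close> is left against an error of order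
          \<open>t^(k+1)\<close>.\<close>
        have "norm (Q 0 (w t, of_real t) - (\<Sum>i\<le>k. Q i (w t, 0) * (of_real t - 0) ^ i / fact i))
            \<le> ?B * norm (complex_of_real t - 0) ^ Suc k / fact k"
          by (rule field_Taylor[where S = "ball 0 e" and f = "\<lambda>i z. Q i (w t, z)"])
            (use elim e(1) mem in \<open>auto intro: has_field_derivative_at_within Qder\<close>)
        moreover have "Q 0 (w t, of_real t) = 0"
          using elim by (simp add: Q0 cscale_of_real w_def)
        moreover have "(\<Sum>i\<le>k. Q i (w t, 0) * (of_real t - 0) ^ i / fact i) = Q k (w t, 0) * of_real t ^ k / fact k"
          by (subst sum.remove[of _ k]) (auto intro!: sum.neutral simp: less)
        ultimately have "norm (Q k (w t, 0)) * norm t ^ k \<le> ?B * norm t * norm t ^ k"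
          by (simp add: norm_mult norm_divide norm_power divide_le_cancel mult_ac)
        then show ?case using elim by simp
      qed
      have "((\<lambda>t::real. (norm (Q (Suc k) (v, 0)) + 1) * norm t) \<longlongrightarrow> (norm (Q (Suc k) (v, 0)) + 1) * norm (0::real)) (at 0)"
        by (intro tendsto_intros)
      then have "((\<lambda>t. Q k (w t, 0)) \<longlongrightarrow> 0) (at 0)"
        by (intro Lim_null_comparison[OF bd]) simp
      moreover have "((\<lambda>t. Q k (w t, 0)) \<longlongrightarrow> Q k (v, 0)) (at 0)"
        by (rule isCont_tendsto_compose[OF Qcont[OF S20(1)]]) (intro tendsto_intros w)
      ultimately show ?thesis using tendsto_unique[OF _ _ _] trivial_limit_at by blast
    qed
    obtain x y where xy: "x \<in> V" "y \<in> V" "w = x + J y" using V(2) by blast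
    \<comment> \<open>For real \<open>z\<close> the vector \<open>x + z y\<close> lies in
      \<open>V\<close>. So an entire function of \<open>z\<close> vanishes on the real axis, hence
      everywhere, and \<open>z = \<i>\<close> yields \<open>w\<close>.\<close>
    have "Q k (x + cscale z y, 0) = 0" for z
    proof (rule analytic_continuation[where f = "\<lambda>z. Q k (x + cscale z y, 0)" and w = z and S = UNIV and U = "\<real>" and \<xi> = 0])
      show "(\<lambda>z. Q k (x + cscale z y, 0)) holomorphic_on UNIV"
        using P.has_field_derivative_line[OF Qhol, of "(x, 0)" _ "(y, 0)" k] S20
        by (auto simp: holomorphic_on_def field_differentiable_def csc2)
      show "Q k (x + cscale z y, 0) = 0" if "z \<in> \<real>" for z
        using that xy V(1) by (auto elim!: Reals_cases simp: cscale_of_real intro!: QV subspace_add subspace_scale)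
      show "(0::complex) islimpt \<real>"
        unfolding islimpt_approachable
      proof (intro allI impI)
        fix e :: real assume "e > 0"
        then show "\<exists>x'\<in>\<real>. x' \<noteq> 0 \<and> dist x' (0::complex) < e"
          by (intro bexI[of _ "of_real (e / 2)"]) auto
      qed
    qed auto
    from this[of \<i>] show ?case using xy by (simp add: cscale_i)
  qed
  obtain C where C: "C > 0" "\<And>z v. norm (cscale z v) \<le> C * norm z * norm v" using norm_cscale_le by blast
  obtain r where r: "r > 0" "ball a r \<subseteq> S" using \<open>open S\<close> \<open>a \<in> S\<close> openE by blast
  \<comment> \<open>With this bound the disc of radius 2 in the direction \<open>x - a\<close> is
    mapped into \<open>S\<close>, and the parameter 1, which corresponds to \<open>x\<close>, is
    interior to it.\<close>
  have "f x = 0" if x: "dist x a < r / (2 * C)" for x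
  proof -
    define w where "w = x - a"
    have mem: "(w, z) \<in> S2" if "z \<in> ball 0 2" for z
    proof -
      have "norm (cscale z w) \<le> C * norm z * norm w" by (rule C)
      also have "\<dots> \<le> C * 2 * norm w" using that C(1) by (intro mult_left_mono mult_right_mono) auto
      also have "\<dots> < r" using x C(1) by (simp add: w_def dist_norm field_simps)
      finally show ?thesis using r(2) by (auto simp: S2_def dist_norm)
    qed
    have der: "z \<in> ball 0 2 \<longrightarrow> (deriv ^^ n) (\<lambda>z. Q 0 (w, z)) z = Q n (w, z)" for n z
    proof (induction n arbitrary: z)
      case (Suc n)
      show ?case
      proof
        assume z: "z \<in> ball 0 2"
        have "((deriv ^^ n) (\<lambda>z. Q 0 (w, z)) has_field_derivative Q (Suc n) (w, z)) (at z)"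
          by (rule has_field_derivative_transform_within_open[OF Qder[OF mem[OF z]] open_ball z])
            (use Suc in auto)
        then show "(deriv ^^ Suc n) (\<lambda>z. Q 0 (w, z)) z = Q (Suc n) (w, z)" by (simp add: DERIV_imp_deriv)
      qed
    qed simp
    have "Q 0 (w, 1) = 0"
    proof (rule holomorphic_fun_eq_0_on_ball[where f = "\<lambda>z. Q 0 (w, z)" and w = 1 and z = 0 and r = 2])
      show "(\<lambda>z. Q 0 (w, z)) holomorphic_on ball 0 2"
        using Qder[OF mem] has_field_derivative_at_within
        unfolding holomorphic_on_def field_differentiable_def by blast
    qed (use der Q in auto)
    then show ?thesis using cscale_of_real[of 1] by (simp add: Q0 w_def)
  qed
  then show ?thesis
    unfolding eventually_nhds_metric using r(1) C(1) by (intro exI[of _ "r / (2 * C)"]) auto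
qed

end

section \<open>Calculus on a complex Lie group\<close>

text \<open>Holomorphy is a condition on full derivatives at single points, so the domain
  \<open>{a}\<close> just says that the differential at \<open>a\<close> is complex linear.
  Composition then needs no bookkeeping of domains.\<close>

lemma holomorphic_wrt_compose:
  assumes "holomorphic_wrt J J' f {a}" "holomorphic_wrt J' J'' g {f a}"
  shows "holomorphic_wrt J J'' (g \<circ> f) {a}"
proof -
  obtain f' g' where "(f has_derivative f') (at a)" "(g has_derivative g') (at (f a))"
    "\<And>h. f' (J h) = J' (f' h)" "\<And>h. g' (J' h) = J'' (g' h)"
    using assms by (auto simp: holomorphic_wrt_def)
  then show ?thesis unfolding holomorphic_wrt_def
    by (auto intro!: exI[of _ "g' \<circ> f'"] diff_chain_at)
qed

lemma holomorphic_wrt_cong: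
  assumes "holomorphic_wrt J J' f {a}" "\<forall>\<^sub>F x in nhds a. f x = g x"
  shows "holomorphic_wrt J J' g {a}"
proof -
  have "\<forall>\<^sub>F x in at a. f x = g x" "f a = g a"
    using assms(2) eventually_nhds_x_imp_x[OF assms(2)]
    by (auto simp: eventually_at_filter elim: eventually_mono)
  with assms(1) show ?thesis
    by (auto simp: holomorphic_wrt_def intro: has_derivative_transform_eventually)
qed

lemma holomorphic_wrt_Pair:
  assumes "holomorphic_wrt J J1 f {a}" "holomorphic_wrt J J2 g {a}"
  shows "holomorphic_wrt J (\<lambda>(u, v). (J1 u, J2 v)) (\<lambda>x. (f x, g x)) {a}"
proof -
  obtain f' g' where "(f has_derivative f') (at a)" "(g has_derivative g') (at a)"
    "\<And>h. f' (J h) = J1 (f' h)" "\<And>h. g' (J h) = J2 (g' h)"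
    using assms by (auto simp: holomorphic_wrt_def)
  then show ?thesis unfolding holomorphic_wrt_def
    by (auto intro!: exI[of _ "\<lambda>h. (f' h, g' h)"] has_derivative_Pair)
qed

lemma holomorphic_wrt_const: "J' 0 = 0 \<Longrightarrow> holomorphic_wrt J J' (\<lambda>x. c) S"
  by (auto simp: holomorphic_wrt_def intro!: exI[of _ "\<lambda>h. 0"])

lemma holomorphic_wrt_ident: "holomorphic_wrt J J (\<lambda>x. x) S"
  by (auto simp: holomorphic_wrt_def intro!: exI[of _ "\<lambda>h. h"])

lemma holomorphic_wrt_fst: "holomorphic_wrt (\<lambda>(u, v). (J1 u, J2 v)) J1 fst S"
  and holomorphic_wrt_snd: "holomorphic_wrt (\<lambda>(u, v). (J1 u, J2 v)) J2 snd S"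
  by (auto simp: holomorphic_wrt_def intro!: exI[of _ fst] exI[of _ snd] derivative_eq_intros)

lemma holomorphic_wrt_eventually:
  assumes "holomorphic_wrt J J' f {a}" "open A" "f a \<in> A"
  shows "\<forall>\<^sub>F x in nhds a. f x \<in> A"
proof -
  have "isCont f a"
    using assms(1) by (auto simp: holomorphic_wrt_def intro: has_derivative_continuous)
  then show ?thesis
    using assms(2,3) by (auto simp: isCont_def tendsto_at_iff_tendsto_nhds intro: topological_tendstoD)
qed

lemma holomorphic_wrt_singleton: "holomorphic_wrt J J' f S \<longleftrightarrow> (\<forall>x\<in>S. holomorphic_wrt J J' f {x})"
  by (simp add: holomorphic_wrt_def)

lemma openI_eventually: "(\<And>x. x \<in> S \<Longrightarrow> \<forall>\<^sub>F y in nhds x. y \<in> S) \<Longrightarrow> open S"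
  by (subst open_subopen) (metis eventually_nhds subsetI)

lemma complex_structure_Jvec: "complex_structure (Jvec :: complex ^ 'n \<Rightarrow> complex ^ 'n)"
  by unfold_locales (auto intro!: linearI simp: Jvec_def vec_eq_iff algebra_simps)

interpretation Jvec: complex_structure "Jvec :: complex ^ 'n \<Rightarrow> complex ^ 'n"
  by (rule complex_structure_Jvec)

lemma holomorphic_wrt_vec_nth:
  assumes "holomorphic_wrt J Jvec f S" shows "holomorphic_wrt J ((*) \<i>) (\<lambda>x. vec_nth (f x) j) S"
  unfolding holomorphic_wrt_def
proof
  fix x assume "x \<in> S"
  then obtain f' where "(f has_derivative f') (at x)" "\<And>h. f' (J h) = Jvec (f' h)"
    using assms by (auto simp: holomorphic_wrt_def)
  then show "\<exists>f'. ((\<lambda>x. vec_nth (f x) j) has_derivative f') (at x) \<and> (\<forall>h. f' (J h) = \<i> * f' h)"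
    by (intro exI[of _ "\<lambda>h. vec_nth (f' h) j"]) (auto simp: Jvec_def intro: bounded_linear.has_derivative bounded_linear_vec_nth)
qed

lemma holomorphic_wrt_vecI:
  fixes f :: "'a::real_normed_vector \<Rightarrow> complex ^ 'n"
  assumes "\<And>j. holomorphic_wrt J ((*) \<i>) (\<lambda>x. vec_nth (f x) j) S" shows "holomorphic_wrt J Jvec f S"
  unfolding holomorphic_wrt_def
proof
  fix x assume "x \<in> S"
  then have "\<forall>j. \<exists>f'. ((\<lambda>x. vec_nth (f x) j) has_derivative f') (at x) \<and> (\<forall>h. f' (J h) = \<i> * f' h)"
    using assms by (auto simp: holomorphic_wrt_def)
  then obtain f' where f': "\<And>j. ((\<lambda>x. vec_nth (f x) j) has_derivative f' j) (at x)" "\<And>j h. f' j (J h) = \<i> * f' j h"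
    by metis
  have "(f has_derivative (\<lambda>h. \<chi> j. f' j h)) (at x)"
    by (subst has_derivative_componentwise_within)
      (auto simp: Basis_vec_def inner_axis intro!: derivative_eq_intros f'(1))
  then show "\<exists>f'. (f has_derivative f') (at x) \<and> (\<forall>h. f' (J h) = Jvec (f' h))"
    by (intro exI[of _ "\<lambda>h. \<chi> j. f' j h"]) (auto simp: Jvec_def f'(2) vec_eq_iff)
qed

text \<open>Reduction to components; the vector-valued form is what differentiating
  \<open>Ad\<close> requires.\<close>

lemma (in complex_structure) holomorphic_directional_derivative_vec:
  fixes f :: "'a \<Rightarrow> complex ^ 'n"
  assumes f: "holomorphic_wrt J Jvec f S" and "open S"
  shows "holomorphic_wrt J Jvec (\<lambda>x. frechet_derivative f (at x) v) S"
proof (rule holomorphic_wrt_vecI)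
  fix j
  have eq: "vec_nth (frechet_derivative f (at x) v) j = frechet_derivative (\<lambda>x. vec_nth (f x) j) (at x) v" if "x \<in> S" for x
    using frechet_derivative_at[OF bounded_linear.has_derivative[OF bounded_linear_vec_nth
          holomorphic_wrt_frechet(1)[OF f that]], of j] by metis
  have hol: "holomorphic_wrt J ((*) \<i>) (\<lambda>x. frechet_derivative (\<lambda>x. vec_nth (f x) j) (at x) v) S"
    by (intro holomorphic_directional_derivative holomorphic_wrt_vec_nth f \<open>open S\<close>)
  show "holomorphic_wrt J ((*) \<i>) (\<lambda>x. vec_nth (frechet_derivative f (at x) v) j) S"
    unfolding holomorphic_wrt_singleton[where S = S]
  proof
    fix x assume x: "x \<in> S"
    have "holomorphic_wrt J ((*) \<i>) (\<lambda>x. frechet_derivative (\<lambda>x. vec_nth (f x) j) (at x) v) {x}"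
      by (rule holomorphic_wrt_subset[OF hol]) (use x in simp)
    then show "holomorphic_wrt J ((*) \<i>) (\<lambda>x. vec_nth (frechet_derivative f (at x) v) j) {x}"
      by (rule holomorphic_wrt_cong)
        (use eventually_nhds_in_open[OF \<open>open S\<close> x] eq in \<open>auto elim!: eventually_mono\<close>)
  qed
qed

section \<open>Charts of the group and maps into it that are holomorphic at a point\<close>

locale complex_lie =
  fixes L :: "('g, 'n::finite) cx_group" (structure)
  assumes L: "complex_lie_group L"
begin

sublocale group L using L by (simp add: complex_lie_group_def)

abbreviation "T \<equiv> mtop L"

lemma topspace_T [simp]: "topspace T = carrier L"
  using L by (simp add: complex_lie_group_def)

lemma chart:
  assumes "(D, c) \<in> atlas L"
  shows "openin T D" "D \<subseteq> carrier L" "open (c ` D)" "inj_on c D"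
    "homeomorphic_map (subtopology T D) (top_of_set (c ` D)) c"
proof -
  have *: "is_chart T D c"
    using L assms by (auto simp: complex_lie_group_def complex_manifold_def)
  then show "openin T D" "open (c ` D)" "homeomorphic_map (subtopology T D) (top_of_set (c ` D)) c"
    by (auto simp: is_chart_def)
  then show "D \<subseteq> carrier L" using openin_subset by fastforce
  with * show "inj_on c D"
    using homeomorphic_imp_injective_map[of "subtopology T D" "top_of_set (c ` D)" c]
    by (simp add: is_chart_def Int_absorb1)
qed

lemma chart_at: assumes "x \<in> carrier L" obtains D c where "(D, c) \<in> atlas L" "x \<in> D"
proof -
  have "(\<Union>(D, c)\<in>atlas L. D) = carrier L"
    using L by (simp add: complex_lie_group_def complex_manifold_def)
  with assms that show ?thesis by blast
qed

lemma open_chart_image: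
  assumes "(D, c) \<in> atlas L" "openin T E" shows "open (c ` (D \<inter> E))"
proof -
  have "openin (subtopology T D) (D \<inter> E)"
    using assms(2) by (auto simp: openin_subtopology)
  then have "openin (top_of_set (c ` D)) (c ` (D \<inter> E))"
    using homeomorphic_imp_open_map[OF chart(5)[OF assms(1)]] by (simp add: open_map_def)
  then show ?thesis using chart(3)[OF assms(1)] openin_open_trans by blast
qed

lemma openin_chart_vimage:
  assumes "(D, c) \<in> atlas L" "open A" shows "openin T {x \<in> D. c x \<in> A}"
proof -
  have "continuous_map (subtopology T D) (top_of_set (c ` D)) c"
    using homeomorphic_imp_continuous_map[OF chart(5)[OF assms(1)]] .
  moreover have "openin (top_of_set (c ` D)) (c ` D \<inter> A)" using assms(2) by (rule openin_open_Int)
  ultimately have "openin (subtopology T D) {x \<in> topspace (subtopology T D). c x \<in> c ` D \<inter> A}"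
    by (rule openin_continuous_map_preimage)
  moreover have "{x \<in> topspace (subtopology T D). c x \<in> c ` D \<inter> A} = {x \<in> D. c x \<in> A}"
    using chart(2)[OF assms(1)] by auto
  ultimately show ?thesis
    using openin_trans_full chart(1)[OF assms(1)] by metis
qed

lemma transition:
  "(D, c) \<in> atlas L \<Longrightarrow> (E, d) \<in> atlas L \<Longrightarrow> holomorphic_wrt Jvec Jvec (d \<circ> inv_into D c) (c ` (D \<inter> E))"
  using L by (auto simp: complex_lie_group_def complex_manifold_def)

text \<open>Eventual membership in the chart domain stands for continuity of \<open>f\<close>; the
  coordinate expression alone cannot express it, since a chart takes arbitrary values off its
  domain. All charts around \<open>f a\<close> are required for ease of use;
  \<open>hol_intoI\<close> reduces this to one.\<close>

definition hol_into :: "('a::real_normed_vector \<Rightarrow> 'a) \<Rightarrow> ('a \<Rightarrow> 'g) \<Rightarrow> 'a \<Rightarrow> bool" where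
  "hol_into J f a \<longleftrightarrow> f a \<in> carrier L \<and> (\<forall>(R, r)\<in>atlas L. f a \<in> R \<longrightarrow>
     (\<forall>\<^sub>F x in nhds a. f x \<in> R) \<and> holomorphic_wrt J Jvec (r \<circ> f) {a})"

lemma hol_intoD:
  assumes "hol_into J f a" "(R, r) \<in> atlas L" "f a \<in> R"
  shows "\<forall>\<^sub>F x in nhds a. f x \<in> R" "holomorphic_wrt J Jvec (r \<circ> f) {a}"
  using assms by (auto simp: hol_into_def)

lemma hol_into_carrier: "hol_into J f a \<Longrightarrow> f a \<in> carrier L"
  by (simp add: hol_into_def)

text \<open>The chart maps \<open>R \<inter> E\<close> onto an open set, which
  \<open>r \<circ> f\<close> does not leave near \<open>a\<close>; injectivity of \<open>r\<close>
  on \<open>R\<close> brings this back to the group.\<close>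

lemma eventually_in_open_chart:
  assumes R: "(R, r) \<in> atlas L" "f a \<in> R" "\<forall>\<^sub>F x in nhds a. f x \<in> R"
    "holomorphic_wrt J Jvec (r \<circ> f) {a}" and E: "openin T E" "f a \<in> E"
  shows "\<forall>\<^sub>F x in nhds a. f x \<in> E"
proof -
  have "\<forall>\<^sub>F x in nhds a. (r \<circ> f) x \<in> r ` (R \<inter> E)"
    using R(2) E(2) by (intro holomorphic_wrt_eventually[OF R(4)] open_chart_image R(1) E(1)) auto
  with R(3) show ?thesis
    by eventually_elim (use inj_onD[OF chart(4)[OF R(1)]] in force)
qed

lemma hol_into_eventually:
  assumes "hol_into J f a" "openin T E" "f a \<in> E" shows "\<forall>\<^sub>F x in nhds a. f x \<in> E"
proof -
  obtain R r where R: "(R, r) \<in> atlas L" "f a \<in> R" using chart_at hol_into_carrier[OF assms(1)] by metis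
  show ?thesis by (rule eventually_in_open_chart[OF R hol_intoD[OF assms(1) R] assms(2,3)])
qed

lemma hol_intoI:
  assumes R: "(R, r) \<in> atlas L" "f a \<in> R" "\<forall>\<^sub>F x in nhds a. f x \<in> R"
    "holomorphic_wrt J Jvec (r \<circ> f) {a}"
  shows "hol_into J f a"
  unfolding hol_into_def
proof (intro conjI ballI, safe)
  show "f a \<in> carrier L" using R chart(2) by blast
  fix E d assume E: "(E, d) \<in> atlas L" "f a \<in> E"
  show "\<forall>\<^sub>F x in nhds a. f x \<in> E"
    by (rule eventually_in_open_chart[OF R chart(1)[OF E(1)] E(2)])
  have "holomorphic_wrt Jvec Jvec (d \<circ> inv_into R r) {(r \<circ> f) a}"
    using R(2) E(2) by (intro holomorphic_wrt_subset[OF transition[OF R(1) E(1)]]) auto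
  from holomorphic_wrt_compose[OF R(4) this]
  show "holomorphic_wrt J Jvec (d \<circ> f) {a}"
    by (rule holomorphic_wrt_cong)
      (use R(3) chart(4)[OF R(1)] in \<open>auto elim!: eventually_mono simp: inv_into_f_f\<close>)
qed

lemma hol_into_const: assumes "g \<in> carrier L" shows "hol_into J (\<lambda>x. g) a"
proof -
  obtain R r where "(R, r) \<in> atlas L" "g \<in> R" using chart_at assms by metis
  then show ?thesis
    by (intro hol_intoI[of R r]) (simp_all add: comp_def holomorphic_wrt_const)
qed

lemma hol_into_inv_chart:
  assumes "(D, c) \<in> atlas L" "u \<in> c ` D" shows "hol_into Jvec (inv_into D c) u"
proof (rule hol_intoI[OF assms(1)])
  have ev: "\<forall>\<^sub>F x in nhds u. x \<in> c ` D"
    using chart(3)[OF assms(1)] assms(2) by (rule eventually_nhds_in_open)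
  then show "\<forall>\<^sub>F x in nhds u. inv_into D c x \<in> D"
    by eventually_elim (rule inv_into_into)
  show "inv_into D c u \<in> D" using assms(2) by (rule inv_into_into)
  show "holomorphic_wrt Jvec Jvec (c \<circ> inv_into D c) {u}"
    by (rule holomorphic_wrt_cong[OF holomorphic_wrt_ident])
      (use ev in \<open>auto elim!: eventually_mono simp: f_inv_into_f\<close>)
qed

lemma hol_into_compose:
  assumes "hol_into J' f (g a)" "holomorphic_wrt J J' g {a}"
  shows "hol_into J (\<lambda>x. f (g x)) a"
proof -
  obtain R r where R: "(R, r) \<in> atlas L" "f (g a) \<in> R" using chart_at hol_into_carrier[OF assms(1)] by metis
  note * = hol_intoD[OF assms(1) R]
  show ?thesis
  proof (rule hol_intoI[of R r])
    have "filterlim g (nhds (g a)) (nhds a)"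
      using assms(2) has_derivative_continuous unfolding holomorphic_wrt_def
      by (metis isCont_def singletonI tendsto_at_iff_tendsto_nhds)
    from eventually_compose_filterlim[OF *(1) this] show "\<forall>\<^sub>F x in nhds a. f (g x) \<in> R" .
    show "holomorphic_wrt J Jvec (r \<circ> (\<lambda>x. f (g x))) {a}"
      using holomorphic_wrt_compose[OF assms(2) *(2)] by (simp add: comp_def)
  qed (use R in auto)
qed

text \<open>The axioms give holomorphy of multiplication only in coordinates, where the product lies
  in the chart \<open>R\<close>. Continuity of multiplication guarantees this near \<open>a\<close>,
  and there the product is \<open>?M\<close> composed with the pair of coordinate
  expressions.\<close>

lemma hol_into_mult:
  assumes f: "hol_into J f a" and g: "hol_into J g a"
  shows "hol_into J (\<lambda>x. f x \<otimes> g x) a"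
proof -
  note car = hol_into_carrier[OF f] hol_into_carrier[OF g]
  obtain D c where D: "(D, c) \<in> atlas L" "f a \<in> D" using chart_at car(1) by metis
  obtain E d where E: "(E, d) \<in> atlas L" "g a \<in> E" using chart_at car(2) by metis
  obtain R r where R: "(R, r) \<in> atlas L" "f a \<otimes> g a \<in> R" using chart_at m_closed[OF car] by metis
  have "continuous_map (prod_topology T T) T (\<lambda>(x, y). x \<otimes> y)"
    using L by (simp add: complex_lie_group_def)
  from openin_continuous_map_preimage[OF this chart(1)[OF R(1)]]
  have "openin (prod_topology T T) {p \<in> carrier L \<times> carrier L. fst p \<otimes> snd p \<in> R}"
    by (simp add: split_beta)
  from this[unfolded openin_prod_topology_alt, rule_format, of "f a" "g a"] car R(2)
  obtain A B where AB: "openin T A" "openin T B" "f a \<in> A" "g a \<in> B"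
      "A \<times> B \<subseteq> {p \<in> carrier L \<times> carrier L. fst p \<otimes> snd p \<in> R}"
    by auto
  have ev: "\<forall>\<^sub>F x in nhds a. f x \<otimes> g x \<in> R"
    using hol_into_eventually[OF f AB(1,3)] hol_into_eventually[OF g AB(2,4)]
    by eventually_elim (use AB(5) in auto)
  let ?M = "\<lambda>(u, v). r (inv_into D c u \<otimes> inv_into E d v)"
  have invs: "inv_into D c (c x) = x" "inv_into E d (d y) = y" if "x \<in> D" "y \<in> E" for x y
    using that chart(4)[OF D(1)] chart(4)[OF E(1)] by simp_all
  have "holomorphic_wrt (\<lambda>(u, v). (Jvec u, Jvec v)) Jvec ?M
      {(u, v). u \<in> c ` D \<and> v \<in> d ` E \<and> inv_into D c u \<otimes> inv_into E d v \<in> R}"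
    using L D(1) E(1) R(1) unfolding complex_lie_group_def by fast
  then have "holomorphic_wrt (\<lambda>(u, v). (Jvec u, Jvec v)) Jvec ?M {((c \<circ> f) a, (d \<circ> g) a)}"
    by (rule holomorphic_wrt_subset) (use D(2) E(2) R(2) invs in auto)
  from holomorphic_wrt_compose[OF holomorphic_wrt_Pair[OF hol_intoD(2)[OF f D] hol_intoD(2)[OF g E]] this]
  have "holomorphic_wrt J Jvec (r \<circ> (\<lambda>x. f x \<otimes> g x)) {a}"
  proof (rule holomorphic_wrt_cong)
    show "\<forall>\<^sub>F x in nhds a. (?M \<circ> (\<lambda>x. ((c \<circ> f) x, (d \<circ> g) x))) x = (r \<circ> (\<lambda>x. f x \<otimes> g x)) x"
      using hol_intoD(1)[OF f D] hol_intoD(1)[OF g E] by eventually_elim (simp add: invs)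
  qed
  with R ev show ?thesis by (intro hol_intoI)
qed

lemma hol_into_m_inv:
  assumes f: "hol_into J f a" shows "hol_into J (\<lambda>x. inv (f x)) a"
proof -
  note car = hol_into_carrier[OF f]
  obtain D c where D: "(D, c) \<in> atlas L" "f a \<in> D" using chart_at car(1) by metis
  obtain E d where E: "(E, d) \<in> atlas L" "inv (f a) \<in> E" using chart_at inv_closed[OF car] by metis
  have "continuous_map T T (\<lambda>x. inv x)"
    using L by (simp add: complex_lie_group_def)
  from openin_continuous_map_preimage[OF this chart(1)[OF E(1)]]
  have "openin T {x \<in> carrier L. inv x \<in> E}" by simp
  from hol_into_eventually[OF f this] car E(2) have ev: "\<forall>\<^sub>F x in nhds a. inv (f x) \<in> E"
    by (auto elim: eventually_mono)
  have invs: "inv_into D c (c x) = x" if "x \<in> D" for x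
    using that chart(4)[OF D(1)] by simp_all
  have "holomorphic_wrt Jvec Jvec (\<lambda>u. d (inv (inv_into D c u))) {u \<in> c ` D. inv (inv_into D c u) \<in> E}"
    using L D(1) E(1) unfolding complex_lie_group_def by fast
  then have "holomorphic_wrt Jvec Jvec (\<lambda>u. d (inv (inv_into D c u))) {(c \<circ> f) a}"
    by (rule holomorphic_wrt_subset) (use D(2) E(2) invs in auto)
  from holomorphic_wrt_compose[OF hol_intoD(2)[OF f D] this]
  have "holomorphic_wrt J Jvec (d \<circ> (\<lambda>x. inv (f x))) {a}"
  proof (rule holomorphic_wrt_cong)
    show "\<forall>\<^sub>F x in nhds a. ((\<lambda>u. d (inv (inv_into D c u))) \<circ> (c \<circ> f)) x = (d \<circ> (\<lambda>x. inv (f x))) x"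
      using hol_intoD(1)[OF f D] by eventually_elim (simp add: invs)
  qed
  with E ev show ?thesis by (intro hol_intoI)
qed

lemma holomorphic_fun_compose:
  assumes F: "holomorphic_fun L S F" and f: "hol_into J f a" "f a \<in> S"
  shows "holomorphic_wrt J ((*) \<i>) (\<lambda>x. F (f x)) {a}"
proof -
  obtain D c where D: "(D, c) \<in> atlas L" "f a \<in> D" using chart_at hol_into_carrier[OF f(1)] by metis
  have "holomorphic_wrt Jvec ((*) \<i>) (F \<circ> inv_into D c) (c ` (D \<inter> S))"
    using F D(1) by (auto simp: holomorphic_fun_def)
  then have "holomorphic_wrt Jvec ((*) \<i>) (F \<circ> inv_into D c) {(c \<circ> f) a}"
    by (rule holomorphic_wrt_subset) (use D(2) f(2) in auto)
  from holomorphic_wrt_compose[OF hol_intoD(2)[OF f(1) D] this]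
  show ?thesis
  proof (rule holomorphic_wrt_cong)
    show "\<forall>\<^sub>F x in nhds a. (F \<circ> inv_into D c \<circ> (c \<circ> f)) x = F (f x)"
      using hol_intoD(1)[OF f(1) D] by eventually_elim (simp add: chart(4)[OF D(1)])
  qed
qed

end

lemma has_derivative_cong_nhds:
  assumes "\<forall>\<^sub>F x in nhds a. f x = g x" "(f has_derivative f') (at a)"
  shows "(g has_derivative f') (at a)"
proof (rule has_derivative_transform_eventually[OF assms(2)])
  show "\<forall>\<^sub>F x in at a. f x = g x"
    using assms(1) by (auto simp: eventually_at_filter elim: eventually_mono)
qed (use eventually_nhds_x_imp_x[OF assms(1)] in auto)

section \<open>Left-invariant derivatives and one-parameter subgroups\<close>

context complex_lie
begin

abbreviation "D0 \<equiv> fst (id_chart L)"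
abbreviation "e0 \<equiv> coord L \<one>"

lemma id_chart: "(D0, coord L) \<in> atlas L" "\<one> \<in> D0"
proof -
  obtain D c where "(D, c) \<in> atlas L" "\<one> \<in> D" using chart_at one_closed by metis
  then have "id_chart L \<in> atlas L \<and> \<one> \<in> fst (id_chart L)"
    unfolding id_chart_def by (intro someI[of "\<lambda>p. p \<in> atlas L \<and> \<one> \<in> fst p" "(D, c)"]) simp
  then show "(D0, coord L) \<in> atlas L" "\<one> \<in> D0" by (simp_all add: coord_def)
qed

lemma coord_inv_coord: "x \<in> D0 \<Longrightarrow> coord_inv L (coord L x) = x"
  using chart(4)[OF id_chart(1)] by (simp add: coord_inv_def coord_def)

lemma coord_inv_e0 [simp]: "coord_inv L e0 = \<one>"
  by (simp add: coord_inv_coord id_chart)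

lemma hol_into_coord_inv: "u \<in> coord L ` D0 \<Longrightarrow> hol_into Jvec (coord_inv L) u"
  using hol_into_inv_chart[OF id_chart(1)] by (simp add: coord_inv_def coord_def)

lemma e0_mem: "e0 \<in> coord L ` D0" using id_chart by auto

lemma hol_into_translate: "x \<in> carrier L \<Longrightarrow> hol_into Jvec (\<lambda>u. x \<otimes> coord_inv L u) e0"
  by (intro hol_into_mult hol_into_const hol_into_coord_inv e0_mem)

text \<open>In contrast to \<open>left_inv_deriv\<close> this makes sense for all \<open>v\<close>, and it is complex linear in \<open>v\<close>.\<close>

definition left_deriv :: "complex ^ 'n \<Rightarrow> ('g \<Rightarrow> complex) \<Rightarrow> 'g \<Rightarrow> complex" where
  "left_deriv v F x = frechet_derivative (\<lambda>u. F (x \<otimes> coord_inv L u)) (at e0) v"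

lemma left_deriv_derivative:
  assumes "holomorphic_fun L S F" "x \<in> S" "x \<in> carrier L"
  shows "((\<lambda>u. F (x \<otimes> coord_inv L u)) has_derivative (\<lambda>v. left_deriv v F x)) (at e0)"
    and "left_deriv (Jvec v) F x = \<i> * left_deriv v F x"
proof -
  have *: "holomorphic_wrt Jvec ((*) \<i>) (\<lambda>u. F (x \<otimes> coord_inv L u)) {e0}"
    by (rule holomorphic_fun_compose[OF assms(1) hol_into_translate]) (use assms in auto)
  show "((\<lambda>u. F (x \<otimes> coord_inv L u)) has_derivative (\<lambda>v. left_deriv v F x)) (at e0)"
    using holomorphic_wrt_frechet(1)[OF *] by (simp add: left_deriv_def[abs_def])
  show "left_deriv (Jvec v) F x = \<i> * left_deriv v F x"
    using holomorphic_wrt_frechet(2)[OF *] by (simp add: left_deriv_def)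
qed

lemma left_deriv_unique:
  assumes "((\<lambda>u. F (x \<otimes> coord_inv L u)) has_derivative f') (at e0)"
  shows "left_deriv v F x = f' v"
  using frechet_derivative_at[OF assms] by (simp add: left_deriv_def)

lemma left_deriv_linear:
  assumes "holomorphic_fun L S F" "x \<in> S" "x \<in> carrier L" shows "linear (\<lambda>v. left_deriv v F x)"
  using left_deriv_derivative(1)[OF assms] by (rule has_derivative_linear)

text \<open>\<open>frechet_derivative\<close> is a choice among all derivatives, so it suffices that
  both functions have the same derivatives; no differentiability has to be assumed.\<close>

lemma left_deriv_cong:
  assumes "openin T S" "x \<in> S" "\<And>y. y \<in> S \<Longrightarrow> F y = F' y"
  shows "left_deriv v F x = left_deriv v F' x"
proof -
  have x: "x \<in> carrier L" using openin_subset[OF assms(1)] assms(2) by auto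
  have ev: "\<forall>\<^sub>F u in nhds e0. x \<otimes> coord_inv L u \<in> S"
    using hol_into_eventually[OF hol_into_translate[OF x] assms(1)] assms(2) x by simp
  then have ev: "\<forall>\<^sub>F u in nhds e0. F (x \<otimes> coord_inv L u) = F' (x \<otimes> coord_inv L u)"
    by eventually_elim (rule assms(3))
  from ev have ev': "\<forall>\<^sub>F u in nhds e0. F' (x \<otimes> coord_inv L u) = F (x \<otimes> coord_inv L u)"
    by eventually_elim simp
  have "((\<lambda>u. F (x \<otimes> coord_inv L u)) has_derivative f') (at e0) \<longleftrightarrow>
      ((\<lambda>u. F' (x \<otimes> coord_inv L u)) has_derivative f') (at e0)" for f'
    using has_derivative_cong_nhds[OF ev] has_derivative_cong_nhds[OF ev'] by blast
  then show ?thesis by (simp add: left_deriv_def frechet_derivative_def)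
qed

lemma left_deriv_add_fun:
  assumes "holomorphic_fun L S F" "holomorphic_fun L S F'" "x \<in> S" "x \<in> carrier L"
  shows "left_deriv v (\<lambda>y. F y + F' y) x = left_deriv v F x + left_deriv v F' x"
  by (rule left_deriv_unique) (intro has_derivative_add left_deriv_derivative(1)[OF assms(1)] left_deriv_derivative(1)[OF assms(2)] assms)

lemma left_deriv_cmult_fun:
  assumes "holomorphic_fun L S F" "x \<in> S" "x \<in> carrier L"
  shows "left_deriv v (\<lambda>y. c * F y) x = c * left_deriv v F x"
  by (rule left_deriv_unique) (intro has_derivative_mult_right left_deriv_derivative(1)[OF assms])

lemma open_hol_into_vimage:
  assumes "\<And>p. p \<in> A \<Longrightarrow> hol_into J f p" "open A" "openin T S"
  shows "open {p \<in> A. f p \<in> S}"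
proof (rule openI_eventually)
  fix p assume p: "p \<in> {p \<in> A. f p \<in> S}"
  have "\<forall>\<^sub>F q in nhds p. q \<in> A" "\<forall>\<^sub>F q in nhds p. f q \<in> S"
    using p assms(2) hol_into_eventually[OF assms(1,3), of p] by (auto intro: eventually_nhds_in_open)
  then show "\<forall>\<^sub>F q in nhds p. q \<in> {p \<in> A. f p \<in> S}" by eventually_elim simp
qed

abbreviation "J2 \<equiv> \<lambda>(u :: complex ^ 'n, v :: complex ^ 'n). (Jvec u, Jvec v)"

lemma complex_structure_J2: "complex_structure J2"
  by (intro complex_structure_prod complex_structure_Jvec)

lemma holomorphic_wrt_Pair_const: "holomorphic_wrt Jvec J2 (\<lambda>w. (w, e0)) S"
  unfolding holomorphic_wrt_def
  by (intro ballI exI[of _ "\<lambda>h. (h, 0)"]) (auto intro!: derivative_eq_intros)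

text \<open>\<open>F (x \<otimes> coord_inv L u)\<close> is holomorphic jointly in \<open>u\<close>
  and the coordinates of \<open>x\<close>. The left derivative is its directional derivative along
  \<open>(0, v)\<close>, restricted to the slice where the second coordinate is
  \<open>e0\<close>.\<close>

lemma holomorphic_left_deriv:
  assumes F: "holomorphic_fun L S F" and S: "openin T S"
  shows "holomorphic_fun L S (left_deriv v F)"
  unfolding holomorphic_fun_def
proof (intro ballI, clarify)
  fix D c assume D: "(D, c) \<in> atlas L"
  interpret P: complex_structure J2 by (rule complex_structure_J2)
  let ?m = "\<lambda>p. inv_into D c (fst p) \<otimes> coord_inv L (snd p)"
  define A where "A = c ` D \<times> coord L ` D0"
  define \<Omega> where "\<Omega> = {p \<in> A. ?m p \<in> S}"
  have "open A" unfolding A_def by (intro open_Times chart(3)[OF D] chart(3)[OF id_chart(1)])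
  have m: "hol_into J2 ?m p" if "p \<in> A" for p
    by (intro hol_into_mult hol_into_compose[OF hol_into_inv_chart[OF D]]
        hol_into_compose[OF hol_into_coord_inv] holomorphic_wrt_fst holomorphic_wrt_snd)
      (use that in \<open>auto simp: A_def\<close>)
  have "open \<Omega>" unfolding \<Omega>_def by (rule open_hol_into_vimage[OF m \<open>open A\<close> S])
  have "holomorphic_wrt J2 ((*) \<i>) (\<lambda>p. F (?m p)) \<Omega>"
    unfolding holomorphic_wrt_singleton[where S = \<Omega>]
    by (intro ballI holomorphic_fun_compose[OF F m]) (auto simp: \<Omega>_def)
  note \<Psi> = this and \<Psi>' = P.holomorphic_directional_derivative[OF this \<open>open \<Omega>\<close>, of "(0, v)"]
  have cS: "open (c ` (D \<inter> S))" by (rule open_chart_image[OF D S])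
  have mem: "(w, e0) \<in> \<Omega>" if "w \<in> c ` (D \<inter> S)" for w
    using that e0_mem chart(2)[OF D] chart(4)[OF D]
    by (auto simp: \<Omega>_def A_def subset_iff)
  have eq: "frechet_derivative (\<lambda>p. F (?m p)) (at (w, e0)) (0, v) = (left_deriv v F \<circ> inv_into D c) w"
    if "w \<in> c ` (D \<inter> S)" for w
  proof -
    have "((\<lambda>u. (w, u)) has_derivative (\<lambda>h. (0, h))) (at e0)" by (auto intro!: derivative_eq_intros)
    from has_derivative_compose[OF this holomorphic_wrt_frechet(1)[OF \<Psi> mem[OF that]]]
    show ?thesis by (simp add: left_deriv_unique)
  qed
  show "holomorphic_wrt Jvec ((*) \<i>) (left_deriv v F \<circ> inv_into D c) (c ` (D \<inter> S))"
    unfolding holomorphic_wrt_singleton[where S = "c ` (D \<inter> S)"]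
  proof
    fix w assume w: "w \<in> c ` (D \<inter> S)"
    have "holomorphic_wrt J2 ((*) \<i>) (\<lambda>p. frechet_derivative (\<lambda>p. F (?m p)) (at p) (0, v)) {(w, e0)}"
      by (rule holomorphic_wrt_subset[OF \<Psi>']) (use mem[OF w] in auto)
    from holomorphic_wrt_compose[OF holomorphic_wrt_Pair_const this]
    show "holomorphic_wrt Jvec ((*) \<i>) (left_deriv v F \<circ> inv_into D c) {w}"
      by (rule holomorphic_wrt_cong)
        (use eventually_nhds_in_open[OF cS w] eq in \<open>auto elim!: eventually_mono\<close>)
  qed
qed

lemma continuous_map_translate: assumes "x \<in> carrier L" shows "continuous_map T T (\<lambda>y. x \<otimes> y)"
proof -
  have "continuous_map (prod_topology T T) T (\<lambda>(x, y). x \<otimes> y)"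
    using L by (simp add: complex_lie_group_def)
  moreover have "continuous_map T (prod_topology T T) (\<lambda>y. (x, y))"
    using assms by (simp add: continuous_map_pairwise comp_def)
  ultimately show ?thesis
    using continuous_map_compose[of T "prod_topology T T" "\<lambda>y. (x, y)" T "\<lambda>(x, y). x \<otimes> y"]
    by (simp add: comp_def)
qed

lemma one_param_one:
  assumes "one_param L H v \<gamma>" "H \<subseteq> carrier L" shows "\<gamma> 0 = \<one>"
proof -
  have "\<gamma> 0 \<in> carrier L" "\<gamma> 0 = \<gamma> 0 \<otimes> \<gamma> 0"
    using assms by (auto simp: one_param_def) (metis add_0)
  then show ?thesis by (metis l_cancel_one')
qed

lemma one_param_eventually:
  assumes "one_param L H v \<gamma>" "H \<subseteq> carrier L" "openin T E" "x \<in> carrier L" "x \<in> E"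
  shows "\<forall>\<^sub>F t in nhds 0. x \<otimes> \<gamma> t \<in> E"
proof -
  have "continuous_map euclideanreal T (\<lambda>t. x \<otimes> \<gamma> t)"
    using continuous_map_compose[OF _ continuous_map_translate[OF assms(4)], of euclideanreal \<gamma>] assms(1)
    by (simp add: one_param_def comp_def)
  from openin_continuous_map_preimage[OF this assms(3)]
  have "open {t. x \<otimes> \<gamma> t \<in> E}" by simp
  from eventually_nhds_in_open[OF this, of 0] show ?thesis
    using assms(4,5) one_param_one[OF assms(1,2)] by simp
qed

text \<open>Near \<open>0\<close> the curve runs inside the identity chart, so only its velocity
  enters, whichever subgroup \<open>one_param_sub\<close> picks. The target space is left open: the
  rule is used for complex functions, for conjugation in coordinates and for
  \<open>Ad\<close>.\<close>

lemma one_param_derivative: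
  assumes \<gamma>: "one_param L H v \<gamma>" and "H \<subseteq> carrier L"
    and f: "((\<lambda>u. f (coord_inv L u)) has_derivative f') (at e0)"
  shows "((\<lambda>t. f (\<gamma> t)) has_vector_derivative f' v) (at 0)"
proof -
  note g0 = one_param_one[OF assms(1,2)]
  have "((\<lambda>t. coord L (\<gamma> t)) has_derivative (\<lambda>t. t *\<^sub>R v)) (at 0)"
    using \<gamma> by (simp add: one_param_def has_vector_derivative_def)
  from has_derivative_compose[OF this] f g0
  have "((\<lambda>t. f (coord_inv L (coord L (\<gamma> t)))) has_derivative (\<lambda>t. f' (t *\<^sub>R v))) (at 0)"
    by simp
  moreover have "\<forall>\<^sub>F t in nhds 0. \<gamma> t \<in> D0"
  proof -
    have "\<gamma> t \<in> carrier L" for t using assms(1,2) by (auto simp: one_param_def)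
    then show ?thesis
      using one_param_eventually[OF assms(1,2) chart(1)[OF id_chart(1)] one_closed id_chart(2)] by simp
  qed
  then have "\<forall>\<^sub>F t in at 0. f (coord_inv L (coord L (\<gamma> t))) = f (\<gamma> t)"
    unfolding eventually_at_filter by eventually_elim (simp add: coord_inv_coord)
  ultimately have "((\<lambda>t. f (\<gamma> t)) has_derivative (\<lambda>t. f' (t *\<^sub>R v))) (at 0)"
    by (rule has_derivative_transform_eventually) (auto simp: g0)
  moreover have "f' (t *\<^sub>R v) = t *\<^sub>R f' v" for t
    using has_derivative_linear[OF f] by (rule linear_scale)
  ultimately show ?thesis by (simp add: has_vector_derivative_def)
qed

lemma one_param_left_deriv:
  assumes "one_param L H v \<gamma>" "H \<subseteq> carrier L" "holomorphic_fun L S F" "x \<in> S" "x \<in> carrier L"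
  shows "((\<lambda>t. F (x \<otimes> \<gamma> t)) has_vector_derivative left_deriv v F x) (at 0)"
  by (rule one_param_derivative[OF assms(1,2) left_deriv_derivative(1)[OF assms(3-5)]])

lemma one_param_sub: "v \<in> lie_alg L H \<Longrightarrow> one_param L H v (one_param_sub L H v)"
  unfolding lie_alg_def one_param_sub_def by (auto intro: someI[of "one_param L H v"])

text \<open>The curve through \<open>x\<close> stays in \<open>H\<close>, and for small
  \<open>t\<close> in an open set of \<open>L\<close> that cuts out \<open>W\<close>; so
  differentiating along it sees only points where \<open>\<phi>\<close> and \<open>F\<close>
  agree.\<close>

lemma left_inv_deriv_eq:
  assumes H: "subgroup H L" and v: "v \<in> lie_alg L H"
    and F: "holomorphic_fun L S F" and S: "openin T S" and W: "openin (subtopology T H) W" "W \<subseteq> S" "x \<in> W"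
    and eq: "\<And>y. y \<in> W \<Longrightarrow> \<phi> y = F y"
  shows "left_inv_deriv L H v \<phi> x = left_deriv v F x"
proof -
  let ?\<gamma> = "one_param_sub L H v"
  note HL = subgroup.subset[OF H] and \<gamma> = one_param_sub[OF v]
  obtain E where E: "openin T E" "W = E \<inter> H" using W(1) by (auto simp: openin_subtopology)
  have x: "x \<in> carrier L" "x \<in> H" "x \<in> E" using W E HL by auto
  have "\<forall>\<^sub>F t in nhds 0. x \<otimes> ?\<gamma> t \<in> E"
    by (rule one_param_eventually[OF \<gamma> HL E(1) x(1,3)])
  then have ev: "\<forall>\<^sub>F t in nhds 0. F (x \<otimes> ?\<gamma> t) = \<phi> (x \<otimes> ?\<gamma> t)"
  proof eventually_elim
    case (elim t)
    have "?\<gamma> t \<in> H" using \<gamma> by (auto simp: one_param_def)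
    then show ?case using elim x E eq subgroup.m_closed[OF H] by simp
  qed
  have "((\<lambda>t. F (x \<otimes> ?\<gamma> t)) has_vector_derivative left_deriv v F x) (at 0)"
    by (rule one_param_left_deriv[OF \<gamma> HL F]) (use W x in auto)
  then have "((\<lambda>t. \<phi> (x \<otimes> ?\<gamma> t)) has_vector_derivative left_deriv v F x) (at 0)"
    unfolding has_vector_derivative_def
    by (rule has_derivative_cong_nhds[OF ev])
  then show ?thesis by (simp add: left_inv_deriv_def vector_derivative_at)
qed

lemma left_inv_deriv2_eq:
  assumes H: "subgroup H L" and v: "v \<in> lie_alg L H" "w \<in> lie_alg L H"
    and F: "holomorphic_fun L S F" and S: "openin T S" and W: "openin (subtopology T H) W" "W \<subseteq> S" "x \<in> W"
    and eq: "\<And>y. y \<in> W \<Longrightarrow> \<phi> y = F y"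
  shows "left_inv_deriv L H w (left_inv_deriv L H v \<phi>) x = left_deriv w (left_deriv v F) x"
  using left_inv_deriv_eq[OF H v(1) F S W(1,2) _ eq]
  by (intro left_inv_deriv_eq[OF H v(2) holomorphic_left_deriv[OF F S] S W]) auto

subsection \<open>The identity theorem\<close>

text \<open>The curves fed into \<open>vanishing_on_curves\<close> are the one-parameter subgroups
  of \<open>H\<close> in the identity chart, with \<open>F\<close> translated by \<open>x\<close>.
  They keep the argument of \<open>F\<close> in \<open>W\<close>, and their velocities exhaust the
  Lie algebra.\<close>

lemma vanish_near:
  assumes H: "subgroup H L" and V: "subspace (lie_alg L H)" "\<And>w. \<exists>x\<in>lie_alg L H. \<exists>y\<in>lie_alg L H. w = x + Jvec y"
    and F: "holomorphic_fun L S F" and S: "openin T S" and W: "openin (subtopology T H) W" "W \<subseteq> S" "x \<in> W"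
    and eq: "\<And>y. y \<in> W \<Longrightarrow> F y = 0"
  shows "\<exists>N. openin T N \<and> x \<in> N \<and> (\<forall>y\<in>N. F y = 0)"
proof -
  note HL = subgroup.subset[OF H]
  obtain E where E: "openin T E" "W = E \<inter> H" using W(1) by (auto simp: openin_subtopology)
  have x: "x \<in> carrier L" "x \<in> H" "x \<in> E" "x \<in> S" using W E HL by auto
  let ?m = "\<lambda>u. x \<otimes> coord_inv L u"
  define A where "A = coord L ` D0"
  have "open A" unfolding A_def by (rule chart(3)[OF id_chart(1)])
  have m: "hol_into Jvec ?m p" if "p \<in> A" for p
    by (intro hol_into_mult hol_into_const hol_into_coord_inv) (use that x in \<open>auto simp: A_def\<close>)
  define \<Omega> where "\<Omega> = {p \<in> A. ?m p \<in> S}"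
  have "open \<Omega>" unfolding \<Omega>_def by (rule open_hol_into_vimage[OF m \<open>open A\<close> S])
  have hol: "holomorphic_wrt Jvec ((*) \<i>) (\<lambda>p. F (?m p)) \<Omega>"
    unfolding holomorphic_wrt_singleton[where S = \<Omega>]
    by (intro ballI holomorphic_fun_compose[OF F m]) (auto simp: \<Omega>_def)
  have "\<forall>\<^sub>F u in nhds e0. F (?m u) = 0"
  proof (rule Jvec.vanishing_on_curves[OF hol \<open>open \<Omega>\<close> _ V])
    show "e0 \<in> \<Omega>" using e0_mem x by (simp add: \<Omega>_def A_def)
    fix v assume v: "v \<in> lie_alg L H"
    let ?\<gamma> = "one_param_sub L H v"
    note \<gamma> = one_param_sub[OF v]
    have "\<forall>\<^sub>F t in nhds 0. x \<otimes> ?\<gamma> t \<in> E" "\<forall>\<^sub>F t in nhds 0. \<one> \<otimes> ?\<gamma> t \<in> D0"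
      by (rule one_param_eventually[OF \<gamma> HL E(1) x(1,3)]
          one_param_eventually[OF \<gamma> HL chart(1)[OF id_chart(1)] one_closed id_chart(2)])+
    then have "\<forall>\<^sub>F t in nhds 0. F (?m (coord L (?\<gamma> t))) = 0"
    proof eventually_elim
      case (elim t)
      have "?\<gamma> t \<in> H" using \<gamma> by (auto simp: one_param_def)
      then show ?case using elim x E eq HL subgroup.m_closed[OF H] by (simp add: coord_inv_coord subset_iff)
    qed
    then show "\<exists>c. c 0 = e0 \<and> (c has_vector_derivative v) (at 0) \<and> (\<forall>\<^sub>F t in at 0. F (?m (c t)) = 0)"
      using one_param_one[OF \<gamma> HL] \<gamma>
      by (intro exI[of _ "\<lambda>t. coord L (?\<gamma> t)"])
        (auto simp: one_param_def eventually_at_filter elim: eventually_mono)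
  qed
  then obtain N where N: "open N" "e0 \<in> N" "\<And>u. u \<in> N \<Longrightarrow> F (?m u) = 0"
    by (auto simp: eventually_nhds)
  \<comment> \<open>The neighbourhood of zeros, found in the identity chart, is carried to
    \<open>x\<close> by left translation.\<close>
  have "openin T {y \<in> D0. coord L y \<in> N}" by (rule openin_chart_vimage[OF id_chart(1) N(1)])
  from openin_continuous_map_preimage[OF continuous_map_translate this, of "inv x"] x
  have "openin T {y \<in> carrier L. inv x \<otimes> y \<in> {y \<in> D0. coord L y \<in> N}}" by simp
  moreover have "F y = 0" if "y \<in> carrier L" "inv x \<otimes> y \<in> D0" "coord L (inv x \<otimes> y) \<in> N" for y
    using N(3)[OF that(3)] that x by (simp add: coord_inv_coord m_assoc[symmetric])
  ultimately show ?thesis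
    using x id_chart(2) N(2) by (intro exI[of _ "{y \<in> carrier L. inv x \<otimes> y \<in> {y \<in> D0. coord L y \<in> N}}"]) auto
qed

text \<open>The complex line through \<open>b\<close> and \<open>x\<close> meets the ball in a
  convex, hence connected, set of parameters, to which the one-variable identity theorem
  applies.\<close>

lemma vanish_ball:
  assumes F: "holomorphic_wrt Jvec ((*) \<i>) f (ball a r)"
    and b: "b \<in> ball a r" "\<forall>\<^sub>F x in nhds b. f x = 0" and x: "x \<in> ball (a :: complex ^ 'm) r"
  shows "f x = 0"
proof -
  define S where "S = {z::complex. b + Jvec.cscale z (x - b) \<in> ball a r}"
  have aff: "b + Jvec.cscale ((1 - t) *\<^sub>R z + t *\<^sub>R z') (x - b) =
      (1 - t) *\<^sub>R (b + Jvec.cscale z (x - b)) + t *\<^sub>R (b + Jvec.cscale z' (x - b))" for t z z'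
    by (simp add: Jvec.cscale_def algebra_simps scaleR_add_left)
  have "open S" unfolding S_def
    using open_vimage[OF open_ball, of "\<lambda>z. b + Jvec.cscale z (x - b)" a r]
    by (simp add: vimage_def continuous_intros)
  moreover have "convex S"
    unfolding S_def convex_alt mem_Collect_eq aff using convex_ball[of a r] unfolding convex_alt by blast
  moreover have S01: "0 \<in> S" "1 \<in> S"
    using b x Jvec.cscale_of_real[of 1 "x - b"] by (auto simp: S_def)
  moreover have hol: "(\<lambda>z. f (b + Jvec.cscale z (x - b))) holomorphic_on S"
    using Jvec.has_field_derivative_line[OF F, of b _ "x - b"] has_field_derivative_at_within
    unfolding holomorphic_on_def field_differentiable_def S_def by blast
  moreover obtain N where N: "open N" "b \<in> N" "\<And>y. y \<in> N \<Longrightarrow> f y = 0"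
    using b(2) by (auto simp: eventually_nhds)
  define U where "U = S \<inter> {z. b + Jvec.cscale z (x - b) \<in> N}"
  have "open U" unfolding U_def
    using open_vimage[OF N(1), of "\<lambda>z. b + Jvec.cscale z (x - b)"] \<open>open S\<close>
    by (auto simp: vimage_def continuous_intros)
  moreover have "0 \<in> U" using N S01 by (simp add: U_def)
  ultimately have "f (b + Jvec.cscale 1 (x - b)) = 0"
    by (intro analytic_continuation_open[of U S "\<lambda>z. f (b + Jvec.cscale z (x - b))" "\<lambda>z. 0" 1])
      (auto intro: convex_connected simp: U_def N)
  then show ?thesis using Jvec.cscale_of_real[of 1 "x - b"] by simp
qed

text \<open>The points of \<open>S\<close> around which \<open>F\<close> vanishes identically form
  an open and closed subset, and every component of \<open>S\<close> contains such a point, namely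
  one in \<open>W\<close>.\<close>

theorem identity_theorem:
  assumes H: "subgroup H L" and V: "subspace (lie_alg L H)" "\<And>w. \<exists>x\<in>lie_alg L H. \<exists>y\<in>lie_alg L H. w = x + Jvec y"
    and F: "holomorphic_fun L S F" and S: "openin T S" and W: "openin (subtopology T H) W" "W \<subseteq> S"
    and eq: "\<And>y. y \<in> W \<Longrightarrow> F y = 0"
    and comp: "\<And>C. C \<in> connected_components_of (subtopology T S) \<Longrightarrow> C \<inter> W \<noteq> {}"
    and x: "x \<in> S"
  shows "F x = 0"
proof -
  define Z where "Z = {y \<in> S. \<exists>N. openin T N \<and> y \<in> N \<and> (\<forall>z\<in>N. F z = 0)}"
  have SL: "S \<subseteq> carrier L" using openin_subset[OF S] by simp
  \<comment> \<open>A chart ball that meets \<open>Z\<close> lies in \<open>Z\<close>. This yields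
    openness of \<open>Z\<close> and of its complement in \<open>S\<close> at once.\<close>
  have nbhd: "\<exists>N. openin T N \<and> y \<in> N \<and> N \<subseteq> S \<and> (N \<inter> Z \<noteq> {} \<longrightarrow> N \<subseteq> Z)" if y: "y \<in> S" for y
  proof -
    obtain D c where D: "(D, c) \<in> atlas L" "y \<in> D" using chart_at y SL by blast
    have "open (c ` (D \<inter> S))" by (rule open_chart_image[OF D(1) S])
    then obtain r where r: "r > 0" "ball (c y) r \<subseteq> c ` (D \<inter> S)" using openE D y by blast
    define N where "N = {z \<in> D. c z \<in> ball (c y) r}"
    have N: "openin T N" unfolding N_def by (rule openin_chart_vimage[OF D(1) open_ball])
    have inj: "z \<in> D \<Longrightarrow> inv_into D c (c z) = z" for z using chart(4)[OF D(1)] by simp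
    have NS: "N \<subseteq> S"
    proof
      fix z assume z: "z \<in> N"
      then obtain z' where "z' \<in> D \<inter> S" "c z = c z'" using r(2) by (auto simp: N_def)
      with z show "z \<in> S" using inj_onD[OF chart(4)[OF D(1)], of z z'] by (auto simp: N_def)
    qed
    have "F z = 0" if w: "w \<in> N" "w \<in> Z" and z: "z \<in> N" for w z
    proof -
      obtain M where M: "openin T M" "w \<in> M" "\<And>z. z \<in> M \<Longrightarrow> F z = 0" using w(2) by (auto simp: Z_def)
      have hol: "holomorphic_wrt Jvec ((*) \<i>) (F \<circ> inv_into D c) (ball (c y) r)"
        using F D(1) by (auto simp: holomorphic_fun_def intro: holomorphic_wrt_subset[OF _ r(2)])
      have "open (c ` (D \<inter> M))" by (rule open_chart_image[OF D(1) M(1)])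
      then have "\<forall>\<^sub>F u in nhds (c w). u \<in> c ` (D \<inter> M)"
        using w M(2) by (intro eventually_nhds_in_open) (auto simp: N_def)
      then have "\<forall>\<^sub>F u in nhds (c w). (F \<circ> inv_into D c) u = 0"
        by eventually_elim (auto simp: inj M)
      from vanish_ball[OF hol _ this, of "c z"] show ?thesis
        using w z by (simp add: N_def inj)
    qed
    then have "N \<subseteq> Z" if "N \<inter> Z \<noteq> {}" using that N NS unfolding Z_def by blast
    with N NS D(2) r(1) show ?thesis by (intro exI[of _ N]) (auto simp: N_def)
  qed
  have ZS: "Z \<subseteq> S" by (auto simp: Z_def)
  have top: "topspace (subtopology T S) = S" using SL by auto
  have "openin T Z"
    by (subst openin_subopen) (metis IntI ZS empty_iff nbhd subset_iff)
  then have op: "openin (subtopology T S) Z" using ZS by (auto simp: openin_subtopology)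
  have "openin T (S - Z)"
  proof (subst openin_subopen, intro ballI)
    fix y assume "y \<in> S - Z"
    with nbhd[of y] obtain N where "openin T N" "y \<in> N" "N \<subseteq> S" "N \<inter> Z = {}" by blast
    then show "\<exists>N. openin T N \<and> y \<in> N \<and> N \<subseteq> S - Z" by blast
  qed
  then have "openin (subtopology T S) (S - Z)" by (auto simp: openin_subtopology)
  then have cl: "closedin (subtopology T S) Z" using ZS top by (simp add: closedin_def)
  obtain C where C: "C \<in> connected_components_of (subtopology T S)" "x \<in> C"
    using x top Union_connected_components_of[of "subtopology T S"] by blast
  obtain w where w: "w \<in> C" "w \<in> W" using comp[OF C(1)] by blast
  then have "w \<in> Z" using W(2) vanish_near[OF H V F S W w(2) eq] by (auto simp: Z_def)
  moreover have "connectedin (subtopology T S) C" using C(1) by (rule connectedin_connected_components_of)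
  ultimately have "C \<subseteq> Z"
    using connectedin_clopen_cases[OF _ cl op, of C] w(1) by (auto simp: disjnt_iff)
  with C(2) show ?thesis by (auto simp: Z_def)
qed

end

section \<open>The bracket\<close>

context complex_lie
begin

abbreviation "conj_coord x v \<equiv> coord L (x \<otimes> coord_inv L v \<otimes> inv x)"

lemma Ad_derivative:
  assumes x: "x \<in> carrier L"
  shows "((\<lambda>v. conj_coord x v) has_derivative Ad L x) (at e0)" "Ad L x (Jvec w) = Jvec (Ad L x w)"
proof -
  have hi: "hol_into Jvec (\<lambda>v. x \<otimes> coord_inv L v \<otimes> inv x) e0"
    by (intro hol_into_mult hol_into_const hol_into_coord_inv e0_mem inv_closed x)
  have "x \<otimes> coord_inv L e0 \<otimes> inv x = \<one>" using x by simp
  then have *: "holomorphic_wrt Jvec Jvec (\<lambda>v. conj_coord x v) {e0}"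
    using hol_intoD(2)[OF hi id_chart(1)] id_chart(2) by (simp add: comp_def)
  show "((\<lambda>v. conj_coord x v) has_derivative Ad L x) (at e0)"
    using holomorphic_wrt_frechet(1)[OF *] by (simp add: Ad_def[abs_def])
  show "Ad L x (Jvec w) = Jvec (Ad L x w)"
    using holomorphic_wrt_frechet(2)[OF *] by (simp add: Ad_def)
qed

lemma linear_Ad: "x \<in> carrier L \<Longrightarrow> linear (Ad L x)"
  using Ad_derivative(1) has_derivative_linear by blast

lemma coord_inv_closed: "u \<in> coord L ` D0 \<Longrightarrow> coord_inv L u \<in> carrier L"
  using hol_into_carrier[OF hol_into_coord_inv] by simp

lemma open_D0: "open (coord L ` D0)" by (rule chart(3)[OF id_chart(1)])

text \<open>Again a directional derivative along \<open>(0, w)\<close> on a slice, now of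
  conjugation in both variables. It ensures that the derivative chosen in \<open>bracket\<close>
  really exists and is complex linear in the first argument.\<close>

lemma holomorphic_Ad: "holomorphic_wrt Jvec Jvec (\<lambda>u. Ad L (coord_inv L u) w) (coord L ` D0)"
proof -
  interpret P: complex_structure J2 by (rule complex_structure_J2)
  let ?m = "\<lambda>p. coord_inv L (fst p) \<otimes> coord_inv L (snd p) \<otimes> inv (coord_inv L (fst p))"
  define A where "A = coord L ` D0 \<times> coord L ` D0"
  define \<Omega> where "\<Omega> = {p \<in> A. ?m p \<in> D0}"
  have "open A" unfolding A_def by (intro open_Times open_D0)
  have m: "hol_into J2 ?m p" if "p \<in> A" for p
    by (intro hol_into_mult hol_into_m_inv
        hol_into_compose[OF hol_into_coord_inv] holomorphic_wrt_fst holomorphic_wrt_snd)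
      (use that in \<open>auto simp: A_def\<close>)
  have "open \<Omega>" unfolding \<Omega>_def by (rule open_hol_into_vimage[OF m \<open>open A\<close> chart(1)[OF id_chart(1)]])
  have "holomorphic_wrt J2 Jvec (\<lambda>p. coord L (?m p)) \<Omega>"
    unfolding holomorphic_wrt_singleton[where S = \<Omega>]
  proof
    fix p assume "p \<in> \<Omega>"
    then show "holomorphic_wrt J2 Jvec (\<lambda>p. coord L (?m p)) {p}"
      using hol_intoD(2)[OF m id_chart(1), of p] by (simp add: \<Omega>_def comp_def)
  qed
  note \<Psi> = this and \<Psi>' = P.holomorphic_directional_derivative_vec[OF this \<open>open \<Omega>\<close>, of "(0, w)"]
  have mem: "(u, e0) \<in> \<Omega>" if "u \<in> coord L ` D0" for u
    using that e0_mem coord_inv_closed[OF that] id_chart(2) by (simp add: \<Omega>_def A_def)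
  have eq: "frechet_derivative (\<lambda>p. coord L (?m p)) (at (u, e0)) (0, w) = Ad L (coord_inv L u) w"
    if "u \<in> coord L ` D0" for u
  proof -
    have "((\<lambda>v. (u, v)) has_derivative (\<lambda>h. (0, h))) (at e0)" by (auto intro!: derivative_eq_intros)
    from has_derivative_compose[OF this holomorphic_wrt_frechet(1)[OF \<Psi> mem[OF that]]]
    show ?thesis
      using has_derivative_unique[OF Ad_derivative(1)[OF coord_inv_closed[OF that]]] by (simp add: fun_eq_iff)
  qed
  show ?thesis
    unfolding holomorphic_wrt_singleton[where S = "coord L ` D0"]
  proof
    fix u assume u: "u \<in> coord L ` D0"
    have "holomorphic_wrt J2 Jvec (\<lambda>p. frechet_derivative (\<lambda>p. coord L (?m p)) (at p) (0, w)) {(u, e0)}"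
      by (rule holomorphic_wrt_subset[OF \<Psi>']) (use mem[OF u] in auto)
    from holomorphic_wrt_compose[OF holomorphic_wrt_Pair_const this]
    show "holomorphic_wrt Jvec Jvec (\<lambda>u. Ad L (coord_inv L u) w) {u}"
      by (rule holomorphic_wrt_cong)
        (use eventually_nhds_in_open[OF open_D0 u] eq in \<open>auto elim!: eventually_mono\<close>)
  qed
qed

lemma bracket_derivative:
  "((\<lambda>u. Ad L (coord_inv L u) w) has_derivative (\<lambda>v. bracket L v w)) (at e0)"
  using holomorphic_wrt_frechet(1)[OF holomorphic_Ad e0_mem] by (simp add: bracket_def[abs_def])

lemma bracket_Jvec_left: "bracket L (Jvec v) w = Jvec (bracket L v w)"
  using holomorphic_wrt_frechet(2)[OF holomorphic_Ad e0_mem] by (simp add: bracket_def)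

lemma linear_bracket_left: "linear (\<lambda>v. bracket L v w)"
  using bracket_derivative by (rule has_derivative_linear)

lemma bracket_unique:
  assumes "\<And>u. u \<in> coord L ` D0 \<Longrightarrow> f u = Ad L (coord_inv L u) w" "(f has_derivative f') (at e0)"
  shows "bracket L v w = f' v"
proof -
  have "\<forall>\<^sub>F u in nhds e0. f u = Ad L (coord_inv L u) w"
    using eventually_nhds_in_open[OF open_D0 e0_mem] by eventually_elim (rule assms(1))
  from has_derivative_cong_nhds[OF this assms(2)]
  show ?thesis using has_derivative_unique[OF bracket_derivative] by (metis (no_types))
qed

lemma linear_bracket_right: "linear (bracket L v)"
proof (rule linearI)
  show "bracket L v (w + w') = bracket L v w + bracket L v w'" for w w'
    by (rule bracket_unique[of "\<lambda>u. Ad L (coord_inv L u) w + Ad L (coord_inv L u) w'"])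
      (auto intro!: has_derivative_add bracket_derivative simp: linear_add[OF linear_Ad] coord_inv_closed)
  show "bracket L v (r *\<^sub>R w) = r *\<^sub>R bracket L v w" for r w
    by (rule bracket_unique[of "\<lambda>u. r *\<^sub>R Ad L (coord_inv L u) w"])
      (auto intro!: has_derivative_scaleR_right bracket_derivative simp: linear_scale[OF linear_Ad] coord_inv_closed)
qed

lemma bounded_linear_Jvec: "bounded_linear (Jvec :: complex ^ 'm \<Rightarrow> complex ^ 'm)"
  using Jvec.linear_J linear_conv_bounded_linear by blast

lemma bracket_Jvec_right: "bracket L v (Jvec w) = Jvec (bracket L v w)"
  by (rule bracket_unique[of "\<lambda>u. Jvec (Ad L (coord_inv L u) w)"])
    (auto intro!: bounded_linear.has_derivative[OF bounded_linear_Jvec] bracket_derivative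
      simp: Ad_derivative(2) coord_inv_closed)

text \<open>A one-parameter subgroup commutes with itself, so \<open>Ad\<close> fixes its velocity.\<close>

lemma bracket_self:
  assumes H: "subgroup H L" and v: "v \<in> lie_alg L H"
  shows "bracket L v v = 0"
proof -
  let ?\<gamma> = "one_param_sub L H v"
  note HL = subgroup.subset[OF H] and \<gamma> = one_param_sub[OF v]
  note g0 = one_param_one[OF \<gamma> HL]
  have car: "?\<gamma> t \<in> carrier L" for t using \<gamma> HL by (auto simp: one_param_def)
  have add: "?\<gamma> (s + t) = ?\<gamma> s \<otimes> ?\<gamma> t" for s t using \<gamma> by (simp add: one_param_def)
  have comm: "?\<gamma> s \<otimes> ?\<gamma> t \<otimes> inv (?\<gamma> s) = ?\<gamma> t" for s t
  proof -
    have "?\<gamma> s \<otimes> ?\<gamma> t = ?\<gamma> t \<otimes> ?\<gamma> s" using add[of s t] add[of t s] by (simp add: add.commute)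
    then show ?thesis using car by (simp add: m_assoc)
  qed
  have Ad: "Ad L (?\<gamma> s) v = v" for s
  proof -
    have "((\<lambda>t. coord L (?\<gamma> s \<otimes> ?\<gamma> t \<otimes> inv (?\<gamma> s))) has_vector_derivative Ad L (?\<gamma> s) v) (at 0)"
      by (rule one_param_derivative[OF \<gamma> HL, of "\<lambda>y. coord L (?\<gamma> s \<otimes> y \<otimes> inv (?\<gamma> s))"])
        (rule Ad_derivative(1)[OF car])
    then have "((\<lambda>t. coord L (?\<gamma> t)) has_vector_derivative Ad L (?\<gamma> s) v) (at 0)" by (simp only: comm)
    moreover have "((\<lambda>t. coord L (?\<gamma> t)) has_vector_derivative v) (at 0)"
      using \<gamma> by (simp add: one_param_def)
    ultimately show ?thesis by (rule vector_derivative_unique_at)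
  qed
  have "((\<lambda>t. Ad L (?\<gamma> t) v) has_vector_derivative bracket L v v) (at 0)"
    by (rule one_param_derivative[OF \<gamma> HL, of "\<lambda>y. Ad L y v"]) (rule bracket_derivative)
  then have "((\<lambda>t::real. v) has_vector_derivative bracket L v v) (at 0)" by (simp only: Ad)
  then show ?thesis by (rule vector_derivative_unique_at) (rule has_vector_derivative_const)
qed

text \<open>Polarisation of \<open>bracket_self\<close>; the sum \<open>v + w\<close> must again be
  the velocity of a one-parameter subgroup of \<open>H\<close>, whence the subspace
  condition.\<close>

lemma bracket_antisym:
  assumes H: "subgroup H L" and V: "subspace (lie_alg L H)" and v: "v \<in> lie_alg L H" "w \<in> lie_alg L H"
  shows "bracket L v w = - bracket L w v"
proof -
  have "bracket L (v + w) (v + w) = 0" by (rule bracket_self[OF H]) (rule subspace_add[OF V v])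
  then have "bracket L v w + bracket L w v = 0"
    using bracket_self[OF H v(1)] bracket_self[OF H v(2)]
    by (simp add: linear_add[OF linear_bracket_left] linear_add[OF linear_bracket_right] add.commute)
  then show ?thesis by (simp add: eq_neg_iff_add_eq_0)
qed

end

section \<open>Scalar products and traces\<close>

text \<open>Bilinearity is relative to \<open>V\<close> because scalar products such as
  \<open>dual_metric\<close> are total functions with meaningful values only on their Lie
  algebra.\<close>

definition bilinear_on :: "'v::real_vector set \<Rightarrow> ('v \<Rightarrow> 'v \<Rightarrow> 'w::real_vector) \<Rightarrow> bool" where
  "bilinear_on V f \<longleftrightarrow> (\<forall>x\<in>V. \<forall>y\<in>V. \<forall>z\<in>V. \<forall>a.
     f (a *\<^sub>R x + y) z = a *\<^sub>R f x z + f y z \<and> f z (a *\<^sub>R x + y) = a *\<^sub>R f z x + f z y)"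

lemma linear_on_sum:
  fixes h :: "'v::real_vector \<Rightarrow> 'w::real_vector"
  assumes V: "subspace V" and h: "\<And>x y a. x \<in> V \<Longrightarrow> y \<in> V \<Longrightarrow> h (a *\<^sub>R x + y) = a *\<^sub>R h x + h y"
    and E: "finite E" "E \<subseteq> V"
  shows "h (\<Sum>e\<in>E. c e *\<^sub>R e) = (\<Sum>e\<in>E. c e *\<^sub>R h e)"
  using E
proof (induction E)
  case empty
  show ?case using h[of 0 0 1] subspace_0[OF V] by simp
next
  case (insert e E)
  have "(\<Sum>e\<in>E. c e *\<^sub>R e) \<in> V"
    using insert by (intro subspace_sum[OF V] subspace_scale[OF V]) auto
  with insert show ?case by (simp add: h)
qed

lemma bilinear_on_sum:
  assumes "bilinear_on V f" "subspace V" "finite E" "E \<subseteq> V" "z \<in> V"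
  shows "f (\<Sum>e\<in>E. c e *\<^sub>R e) z = (\<Sum>e\<in>E. c e *\<^sub>R f e z)"
    and "f z (\<Sum>e\<in>E. c e *\<^sub>R e) = (\<Sum>e\<in>E. c e *\<^sub>R f z e)"
  using assms
  by (auto intro!: linear_on_sum[of V "\<lambda>x. f x z"] linear_on_sum[of V "\<lambda>x. f z x"] simp: bilinear_on_def)

lemma bilinear_on_zero:
  assumes "bilinear_on V f" "subspace V" "z \<in> V" shows "f 0 z = 0" "f z 0 = 0"
  using bilinear_on_sum[OF assms(1,2), of "{}" z] assms(3) by auto

lemma bilinear_on_uminus:
  assumes "bilinear_on V f" "subspace V" "x \<in> V" "z \<in> V" shows "f (- x) z = - f x z" "f z (- x) = - f z x"
  using bilinear_on_sum[OF assms(1,2), of "{x}" z "\<lambda>_. -1"] assms(3,4) by auto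

lemma bilinear_on_add:
  assumes "bilinear_on V f" "x \<in> V" "y \<in> V" "z \<in> V"
  shows "f (x + y) z = f x z + f y z" "f z (x + y) = f z x + f z y"
  using assms unfolding bilinear_on_def by (metis scaleR_one)+

text \<open>Definiteness is not assumed: the dual metric is negative on \<open>\<kk>\<close> and
  positive on \<open>\<i>\<pp>\<close>. Nondegeneracy comes from an orthonormal frame where one is
  given.\<close>

locale framed_space =
  fixes V :: "'v::euclidean_space set" and m :: "'v \<Rightarrow> 'v \<Rightarrow> real"
  assumes V: "subspace V" and bil: "bilinear_on V m" and sym: "\<And>x y. x \<in> V \<Longrightarrow> y \<in> V \<Longrightarrow> m x y = m y x"
begin

lemma frame_props:
  assumes "orthonormal_frame V m E"
  shows "finite E" "E \<subseteq> V" "\<And>e. e \<in> E \<Longrightarrow> m e e * m e e = 1"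
    "\<And>e f. e \<in> E \<Longrightarrow> f \<in> E \<Longrightarrow> e \<noteq> f \<Longrightarrow> m e f = 0"
  using assms span_superset[of E] independent_imp_finite[of E]
  by (auto simp: orthonormal_frame_def abs_if split: if_splits)

text \<open>The coefficient of \<open>e\<close> is \<open>m v e / m e e\<close>, and
  \<open>m e e\<close> is 1 or -1, thus its own inverse.\<close>

lemma frame_expand:
  assumes E: "orthonormal_frame V m E" and v: "v \<in> V"
  shows "v = (\<Sum>e\<in>E. (m e e * m v e) *\<^sub>R e)"
proof -
  note E' = frame_props[OF E]
  obtain c where c: "v = (\<Sum>e\<in>E. c e *\<^sub>R e)"
  proof -
    have "v \<in> range (\<lambda>c. \<Sum>e\<in>E. c e *\<^sub>R e)"
      using E v span_finite[OF E'(1)] by (simp add: orthonormal_frame_def)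
    then show ?thesis using that by blast
  qed
  have "m v f = c f * m f f" if f: "f \<in> E" for f
  proof -
    have "m v f = (\<Sum>e\<in>E. c e *\<^sub>R m e f)"
      unfolding c using f E'(2) by (intro bilinear_on_sum(1)[OF bil V E'(1,2)]) auto
    also have "\<dots> = c f * m f f"
      by (subst sum.remove[OF E'(1) f]) (auto intro!: sum.neutral simp: E'(4) f)
    finally show ?thesis .
  qed
  then have "m e e * m v e = c e" if "e \<in> E" for e
    using that E'(3)[of e] by (metis mult.assoc mult.commute mult.right_neutral)
  then show ?thesis by (subst c) simp
qed

lemma nondegenerate:
  assumes E: "orthonormal_frame V m E" and "x \<in> V" "y \<in> V" "\<And>z. z \<in> V \<Longrightarrow> m x z = m y z"
  shows "x = y"
proof -
  have "x = (\<Sum>e\<in>E. (m e e * m x e) *\<^sub>R e)" by (rule frame_expand[OF E assms(2)])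
  also have "\<dots> = (\<Sum>e\<in>E. (m e e * m y e) *\<^sub>R e)"
    using frame_props(2)[OF E] assms(4) by (intro sum.cong) auto
  also have "\<dots> = y" by (rule frame_expand[OF E assms(3), symmetric])
  finally show ?thesis .
qed

lemma riesz:
  assumes E: "orthonormal_frame V m E"
    and h: "\<And>x y a. x \<in> V \<Longrightarrow> y \<in> V \<Longrightarrow> h (a *\<^sub>R x + y) = a * h x + (h y :: real)"
  shows "\<exists>z\<in>V. \<forall>t\<in>V. m z t = h t"
proof (intro bexI ballI)
  note E' = frame_props[OF E]
  let ?z = "\<Sum>e\<in>E. (m e e * h e) *\<^sub>R e"
  show "?z \<in> V" using E' by (intro subspace_sum[OF V] subspace_scale[OF V]) auto
  fix t assume t: "t \<in> V"
  have "h t = h (\<Sum>e\<in>E. (m e e * m t e) *\<^sub>R e)" using frame_expand[OF E t] by simp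
  also have "\<dots> = (\<Sum>e\<in>E. (m e e * m t e) *\<^sub>R h e)"
    by (rule linear_on_sum[OF V _ E'(1,2)]) (simp add: h)
  also have "\<dots> = (\<Sum>e\<in>E. (m e e * h e) *\<^sub>R m e t)"
    using E'(2) t sym by (intro sum.cong) (auto simp: subset_iff mult_ac)
  also have "\<dots> = m ?z t" by (rule bilinear_on_sum(1)[OF bil V E'(1,2) t, symmetric])
  finally show "m ?z t = h t" by simp
qed

text \<open>The operators are defined through the arbitrarily chosen \<open>frame\<close>, while the
  comparison needs adapted frames. Expanding the vectors of \<open>F\<close> in \<open>E\<close>
  leaves the Gram sums over \<open>F\<close>, which collapse to \<open>m b c\<close>, and
  orthogonality of \<open>E\<close> keeps the diagonal.\<close>

lemma trace_frame_independent:
  fixes f :: "'v \<Rightarrow> 'v \<Rightarrow> 'w::real_vector"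
  assumes E: "orthonormal_frame V m E" and F: "orthonormal_frame V m F" and f: "bilinear_on V f"
  shows "(\<Sum>e\<in>E. m e e *\<^sub>R f e e) = (\<Sum>e\<in>F. m e e *\<^sub>R f e e)"
proof -
  note E' = frame_props[OF E] and F' = frame_props[OF F]
  have expand: "f a a = (\<Sum>b\<in>E. \<Sum>c\<in>E. (m b b * m a b * (m c c * m a c)) *\<^sub>R f b c)" if a: "a \<in> V" for a
  proof -
    have "f a a = f (\<Sum>e\<in>E. (m e e * m a e) *\<^sub>R e) a" using frame_expand[OF E a] by simp
    also have "\<dots> = (\<Sum>b\<in>E. (m b b * m a b) *\<^sub>R f b a)" by (rule bilinear_on_sum(1)[OF f V E'(1,2) a])
    also have "\<dots> = (\<Sum>b\<in>E. (m b b * m a b) *\<^sub>R (\<Sum>c\<in>E. (m c c * m a c) *\<^sub>R f b c))"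
    proof (rule sum.cong[OF refl])
      fix b assume "b \<in> E"
      have "f b a = f b (\<Sum>e\<in>E. (m e e * m a e) *\<^sub>R e)" using frame_expand[OF E a] by simp
      also have "\<dots> = (\<Sum>c\<in>E. (m c c * m a c) *\<^sub>R f b c)"
        using \<open>b \<in> E\<close> E'(2) by (intro bilinear_on_sum(2)[OF f V E'(1,2)]) auto
      finally show "(m b b * m a b) *\<^sub>R f b a = (m b b * m a b) *\<^sub>R (\<Sum>c\<in>E. (m c c * m a c) *\<^sub>R f b c)"
        by simp
    qed
    finally show ?thesis by (simp add: scaleR_sum_right)
  qed
  have gram: "(\<Sum>a\<in>F. m a a * m a b * m a c) = m b c" if "b \<in> V" "c \<in> V" for b c
  proof -
    have "m b c = m (\<Sum>a\<in>F. (m a a * m b a) *\<^sub>R a) c" using frame_expand[OF F that(1)] by simp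
    also have "\<dots> = (\<Sum>a\<in>F. (m a a * m b a) *\<^sub>R m a c)"
      by (rule bilinear_on_sum(1)[OF bil V F'(1,2) that(2)])
    also have "\<dots> = (\<Sum>a\<in>F. m a a * m a b * m a c)"
      using F'(2) sym that by (intro sum.cong) (auto simp: subset_iff)
    finally show ?thesis by simp
  qed
  have "(\<Sum>a\<in>F. m a a *\<^sub>R f a a) =
      (\<Sum>a\<in>F. \<Sum>b\<in>E. \<Sum>c\<in>E. (m a a * (m b b * m a b * (m c c * m a c))) *\<^sub>R f b c)"
    using F'(2) by (intro sum.cong) (auto simp: expand scaleR_sum_right)
  also have "\<dots> = (\<Sum>b\<in>E. \<Sum>c\<in>E. \<Sum>a\<in>F. (m a a * (m b b * m a b * (m c c * m a c))) *\<^sub>R f b c)"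
    by (subst sum.swap) (intro sum.cong[OF refl] sum.swap)
  also have "\<dots> = (\<Sum>b\<in>E. \<Sum>c\<in>E. (m b b * m c c * (\<Sum>a\<in>F. m a a * m a b * m a c)) *\<^sub>R f b c)"
    by (simp add: sum_distrib_left scaleR_sum_left mult_ac)
  also have "\<dots> = (\<Sum>b\<in>E. \<Sum>c\<in>E. (m b b * m c c * m b c) *\<^sub>R f b c)"
    using E'(2) by (intro sum.cong) (auto simp: gram subset_iff)
  also have "\<dots> = (\<Sum>b\<in>E. m b b *\<^sub>R f b b)"
  proof (rule sum.cong[OF refl])
    fix b assume b: "b \<in> E"
    have "(\<Sum>c\<in>E. (m b b * m c c * m b c) *\<^sub>R f b c) = (m b b * m b b * m b b) *\<^sub>R f b b"
      by (subst sum.remove[OF E'(1) b]) (auto intro!: sum.neutral dest: E'(4)[OF b])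
    then show "(\<Sum>c\<in>E. (m b b * m c c * m b c) *\<^sub>R f b c) = m b b *\<^sub>R f b b"
      using E'(3)[OF b] by simp
  qed
  finally show ?thesis by simp
qed

text \<open>Independence is automatic: pairing a linear relation with one of its vectors isolates
  the coefficient of that vector.\<close>

lemma orthonormal_frameI:
  assumes E: "finite E" "E \<subseteq> V" "V \<subseteq> span E" and n: "\<And>e. e \<in> E \<Longrightarrow> \<bar>m e e\<bar> = 1"
    and o: "\<And>e f. e \<in> E \<Longrightarrow> f \<in> E \<Longrightarrow> e \<noteq> f \<Longrightarrow> m e f = 0"
  shows "orthonormal_frame V m E"
proof -
  have "\<not> dependent E"
  proof
    assume "dependent E"
    then obtain c f where c: "f \<in> E" "c f \<noteq> 0" "(\<Sum>e\<in>E. c e *\<^sub>R e) = 0"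
      using dependent_finite[OF E(1)] by blast
    then have "0 = m (\<Sum>e\<in>E. c e *\<^sub>R e) f"
      using bilinear_on_zero(1)[OF bil V] E(2) by auto
    also have "\<dots> = (\<Sum>e\<in>E. c e *\<^sub>R m e f)" using c E by (intro bilinear_on_sum(1)[OF bil V]) auto
    also have "\<dots> = c f * m f f"
      by (subst sum.remove[OF E(1) c(1)]) (auto intro!: sum.neutral simp: o c)
    finally show False using c(2) n[OF c(1)] by auto
  qed
  moreover have "span E = V" using E V by (metis span_minimal subset_antisym)
  ultimately show ?thesis using n o by (auto simp: orthonormal_frame_def)
qed

end

text \<open>Gram-Schmidt with respect to \<open>m\<close> instead of the ambient inner
  product.\<close>

lemma positive_frame_exists:
  assumes V: "subspace V" and m: "inner_product_on V (m :: 'v::euclidean_space \<Rightarrow> 'v \<Rightarrow> real)"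
  shows "\<exists>E. finite E \<and> E \<subseteq> V \<and> V \<subseteq> span E \<and> (\<forall>e\<in>E. m e e = 1) \<and> (\<forall>e\<in>E. \<forall>f\<in>E. e \<noteq> f \<longrightarrow> m e f = 0)"
proof -
  have sym: "\<And>x y. x \<in> V \<Longrightarrow> y \<in> V \<Longrightarrow> m x y = m y x"
    and lin: "\<And>x y z a. x \<in> V \<Longrightarrow> y \<in> V \<Longrightarrow> z \<in> V \<Longrightarrow> m (a *\<^sub>R x + y) z = a * m x z + m y z"
    and pos: "\<And>x. x \<in> V \<Longrightarrow> x \<noteq> 0 \<Longrightarrow> m x x > 0"
    using m by (auto simp: inner_product_on_def)
  have bil: "bilinear_on V m"
    unfolding bilinear_on_def using lin sym V by (auto simp: subspace_add subspace_scale)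
  interpret framed_space V m by (rule framed_space.intro[OF V bil sym])
  obtain B where B: "B \<subseteq> V" "independent B" "V \<subseteq> span B" by (rule basis_exists[of V])
  have "finite B" using B(2) by (rule independent_imp_finite)
  then have "B \<subseteq> V \<Longrightarrow> \<exists>E. finite E \<and> E \<subseteq> V \<and> B \<subseteq> span E \<and> (\<forall>e\<in>E. m e e = 1) \<and> (\<forall>e\<in>E. \<forall>f\<in>E. e \<noteq> f \<longrightarrow> m e f = 0)"
  proof (induction B)
    case (insert b B)
    have "B \<subseteq> V" using insert.prems by simp
    from insert.IH[OF this] obtain E where E0: "finite E \<and> E \<subseteq> V \<and> B \<subseteq> span E \<and>
      (\<forall>e\<in>E. m e e = 1) \<and> (\<forall>e\<in>E. \<forall>f\<in>E. e \<noteq> f \<longrightarrow> m e f = 0)" by (rule exE)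
    then have E: "finite E" "E \<subseteq> V" "B \<subseteq> span E" "\<And>e. e \<in> E \<Longrightarrow> m e e = 1"
      "\<And>e f. e \<in> E \<Longrightarrow> f \<in> E \<Longrightarrow> e \<noteq> f \<Longrightarrow> m e f = 0" by simp_all
    have b: "b \<in> V" using insert by simp
    define s where "s = (\<Sum>e\<in>E. m b e *\<^sub>R e)"
    have s: "s \<in> span E"
      unfolding s_def by (intro span_sum span_scale span_base)
    then have s: "s \<in> V" "s \<in> span E" using span_minimal[OF E(2) V] by auto
    \<comment> \<open>The induction does not carry independence of the basis, so \<open>b\<close>
      may already equal its projection \<open>s\<close>, and then no vector is added.\<close>
    show ?case
    proof (cases "b = s")
      case True
      then have "insert b B \<subseteq> span E" using s E(3) by simp
      then show ?thesis using E by (intro exI[of _ E] conjI ballI impI) simp_all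
    next
      case False
      define w where "w = b - s"
      have w: "w \<in> V" "w \<noteq> 0" unfolding w_def using False b s by (auto intro: subspace_diff[OF V])
      have mw: "m w w > 0" using pos w by blast
      have orth: "m w f = 0" if f: "f \<in> E" for f
      proof -
        have fV: "f \<in> V" using f E by auto
        have "m s f = (\<Sum>e\<in>E. m b e *\<^sub>R m e f)" unfolding s_def by (rule bilinear_on_sum(1)[OF bil V E(1,2) fV])
        also have "\<dots> = m b f"
          by (subst sum.remove[OF E(1) f]) (auto intro!: sum.neutral simp: E f)
        finally have "m s f = m b f" .
        moreover have "m w f = - 1 * m s f + m b f"
          using lin[of s b f "-1"] s b fV by (simp add: w_def)
        ultimately show ?thesis by simp
      qed
      define q where "q = (1 / sqrt (m w w)) *\<^sub>R w"
      have q: "q \<in> V" unfolding q_def by (rule subspace_scale[OF V w(1)])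
      have mq: "m q x = (1 / sqrt (m w w)) * m w x" if "x \<in> V" for x
        using lin[of w 0 x "1 / sqrt (m w w)"] that w(1) subspace_0[OF V] bilinear_on_zero(1)[OF bil V that]
        by (simp add: q_def)
      have qE: "m q f = 0" "m f q = 0" if "f \<in> E" for f
        using mq[of f] orth[OF that] sym[of q f] that E(2) q by auto
      have "m q q = (1 / sqrt (m w w)) * ((1 / sqrt (m w w)) * m w w)"
        using mq[OF q] mq[OF w(1)] sym[OF q w(1)] by simp
      also have "\<dots> = 1" using mw by (simp add: field_simps)
      finally have "m q q = 1" .
      have "b = s + sqrt (m w w) *\<^sub>R q" using mw by (simp add: q_def w_def)
      moreover have "s + sqrt (m w w) *\<^sub>R q \<in> span (insert q E)"
        by (intro span_add span_scale subsetD[OF span_mono s(2)] span_base) auto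
      ultimately have "b \<in> span (insert q E)" by simp
      moreover have "B \<subseteq> span (insert q E)" using E(3) span_mono[of E "insert q E"] by blast
      ultimately have "insert b B \<subseteq> span (insert q E)" by simp
      then show ?thesis
        using E(1,2,4,5) q qE \<open>m q q = 1\<close> by (intro exI[of _ "insert q E"] conjI ballI impI) auto
    qed
  qed auto
  then obtain E where E: "finite E" "E \<subseteq> V" "B \<subseteq> span E" "(\<forall>e\<in>E. m e e = 1) \<and> (\<forall>e\<in>E. \<forall>f\<in>E. e \<noteq> f \<longrightarrow> m e f = 0)"
    using B(1) by blast
  have "V \<subseteq> span E" using B(3) E(3) span_minimal[OF _ subspace_span] by blast
  with E show ?thesis by blast
qed

section \<open>Laplacian and conformality operator in a given frame\<close>

lemma (in framed_space) trace_of_real: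
  fixes f :: "'v \<Rightarrow> 'v \<Rightarrow> complex"
  assumes "orthonormal_frame V m E" "orthonormal_frame V m F" "bilinear_on V f"
  shows "(\<Sum>e\<in>E. complex_of_real (m e e) * f e e) = (\<Sum>e\<in>F. complex_of_real (m e e) * f e e)"
  using trace_frame_independent[OF assms] by (simp add: scaleR_conv_of_real)

context complex_lie
begin

lemma orthonormal_frame_frame: "orthonormal_frame V m E \<Longrightarrow> orthonormal_frame V m (frame V m)"
  unfolding frame_def by (rule someI)

text \<open>In Koszul's formula with both fields equal to \<open>e\<close>, the term with
  \<open>bracket L e e\<close> vanishes and the other two coincide by antisymmetry. Existence of the
  vector is \<open>riesz\<close>, uniqueness is \<open>nondegenerate\<close>.\<close>

lemma levi_civita_self:
  assumes H: "subgroup H L" and fs: "framed_space (lie_alg L H) m"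
    and br: "\<forall>x\<in>lie_alg L H. \<forall>y\<in>lie_alg L H. bracket L x y \<in> lie_alg L H"
    and E: "orthonormal_frame (lie_alg L H) m E" and e: "e \<in> lie_alg L H"
  shows "levi_civita L (lie_alg L H) m e e \<in> lie_alg L H"
    and "t \<in> lie_alg L H \<Longrightarrow> m (levi_civita L (lie_alg L H) m e e) t = m (bracket L t e) e"
proof -
  let ?V = "lie_alg L H"
  interpret framed_space ?V m by (rule fs)
  have kos: "m (bracket L e e) t - m (bracket L e t) e + m (bracket L t e) e = 2 * m (bracket L t e) e"
    if t: "t \<in> ?V" for t
    using bracket_self[OF H e] bracket_antisym[OF H V e t] bilinear_on_zero(1)[OF bil V t]
      bilinear_on_uminus(1)[OF bil V br[rule_format, OF t e] e] by simp
  have "\<exists>z\<in>?V. \<forall>t\<in>?V. m z t = m (bracket L t e) e"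
  proof (rule riesz[OF E])
    fix x y a assume "x \<in> ?V" "y \<in> ?V"
    then show "m (bracket L (a *\<^sub>R x + y) e) e = a * m (bracket L x e) e + m (bracket L y e) e"
      using bil br e unfolding bilinear_on_def
      by (simp add: linear_add[OF linear_bracket_left] linear_scale[OF linear_bracket_left])
  qed
  then obtain z where z: "z \<in> ?V" "\<And>t. t \<in> ?V \<Longrightarrow> m z t = m (bracket L t e) e" by blast
  have "levi_civita L ?V m e e = z"
    unfolding levi_civita_def
  proof (rule the_equality)
    show "z \<in> ?V \<and> (\<forall>t\<in>?V. 2 * m z t = m (bracket L e e) t - m (bracket L e t) e + m (bracket L t e) e)"
      using z kos by simp
    fix z' assume z': "z' \<in> ?V \<and> (\<forall>t\<in>?V. 2 * m z' t = m (bracket L e e) t - m (bracket L e t) e + m (bracket L t e) e)"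
    show "z' = z"
      by (rule nondegenerate[OF E]) (use z z' kos in auto)
  qed
  with z show "levi_civita L ?V m e e \<in> ?V" "t \<in> ?V \<Longrightarrow> m (levi_civita L ?V m e e) t = m (bracket L t e) e"
    by auto
qed

text \<open>The sum in the condition on \<open>N\<close> is the trace of \<open>bracket L t\<close>,
  so \<open>N\<close> is the signed sum of the Levi-Civita terms, described without reference to a
  frame. This form can be matched between the two groups.\<close>

lemma laplacian_eq:
  assumes H: "subgroup H L" and fs: "framed_space (lie_alg L H) m"
    and br: "\<forall>x\<in>lie_alg L H. \<forall>y\<in>lie_alg L H. bracket L x y \<in> lie_alg L H"
    and E: "orthonormal_frame (lie_alg L H) m E"
    and N: "N \<in> lie_alg L H" "\<And>t. t \<in> lie_alg L H \<Longrightarrow> m N t = (\<Sum>e\<in>E. m e e * m (bracket L t e) e)"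
    and F: "holomorphic_fun L S F" and S: "openin T S" and W: "openin (subtopology T H) W" "W \<subseteq> S" "x \<in> W"
    and eq: "\<And>y. y \<in> W \<Longrightarrow> \<phi> y = F y"
  shows "laplacian L H m \<phi> x = (\<Sum>e\<in>E. complex_of_real (m e e) * left_deriv e (left_deriv e F) x) - left_deriv N F x"
proof -
  let ?V = "lie_alg L H" and ?E = "frame (lie_alg L H) m"
  let ?N = "\<lambda>e. levi_civita L ?V m e e"
  interpret framed_space ?V m by (rule fs)
  have E': "orthonormal_frame ?V m ?E" by (rule orthonormal_frame_frame[OF E])
  note fE = frame_props[OF E']
  note lc = levi_civita_self[OF H fs br E']
  have x: "x \<in> S" "x \<in> carrier L" using W S openin_subset[OF S] by auto
  have "(\<Sum>e\<in>?E. m e e *\<^sub>R ?N e) = N"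
  proof (rule nondegenerate[OF E _ N(1)])
    show mem: "(\<Sum>e\<in>?E. m e e *\<^sub>R ?N e) \<in> ?V"
      using fE lc by (intro subspace_sum[OF V] subspace_scale[OF V]) auto
    fix t assume t: "t \<in> ?V"
    have "m (\<Sum>e\<in>?E. m e e *\<^sub>R ?N e) t = (\<Sum>e\<in>?E. m e e *\<^sub>R m (?N e) t)"
    proof -
      \<comment> \<open>\<open>bilinear_on_sum\<close> handles combinations of the frame vectors
        themselves; the summands here are the vectors \<open>?N e\<close>.\<close>
      have "m (\<Sum>e\<in>A. m e e *\<^sub>R ?N e) t = (\<Sum>e\<in>A. m e e *\<^sub>R m (?N e) t) \<and> (\<Sum>e\<in>A. m e e *\<^sub>R ?N e) \<in> ?V"
        if "finite A" "A \<subseteq> ?V" for A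
        using that
      proof (induction A)
        case empty
        show ?case using bilinear_on_zero(1)[OF bil V t] subspace_0[OF V] by simp
      next
        case (insert a A)
        then show ?case
          using bil t lc(1)[of a] unfolding bilinear_on_def
          by (auto intro!: subspace_add[OF V] subspace_scale[OF V])
      qed
      then show ?thesis using fE by blast
    qed
    also have "\<dots> = (\<Sum>e\<in>?E. m e e *\<^sub>R m (bracket L t e) e)"
      using fE(2) lc(2)[OF _ t] by (intro sum.cong) auto
    also have "\<dots> = (\<Sum>e\<in>E. m e e *\<^sub>R m (bracket L t e) e)"
    proof (rule trace_frame_independent[OF E' E, where f = "\<lambda>e f. m (bracket L t e) f"])
      show "bilinear_on ?V (\<lambda>e f. m (bracket L t e) f)"
        unfolding bilinear_on_def
      proof (intro ballI allI conjI)
        fix a b c r assume abc: "a \<in> ?V" "b \<in> ?V" "c \<in> ?V"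
        show "m (bracket L t (r *\<^sub>R a + b)) c = r *\<^sub>R m (bracket L t a) c + m (bracket L t b) c"
          using bil abc br t unfolding bilinear_on_def
          by (simp add: linear_add[OF linear_bracket_right] linear_scale[OF linear_bracket_right])
        show "m (bracket L t c) (r *\<^sub>R a + b) = r *\<^sub>R m (bracket L t c) a + m (bracket L t c) b"
          using bil abc br t unfolding bilinear_on_def by simp
      qed
    qed
    also have "\<dots> = m N t" using N(2)[OF t] by simp
    finally show "m (\<Sum>e\<in>?E. m e e *\<^sub>R ?N e) t = m N t" .
  qed
  then have "left_deriv N F x = (\<Sum>e\<in>?E. left_deriv (m e e *\<^sub>R ?N e) F x)"
    using linear_sum[OF left_deriv_linear[OF F x], of "\<lambda>e. m e e *\<^sub>R ?N e" ?E] by simp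
  then have "left_deriv N F x = (\<Sum>e\<in>?E. complex_of_real (m e e) * left_deriv (?N e) F x)"
    by (simp only: linear_scale[OF left_deriv_linear[OF F x]] scaleR_conv_of_real[where 'a = complex])
  moreover have "(\<Sum>e\<in>?E. complex_of_real (m e e) * left_deriv e (left_deriv e F) x) =
      (\<Sum>e\<in>E. complex_of_real (m e e) * left_deriv e (left_deriv e F) x)"
  proof (rule trace_of_real[OF E' E, of "\<lambda>e f. left_deriv e (left_deriv f F) x"])
    show "bilinear_on ?V (\<lambda>e f. left_deriv e (left_deriv f F) x)"
      unfolding bilinear_on_def
    proof (intro ballI allI conjI)
      fix a b c r
      note hol = holomorphic_left_deriv[OF F S]
      show "left_deriv (r *\<^sub>R a + b) (left_deriv c F) x = r *\<^sub>R left_deriv a (left_deriv c F) x + left_deriv b (left_deriv c F) x"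
        by (simp add: linear_add[OF left_deriv_linear[OF hol x]] linear_scale[OF left_deriv_linear[OF hol x]])
      \<comment> \<open>Linearity in the inner direction is an equality of functions on
        \<open>S\<close>; it has to pass through the outer derivative by
        \<open>left_deriv_cong\<close>.\<close>
      have "left_deriv c (left_deriv (r *\<^sub>R a + b) F) x = left_deriv c (\<lambda>y. left_deriv (r *\<^sub>R a) F y + left_deriv b F y) x"
        using openin_subset[OF S]
        by (intro left_deriv_cong[OF S x(1)]) (auto simp: linear_add[OF left_deriv_linear[OF F]])
      also have "\<dots> = left_deriv c (left_deriv (r *\<^sub>R a) F) x + left_deriv c (left_deriv b F) x"
        by (rule left_deriv_add_fun[OF hol hol x])
      also have "left_deriv c (left_deriv (r *\<^sub>R a) F) x = left_deriv c (\<lambda>y. complex_of_real r * left_deriv a F y) x"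
        using openin_subset[OF S]
        by (intro left_deriv_cong[OF S x(1)]) (auto simp: linear_scale[OF left_deriv_linear[OF F]] scaleR_conv_of_real[where 'a = complex])
      also have "\<dots> = r *\<^sub>R left_deriv c (left_deriv a F) x"
        by (simp add: left_deriv_cmult_fun[OF hol x] scaleR_conv_of_real[where 'a = complex])
      finally show "left_deriv c (left_deriv (r *\<^sub>R a + b) F) x = r *\<^sub>R left_deriv c (left_deriv a F) x + left_deriv c (left_deriv b F) x" .
    qed
  qed
  moreover have "left_inv_deriv L H e (left_inv_deriv L H e \<phi>) x = left_deriv e (left_deriv e F) x"
    "left_inv_deriv L H (?N e) \<phi> x = left_deriv (?N e) F x" if "e \<in> ?E" for e
    using that fE(2) lc(1) left_inv_deriv_eq[OF H _ F S W eq] left_inv_deriv2_eq[OF H _ _ F S W eq]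
    by auto
  ultimately show ?thesis
    unfolding laplacian_def by (simp add: right_diff_distrib sum_subtractf)
qed

lemma conformality_eq:
  assumes H: "subgroup H L" and fs: "framed_space (lie_alg L H) m"
    and E: "orthonormal_frame (lie_alg L H) m E"
    and F: "holomorphic_fun L S F" "holomorphic_fun L S F'" and S: "openin T S"
    and W: "openin (subtopology T H) W" "W \<subseteq> S" "x \<in> W"
    and eq: "\<And>y. y \<in> W \<Longrightarrow> \<phi> y = F y" "\<And>y. y \<in> W \<Longrightarrow> \<psi> y = F' y"
  shows "conformality L H m \<phi> \<psi> x = (\<Sum>e\<in>E. complex_of_real (m e e) * (left_deriv e F x * left_deriv e F' x))"
proof -
  let ?V = "lie_alg L H" and ?E = "frame (lie_alg L H) m"
  interpret framed_space ?V m by (rule fs)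
  have E': "orthonormal_frame ?V m ?E" by (rule orthonormal_frame_frame[OF E])
  note fE = frame_props[OF E']
  have x: "x \<in> S" "x \<in> carrier L" using W S openin_subset[OF S] by auto
  have "conformality L H m \<phi> \<psi> x = (\<Sum>e\<in>?E. complex_of_real (m e e) * (left_deriv e F x * left_deriv e F' x))"
    unfolding conformality_def
    using fE(2) left_inv_deriv_eq[OF H _ F(1) S W eq(1)] left_inv_deriv_eq[OF H _ F(2) S W eq(2)]
    by (intro sum.cong) auto
  also have "\<dots> = (\<Sum>e\<in>E. complex_of_real (m e e) * (left_deriv e F x * left_deriv e F' x))"
  proof (rule trace_of_real[OF E' E, of "\<lambda>e f. left_deriv e F x * left_deriv f F' x"])
    show "bilinear_on ?V (\<lambda>e f. left_deriv e F x * left_deriv f F' x)"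
      unfolding bilinear_on_def
      by (simp add: linear_add[OF left_deriv_linear[OF F(1) x]] linear_add[OF left_deriv_linear[OF F(2) x]]
        linear_scale[OF left_deriv_linear[OF F(1) x]] linear_scale[OF left_deriv_linear[OF F(2) x]]
        distrib_left distrib_right)
  qed
  finally show ?thesis .
qed

lemma holomorphic_fun_const: "holomorphic_fun L S (\<lambda>x. c)"
  by (auto simp: holomorphic_fun_def comp_def intro!: holomorphic_wrt_const)

lemma holomorphic_fun_add:
  assumes "holomorphic_fun L S F" "holomorphic_fun L S F'" shows "holomorphic_fun L S (\<lambda>x. F x + F' x)"
  unfolding holomorphic_fun_def
proof (intro ballI, clarify)
  fix D c assume "(D, c) \<in> atlas L"
  with assms have *: "holomorphic_wrt Jvec ((*) \<i>) (F \<circ> inv_into D c) (c ` (D \<inter> S))"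
    "holomorphic_wrt Jvec ((*) \<i>) (F' \<circ> inv_into D c) (c ` (D \<inter> S))"
    by (auto simp: holomorphic_fun_def)
  show "holomorphic_wrt Jvec ((*) \<i>) ((\<lambda>x. F x + F' x) \<circ> inv_into D c) (c ` (D \<inter> S))"
    unfolding holomorphic_wrt_def
  proof
    fix w assume w: "w \<in> c ` (D \<inter> S)"
    note h = holomorphic_wrt_frechet[OF *(1) w] holomorphic_wrt_frechet[OF *(2) w]
    show "\<exists>f'. ((\<lambda>x. F x + F' x) \<circ> inv_into D c has_derivative f') (at w) \<and> (\<forall>h. f' (Jvec h) = \<i> * f' h)"
      using has_derivative_add[OF h(1,3)]
      by (intro exI conjI) (auto simp: comp_def h(2,4)[unfolded comp_def] distrib_left)
  qed
qed

lemma holomorphic_fun_mult: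
  assumes "holomorphic_fun L S F" "holomorphic_fun L S F'" shows "holomorphic_fun L S (\<lambda>x. F x * F' x)"
  unfolding holomorphic_fun_def
proof (intro ballI, clarify)
  fix D c assume "(D, c) \<in> atlas L"
  with assms have *: "holomorphic_wrt Jvec ((*) \<i>) (F \<circ> inv_into D c) (c ` (D \<inter> S))"
    "holomorphic_wrt Jvec ((*) \<i>) (F' \<circ> inv_into D c) (c ` (D \<inter> S))"
    by (auto simp: holomorphic_fun_def)
  show "holomorphic_wrt Jvec ((*) \<i>) ((\<lambda>x. F x * F' x) \<circ> inv_into D c) (c ` (D \<inter> S))"
    unfolding holomorphic_wrt_def
  proof
    fix w assume w: "w \<in> c ` (D \<inter> S)"
    note h = holomorphic_wrt_frechet[OF *(1) w] holomorphic_wrt_frechet[OF *(2) w]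
    show "\<exists>f'. ((\<lambda>x. F x * F' x) \<circ> inv_into D c has_derivative f') (at w) \<and> (\<forall>h. f' (Jvec h) = \<i> * f' h)"
      using has_derivative_mult[OF h(1,3)]
      by (intro exI conjI) (auto simp: comp_def h(2,4)[unfolded comp_def] algebra_simps)
  qed
qed

lemma holomorphic_fun_sum:
  "(\<And>e. e \<in> E \<Longrightarrow> holomorphic_fun L S (F e)) \<Longrightarrow> holomorphic_fun L S (\<lambda>x. \<Sum>e\<in>E. F e x)"
  by (induction E rule: infinite_finite_induct) (auto intro!: holomorphic_fun_add holomorphic_fun_const)

lemma holomorphic_fun_diff:
  assumes "holomorphic_fun L S F" "holomorphic_fun L S F'" shows "holomorphic_fun L S (\<lambda>x. F x - F' x)"
  using holomorphic_fun_add[OF assms(1) holomorphic_fun_mult[OF holomorphic_fun_const[of _ "-1"] assms(2)]]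
  by simp

end

section \<open>Duality\<close>

locale compact_dual = complex_lie L for L :: "('g, 'n::finite) cx_group" (structure) +
  fixes G U :: "'g set" and k p :: "(complex ^ 'n) set" and m :: "complex ^ 'n \<Rightarrow> complex ^ 'n \<Rightarrow> real"
  assumes G: "subgroup G L"
    and decomp: "\<And>Z. \<exists>!(X, Y). X \<in> lie_alg L G \<and> Y \<in> lie_alg L G \<and> Z = X + \<i> *s Y"
    and cartan: "cartan_decomposition L (lie_alg L G) k p"
    and metric: "standard_metric (lie_alg L G) k p m"
    and U: "subgroup U L" and alg_U: "lie_alg L U = dual_alg k p"
begin

abbreviation "g \<equiv> lie_alg L G"
abbreviation "u \<equiv> lie_alg L U"
abbreviation "ms \<equiv> dual_metric k p m"

lemma subspace_k: "subspace k" and subspace_p: "subspace p"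
  and g_eq: "g = {Y + X | Y X. Y \<in> k \<and> X \<in> p}"
  and br_kk: "x \<in> k \<Longrightarrow> y \<in> k \<Longrightarrow> bracket L x y \<in> k"
  and br_kp: "x \<in> k \<Longrightarrow> z \<in> p \<Longrightarrow> bracket L x z \<in> p"
  and br_pp: "z \<in> p \<Longrightarrow> w \<in> p \<Longrightarrow> bracket L z w \<in> k"
proof -
  note c = cartan[unfolded cartan_decomposition_def]
  show "subspace k" by (rule c[THEN conjunct1])
  show "subspace p" by (rule c[THEN conjunct2, THEN conjunct1])
  note c = c[THEN conjunct2, THEN conjunct2, THEN conjunct2]
  show "g = {Y + X | Y X. Y \<in> k \<and> X \<in> p}" by (rule c[THEN conjunct1])
  note c = c[THEN conjunct2]
  show "x \<in> k \<Longrightarrow> y \<in> k \<Longrightarrow> bracket L x y \<in> k" by (rule c[THEN conjunct1, rule_format])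
  note c = c[THEN conjunct2]
  show "x \<in> k \<Longrightarrow> z \<in> p \<Longrightarrow> bracket L x z \<in> p" by (rule c[THEN conjunct1, rule_format])
  show "z \<in> p \<Longrightarrow> w \<in> p \<Longrightarrow> bracket L z w \<in> k" by (rule c[THEN conjunct2, THEN conjunct1, rule_format])
qed

lemma u_eq: "u = {Y + Jvec X | Y X. Y \<in> k \<and> X \<in> p}"
  using alg_U by (simp add: dual_alg_def Jvec_def)

lemma g_I: "Y \<in> k \<Longrightarrow> X \<in> p \<Longrightarrow> Y + X \<in> g"
  unfolding g_eq by blast

lemma u_I: "Y \<in> k \<Longrightarrow> X \<in> p \<Longrightarrow> Y + Jvec X \<in> u"
  unfolding u_eq by blast

lemma k_g: "x \<in> k \<Longrightarrow> x \<in> g" and p_g: "x \<in> p \<Longrightarrow> x \<in> g"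
  using g_I[OF _ subspace_0[OF subspace_p], of x] g_I[OF subspace_0[OF subspace_k], of x] by auto

lemma k_u: "x \<in> k \<Longrightarrow> x \<in> u" and p_u: "x \<in> p \<Longrightarrow> Jvec x \<in> u"
  using u_I[OF _ subspace_0[OF subspace_p], of x] u_I[OF subspace_0[OF subspace_k], of x] by auto

lemma subspace_g: "subspace g"
  unfolding g_eq by (rule subspace_sums[OF subspace_k subspace_p])

lemma subspace_u: "subspace u"
proof (rule subspaceI)
  show "0 \<in> u" using k_u subspace_0[OF subspace_k] by blast
  show "x + y \<in> u" if xy: "x \<in> u" "y \<in> u" for x y
  proof -
    obtain Y X Y' X' where *: "x = Y + Jvec X" "y = Y' + Jvec X'" "Y \<in> k" "X \<in> p" "Y' \<in> k" "X' \<in> p"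
      using xy unfolding u_eq by blast
    have "x + y = (Y + Y') + Jvec (X + X')" using * by simp
    with * show ?thesis unfolding u_eq using subspace_add[OF subspace_k] subspace_add[OF subspace_p] by blast
  qed
  show "c *\<^sub>R x \<in> u" if x: "x \<in> u" for c x
  proof -
    obtain Y X where *: "x = Y + Jvec X" "Y \<in> k" "X \<in> p" using x unfolding u_eq by blast
    have "c *\<^sub>R x = c *\<^sub>R Y + Jvec (c *\<^sub>R X)" using * by (simp add: scaleR_add_right)
    with * show ?thesis unfolding u_eq using subspace_scale[OF subspace_k] subspace_scale[OF subspace_p] by blast
  qed
qed

lemma g_unique:
  assumes "X \<in> g" "Y \<in> g" "X' \<in> g" "Y' \<in> g" "X + Jvec Y = X' + Jvec Y'" shows "X = X'" "Y = Y'"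
proof -
  let ?P = "\<lambda>(A, B). A \<in> g \<and> B \<in> g \<and> X + Jvec Y = A + Jvec B"
  have "\<exists>!q. ?P q" using decomp[of "X + Jvec Y"] unfolding Jvec_def .
  then obtain q where q: "\<forall>r. ?P r \<longrightarrow> r = q" by (rule ex1E)
  have "(X, Y) = q" by (rule q[rule_format]) (simp add: assms)
  moreover have "(X', Y') = q" by (rule q[rule_format]) (simp add: assms)
  ultimately have "(X, Y) = (X', Y')" by simp
  then show "X = X'" "Y = Y'" by auto
qed

lemma g_spans: "\<exists>x\<in>g. \<exists>y\<in>g. w = x + Jvec y"
proof -
  from ex1_implies_ex[OF decomp[of w]] obtain q
    where "case q of (X, Y) \<Rightarrow> X \<in> g \<and> Y \<in> g \<and> w = X + \<i> *s Y" ..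
  then have "fst q \<in> g" "snd q \<in> g" "w = fst q + Jvec (snd q)" by (simp_all add: split_beta Jvec_def)
  then show ?thesis by blast
qed

text \<open>The four parts of an element of \<open>\<gg> + \<i>\<gg>\<close> are regrouped: the
  \<open>\<pp>\<close>-part of the real component is \<i> times an element of
  \<open>\<i>\<pp>\<close>, up to sign.\<close>

lemma u_spans: "\<exists>x\<in>u. \<exists>y\<in>u. w = x + Jvec y"
proof -
  obtain X Y where XY: "X \<in> g" "Y \<in> g" "w = X + Jvec Y" using g_spans by blast
  then obtain Y1 X1 Y2 X2 where *: "X = Y1 + X1" "Y = Y2 + X2" "Y1 \<in> k" "X1 \<in> p" "Y2 \<in> k" "X2 \<in> p"
    unfolding g_eq by blast
  have "w = (Y1 + Jvec X2) + Jvec (Y2 + Jvec (- X1))" using XY * by (simp add: Jvec.J_J)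
  moreover have "Y1 + Jvec X2 \<in> u" "Y2 + Jvec (- X1) \<in> u"
    unfolding u_eq using * subspace_neg[OF subspace_p] by blast+
  ultimately show ?thesis by blast
qed

lemma m_inner: "inner_product_on g m" and m_kp: "x \<in> k \<Longrightarrow> y \<in> p \<Longrightarrow> m x y = 0"
  using metric by (simp_all add: standard_metric_def)

lemma m_sym: "x \<in> g \<Longrightarrow> y \<in> g \<Longrightarrow> m x y = m y x"
  using m_inner unfolding inner_product_on_def by blast

lemma m_pk: "x \<in> p \<Longrightarrow> y \<in> k \<Longrightarrow> m x y = 0"
  using m_sym[OF p_g k_g] m_kp by metis

lemma m_bil: "bilinear_on g m"
  unfolding bilinear_on_def
proof (intro ballI allI conjI)
  fix x y z :: "complex ^ 'n" and a assume *: "x \<in> g" "y \<in> g" "z \<in> g"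
  have lin: "m (a *\<^sub>R x + y) z = a * m x z + m y z"
    using m_inner * by (simp add: inner_product_on_def)
  then show "m (a *\<^sub>R x + y) z = a *\<^sub>R m x z + m y z" by simp
  have "a *\<^sub>R x + y \<in> g" using * by (intro subspace_add[OF subspace_g] subspace_scale[OF subspace_g])
  then show "m z (a *\<^sub>R x + y) = a *\<^sub>R m z x + m z y"
    using lin m_sym[of z] * by simp
qed

text \<open>The definite description is well defined since \<open>Y\<close> and \<open>X\<close> are
  determined by \<open>Y + \<i> X\<close>: both lie in \<open>\<gg>\<close>, and
  \<open>\<gg> + \<i>\<gg>\<close> is direct.\<close>

lemma dual_metric_eq:
  assumes "Y \<in> k" "X \<in> p" "Y' \<in> k" "X' \<in> p"
  shows "ms (Y + Jvec X) (Y' + Jvec X') = - m Y Y' + m X X'"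
  unfolding dual_metric_def Jvec_def[symmetric]
proof (rule the_equality)
  show "\<exists>Y1\<in>k. \<exists>X1\<in>p. \<exists>Y2\<in>k. \<exists>X2\<in>p. Y + Jvec X = Y1 + Jvec X1 \<and> Y' + Jvec X' = Y2 + Jvec X2 \<and>
      - m Y Y' + m X X' = - m Y1 Y2 + m X1 X2" using assms by blast
  fix r assume "\<exists>Y1\<in>k. \<exists>X1\<in>p. \<exists>Y2\<in>k. \<exists>X2\<in>p. Y + Jvec X = Y1 + Jvec X1 \<and> Y' + Jvec X' = Y2 + Jvec X2 \<and>
      r = - m Y1 Y2 + m X1 X2"
  then obtain Y1 X1 Y2 X2 where *: "Y1 \<in> k" "X1 \<in> p" "Y2 \<in> k" "X2 \<in> p"
    "Y + Jvec X = Y1 + Jvec X1" "Y' + Jvec X' = Y2 + Jvec X2" "r = - m Y1 Y2 + m X1 X2" by blast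
  have "Y = Y1" "X = X1" "Y' = Y2" "X' = X2"
    using g_unique[OF _ _ _ _ *(5)] g_unique[OF _ _ _ _ *(6)] assms * k_g p_g by auto
  with * show "r = - m Y Y' + m X X'" by simp
qed

lemma ms_kk: "x \<in> k \<Longrightarrow> y \<in> k \<Longrightarrow> ms x y = - m x y"
  and ms_pp: "x \<in> p \<Longrightarrow> y \<in> p \<Longrightarrow> ms (Jvec x) (Jvec y) = m x y"
  and ms_kp: "x \<in> k \<Longrightarrow> y \<in> p \<Longrightarrow> ms x (Jvec y) = 0"
  and ms_pk: "x \<in> p \<Longrightarrow> y \<in> k \<Longrightarrow> ms (Jvec x) y = 0"
proof -
  note z = subspace_0[OF subspace_k] subspace_0[OF subspace_p]
  note z' = bilinear_on_zero[OF m_bil subspace_g] subspace_0[OF subspace_g] k_g p_g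
  show "x \<in> k \<Longrightarrow> y \<in> k \<Longrightarrow> ms x y = - m x y"
    using dual_metric_eq[OF _ z(2) _ z(2), of x y] by (simp add: z')
  show "x \<in> p \<Longrightarrow> y \<in> p \<Longrightarrow> ms (Jvec x) (Jvec y) = m x y"
    using dual_metric_eq[OF z(1) _ z(1), of x y] by (simp add: z')
  show "x \<in> k \<Longrightarrow> y \<in> p \<Longrightarrow> ms x (Jvec y) = 0"
    using dual_metric_eq[OF _ z(2) z(1), of x y] by (simp add: z')
  show "x \<in> p \<Longrightarrow> y \<in> k \<Longrightarrow> ms (Jvec x) y = 0"
    using dual_metric_eq[OF z(1) _ _ z(2), of x y] by (simp add: z')
qed

lemma framed_g: "framed_space g m"
  by (rule framed_space.intro[OF subspace_g m_bil m_sym])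

lemma framed_u: "framed_space u ms"
proof (rule framed_space.intro[OF subspace_u])
  show s: "ms x y = ms y x" if xy: "x \<in> u" "y \<in> u" for x y
  proof -
    obtain Y X Y' X' where *: "x = Y + Jvec X" "y = Y' + Jvec X'" "Y \<in> k" "X \<in> p" "Y' \<in> k" "X' \<in> p"
      using xy unfolding u_eq by blast
    then show ?thesis using m_sym[of Y Y'] m_sym[of X X'] k_g p_g by (simp add: dual_metric_eq)
  qed
  have lin: "ms (a *\<^sub>R x + y) z = a *\<^sub>R ms x z + ms y z" if xyz: "x \<in> u" "y \<in> u" "z \<in> u" for x y z a
  proof -
    obtain Y X Y' X' Y'' X'' where *: "x = Y + Jvec X" "y = Y' + Jvec X'" "z = Y'' + Jvec X''"
      "Y \<in> k" "X \<in> p" "Y' \<in> k" "X' \<in> p" "Y'' \<in> k" "X'' \<in> p"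
      using xyz unfolding u_eq by blast
    have "a *\<^sub>R x + y = (a *\<^sub>R Y + Y') + Jvec (a *\<^sub>R X + X')" using * by (simp add: algebra_simps)
    moreover have "a *\<^sub>R Y + Y' \<in> k" "a *\<^sub>R X + X' \<in> p"
      using * subspace_k subspace_p by (auto intro: subspace_add subspace_scale)
    ultimately have "ms (a *\<^sub>R x + y) z = - m (a *\<^sub>R Y + Y') Y'' + m (a *\<^sub>R X + X') X''"
      using * by (simp only: dual_metric_eq)
    moreover have "m (a *\<^sub>R Y + Y') Y'' = a *\<^sub>R m Y Y'' + m Y' Y''" "m (a *\<^sub>R X + X') X'' = a *\<^sub>R m X X'' + m X' X''"
      using m_bil * k_g p_g unfolding bilinear_on_def by blast+
    ultimately show ?thesis using * by (simp add: dual_metric_eq algebra_simps)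
  qed
  show "bilinear_on u ms"
    unfolding bilinear_on_def
  proof (intro ballI allI conjI)
    fix x y z a assume *: "x \<in> u" "y \<in> u" "z \<in> u"
    show "ms (a *\<^sub>R x + y) z = a *\<^sub>R ms x z + ms y z" by (rule lin[OF *])
    have "a *\<^sub>R x + y \<in> u" using * by (intro subspace_add[OF subspace_u] subspace_scale[OF subspace_u])
    then show "ms z (a *\<^sub>R x + y) = a *\<^sub>R ms z x + ms z y"
      using lin[OF *] s[of z] * by simp
  qed
qed

lemma br_pk: "x \<in> p \<Longrightarrow> y \<in> k \<Longrightarrow> bracket L x y \<in> p"
  using bracket_antisym[OF G subspace_g p_g k_g] subspace_neg[OF subspace_p br_kp] by metis

lemmas br_lin = linear_add[OF linear_bracket_left] linear_add[OF linear_bracket_right]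
  bracket_Jvec_left bracket_Jvec_right

lemma br_g: "\<forall>x\<in>g. \<forall>y\<in>g. bracket L x y \<in> g"
proof (intro ballI)
  fix x y assume xy: "x \<in> g" "y \<in> g"
  obtain Y X Y' X' where *: "x = Y + X" "y = Y' + X'" "Y \<in> k" "X \<in> p" "Y' \<in> k" "X' \<in> p"
    using xy unfolding g_eq by blast
  have "bracket L x y = (bracket L Y Y' + bracket L X X') + (bracket L Y X' + bracket L X Y')"
    using * by (simp add: br_lin)
  moreover have "bracket L Y Y' + bracket L X X' \<in> k" "bracket L Y X' + bracket L X Y' \<in> p"
    using * by (auto intro: subspace_add[OF subspace_k] subspace_add[OF subspace_p] br_kk br_kp br_pk br_pp)
  ultimately show "bracket L x y \<in> g" using g_I by simp
qed

text \<open>The bracket is complex bilinear, so two factors from \<open>\<i>\<pp>\<close> produce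
  minus a bracket of \<open>\<pp>\<close> with itself, which is in \<open>\<kk>\<close>, and mixed
  brackets stay in \<open>\<i>\<pp>\<close>.\<close>

lemma br_u: "\<forall>x\<in>u. \<forall>y\<in>u. bracket L x y \<in> u"
proof (intro ballI)
  fix x y assume xy: "x \<in> u" "y \<in> u"
  obtain Y X Y' X' where *: "x = Y + Jvec X" "y = Y' + Jvec X'" "Y \<in> k" "X \<in> p" "Y' \<in> k" "X' \<in> p"
    using xy unfolding u_eq by blast
  have "bracket L x y = (bracket L Y Y' - bracket L X X') + Jvec (bracket L Y X' + bracket L X Y')"
    using * by (simp add: br_lin Jvec.J_J)
  moreover have "bracket L Y Y' - bracket L X X' \<in> k" "bracket L Y X' + bracket L X Y' \<in> p"
    using * by (auto intro: subspace_diff[OF subspace_k] subspace_add[OF subspace_p] br_kk br_kp br_pk br_pp)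
  ultimately show "bracket L x y \<in> u" by (simp only: u_I)
qed

end

text \<open>
  \<open>- N\<close> is the first order part of the Laplacian on \<open>G\<close>. It lies in \<open>\<kk>\<close>, where the dual metric is
  \<open>- m\<close>, so the first order part on \<open>U\<close> is \<open>N\<close>.
\<close>

locale compact_dual_frame = compact_dual +
  fixes EK EP :: "(complex ^ 'b) set" and N :: "complex ^ 'b"
  assumes EK: "finite EK" "EK \<subseteq> k" "k \<subseteq> span EK" "\<And>e. e \<in> EK \<Longrightarrow> m e e = 1"
      "\<And>e f. e \<in> EK \<Longrightarrow> f \<in> EK \<Longrightarrow> e \<noteq> f \<Longrightarrow> m e f = 0"
    and EP: "finite EP" "EP \<subseteq> p" "p \<subseteq> span EP" "\<And>e. e \<in> EP \<Longrightarrow> m e e = 1"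
      "\<And>e f. e \<in> EP \<Longrightarrow> f \<in> EP \<Longrightarrow> e \<noteq> f \<Longrightarrow> m e f = 0"
    and N: "N \<in> g" "\<And>t. t \<in> g \<Longrightarrow> m N t = (\<Sum>e\<in>EK \<union> EP. m (bracket L t e) e)"
begin

lemma EK_k: "e \<in> EK \<Longrightarrow> e \<in> k" and EP_p: "e \<in> EP \<Longrightarrow> e \<in> p"
  using EK(2) EP(2) by blast+

lemma disjoint: "EK \<inter> EP = {}"
proof -
  have False if "e \<in> EK" "e \<in> EP" for e
    using m_kp[OF EK_k EP_p, OF that] EK(4)[OF that(1)] by simp
  then show ?thesis by blast
qed

lemma frame_g: "orthonormal_frame g m (EK \<union> EP)"
proof (rule framed_space.orthonormal_frameI[OF framed_g])
  show "finite (EK \<union> EP)" using EK EP by simp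
  show "EK \<union> EP \<subseteq> g" using EK_k EP_p k_g p_g by blast
  show "g \<subseteq> span (EK \<union> EP)"
  proof
    fix x assume "x \<in> g"
    then obtain Y X where *: "x = Y + X" "Y \<in> k" "X \<in> p" unfolding g_eq by blast
    have "Y \<in> span (EK \<union> EP)" using *(2) EK(3) span_mono[of EK "EK \<union> EP"] by blast
    moreover have "X \<in> span (EK \<union> EP)" using *(3) EP(3) span_mono[of EP "EK \<union> EP"] by blast
    ultimately show "x \<in> span (EK \<union> EP)" unfolding *(1) by (rule span_add)
  qed
  show "\<bar>m e e\<bar> = 1" if "e \<in> EK \<union> EP" for e using that EK(4) EP(4) by auto
  show "m e f = 0" if "e \<in> EK \<union> EP" "f \<in> EK \<union> EP" "e \<noteq> f" for e f
    using that EK(5) EP(5) m_kp[OF EK_k EP_p] m_pk[OF EP_p EK_k] by blast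
qed

lemma inj_Jvec: "inj_on Jvec A"
proof (rule inj_onI)
  fix x y assume "Jvec x = Jvec y"
  then have "Jvec (Jvec x) = Jvec (Jvec y)" by simp
  then show "x = y" by (simp add: Jvec.J_J)
qed

lemma disjoint': "EK \<inter> Jvec ` EP = {}"
proof -
  have False if "e \<in> EK" "f \<in> EP" "e = Jvec f" for e f
    using ms_kp[OF EK_k[OF that(1)] EP_p[OF that(2)]] ms_kk[OF EK_k[OF that(1)] EK_k[OF that(1)]] EK(4)[OF that(1)] that(3) by simp
  then show ?thesis by blast
qed

lemma ms_EK: "e \<in> EK \<Longrightarrow> ms e e = - 1" and ms_EP: "e \<in> EP \<Longrightarrow> ms (Jvec e) (Jvec e) = 1"
  using ms_kk[OF EK_k EK_k, of e e] EK(4)[of e] ms_pp[OF EP_p EP_p, of e e] EP(4)[of e] by auto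

lemma frame_u: "orthonormal_frame u ms (EK \<union> Jvec ` EP)"
proof (rule framed_space.orthonormal_frameI[OF framed_u])
  show "finite (EK \<union> Jvec ` EP)" using EK EP by simp
  show "EK \<union> Jvec ` EP \<subseteq> u" using EK_k EP_p k_u p_u by blast
  show "u \<subseteq> span (EK \<union> Jvec ` EP)"
  proof
    fix x assume "x \<in> u"
    then obtain Y X where *: "x = Y + Jvec X" "Y \<in> k" "X \<in> p" unfolding u_eq by blast
    have "Y \<in> span (EK \<union> Jvec ` EP)" using *(2) EK(3) span_mono[of EK "EK \<union> Jvec ` EP"] by blast
    moreover have "Jvec X \<in> span (EK \<union> Jvec ` EP)"
      using *(3) EP(3) span_mono[of "Jvec ` EP" "EK \<union> Jvec ` EP"] linear_span_image[OF Jvec.linear_J, of EP] by blast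
    ultimately show "x \<in> span (EK \<union> Jvec ` EP)" unfolding *(1) by (rule span_add)
  qed
  show "\<bar>ms e e\<bar> = 1" if "e \<in> EK \<union> Jvec ` EP" for e using that ms_EK ms_EP by auto
  show "ms e f = 0" if ef: "e \<in> EK \<union> Jvec ` EP" "f \<in> EK \<union> Jvec ` EP" "e \<noteq> f" for e f
  proof -
    consider "e \<in> EK" "f \<in> EK" | f' where "e \<in> EK" "f' \<in> EP" "f = Jvec f'" |
      e' where "e' \<in> EP" "f \<in> EK" "e = Jvec e'" | e' f' where "e' \<in> EP" "f' \<in> EP" "e = Jvec e'" "f = Jvec f'"
      using ef by blast
    then show ?thesis
    proof cases
      case 1 then show ?thesis using ms_kk[OF EK_k EK_k] EK(5) ef(3) by simp
    next
      case 2 then show ?thesis using ms_kp[OF EK_k EP_p] by simp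
    next
      case 3 then show ?thesis using ms_pk[OF EP_p EK_k] by simp
    next
      case 4
      then have "e' \<noteq> f'" using ef(3) by auto
      with 4 show ?thesis using ms_pp[OF EP_p EP_p] EP(5) by simp
    qed
  qed
qed

text \<open>For \<open>Z\<close> in \<open>\<pp>\<close> the map \<open>bracket L Z\<close>
  exchanges \<open>\<kk>\<close> and \<open>\<pp>\<close>, so its diagonal in the adapted frame is
  zero. Hence the \<open>\<pp>\<close>-part of \<open>N\<close> is orthogonal to itself, and
  \<open>m\<close> is positive.\<close>

lemma N_k: "N \<in> k"
proof -
  obtain Y Z where YZ: "N = Y + Z" "Y \<in> k" "Z \<in> p" using N(1) unfolding g_eq by blast
  have "m (bracket L Z e) e = 0" if "e \<in> EK \<union> EP" for e
  proof (cases "e \<in> EK")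
    case True
    then show ?thesis using m_pk[OF br_pk[OF YZ(3) EK_k] EK_k] by simp
  next
    case False
    then have "e \<in> EP" using that by simp
    then show ?thesis using m_kp[OF br_pp[OF YZ(3) EP_p] EP_p] by simp
  qed
  then have "m N Z = 0" using N(2)[OF p_g[OF YZ(3)]] by simp
  moreover have "m N Z = m Y Z + m Z Z"
    unfolding YZ(1) by (rule bilinear_on_add(1)[OF m_bil]) (use YZ k_g p_g in auto)
  ultimately have "m Z Z = 0" using m_kp[OF YZ(2,3)] by simp
  moreover have "\<forall>x\<in>g. x \<noteq> 0 \<longrightarrow> m x x > 0"
    using m_inner unfolding inner_product_on_def by (elim conjE)
  ultimately have "Z = 0" using p_g[OF YZ(3)] by force
  then show ?thesis using YZ by simp
qed

lemma sum_u: "(\<Sum>e\<in>EK \<union> Jvec ` EP. h e) = (\<Sum>e\<in>EK. h e) + (\<Sum>e\<in>EP. h (Jvec e))"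
  using EK(1) EP(1) disjoint' by (simp add: sum.union_disjoint sum.reindex[OF inj_Jvec])

lemma sum_g: "(\<Sum>e\<in>EK \<union> EP. h e) = (\<Sum>e\<in>EK. h e) + (\<Sum>e\<in>EP. h e)"
  using EK(1) EP(1) disjoint by (simp add: sum.union_disjoint)

text \<open>Only the \<open>\<kk>\<close>-part \<open>Y\<close> of \<open>t\<close> contributes to
  the trace, since the other part exchanges \<open>\<kk>\<close> and \<open>\<i>\<pp>\<close>. The
  frame signs cancel those of the dual metric and give the same trace as on \<open>\<gg>\<close>;
  the left side equals \<open>m N Y\<close> because the dual metric is \<open>- m\<close> on
  \<open>\<kk>\<close>.\<close>

lemma neg_N:
  assumes t: "t \<in> u"
  shows "ms (- N) t = (\<Sum>e\<in>EK \<union> Jvec ` EP. ms e e * ms (bracket L t e) e)"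
proof -
  obtain Y X where YX: "t = Y + Jvec X" "Y \<in> k" "X \<in> p" using t unfolding u_eq by blast
  note zero = subspace_0[OF subspace_k] subspace_0[OF subspace_p] bilinear_on_zero[OF m_bil subspace_g]
  have K: "ms e e * ms (bracket L t e) e = m (bracket L Y e) e" if e: "e \<in> EK" for e
  proof -
    have mem: "bracket L Y e \<in> k" "bracket L X e \<in> p" using br_kk br_pk YX EK_k[OF e] by auto
    have "bracket L t e = bracket L Y e + Jvec (bracket L X e)" using YX by (simp add: br_lin)
    then have "ms (bracket L t e) e = - m (bracket L Y e) e"
      using dual_metric_eq[OF mem EK_k[OF e] zero(2)] zero(4)[OF p_g[OF mem(2)]] by simp
    then show ?thesis using ms_EK[OF e] by simp
  qed
  have P: "ms (Jvec e) (Jvec e) * ms (bracket L t (Jvec e)) (Jvec e) = m (bracket L Y e) e" if e: "e \<in> EP" for e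
  proof -
    have mem: "- bracket L X e \<in> k" "bracket L Y e \<in> p"
      using br_pp br_kp YX EP_p[OF e] subspace_neg[OF subspace_k] by auto
    have "bracket L t (Jvec e) = - bracket L X e + Jvec (bracket L Y e)"
      using YX by (simp add: br_lin Jvec.J_J)
    then have "ms (bracket L t (Jvec e)) (Jvec e) = m (bracket L Y e) e"
      using dual_metric_eq[OF mem zero(1) EP_p[OF e]] zero(4)[OF k_g[OF mem(1)]] by simp
    then show ?thesis using ms_EP[OF e] by simp
  qed
  have "ms (- N) t = m N Y"
    using dual_metric_eq[OF subspace_neg[OF subspace_k N_k] zero(2) YX(2,3)] zero(3)[OF p_g[OF YX(3)]]
      bilinear_on_uminus(1)[OF m_bil subspace_g N(1) k_g[OF YX(2)]] YX(1) by simp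
  also have "\<dots> = (\<Sum>e\<in>EK \<union> Jvec ` EP. ms e e * ms (bracket L t e) e)"
    by (simp add: N(2)[OF k_g[OF YX(2)]] sum_g sum_u K P)
  finally show ?thesis .
qed

text \<open>The Laplacian of \<open>G\<close> in an adapted frame, continued to holomorphic
  functions on open subsets of \<open>L\<close>. The same operator, negated, is the Laplacian of
  \<open>U\<close>.\<close>

definition lap_op :: "('a \<Rightarrow> complex) \<Rightarrow> 'a \<Rightarrow> complex" where
  "lap_op F x = (\<Sum>e\<in>EK \<union> EP. left_deriv e (left_deriv e F) x) - left_deriv N F x"

definition conf_op :: "('a \<Rightarrow> complex) \<Rightarrow> ('a \<Rightarrow> complex) \<Rightarrow> 'a \<Rightarrow> complex" where
  "conf_op F F' x = (\<Sum>e\<in>EK \<union> EP. left_deriv e F x * left_deriv e F' x)"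

lemma holomorphic_lap_op:
  assumes "holomorphic_fun L S F" "openin T S" shows "holomorphic_fun L S (lap_op F)"
  unfolding lap_op_def[abs_def]
  by (intro holomorphic_fun_diff holomorphic_fun_sum holomorphic_left_deriv assms)

lemma holomorphic_conf_op:
  assumes "holomorphic_fun L S F" "holomorphic_fun L S F'" "openin T S"
  shows "holomorphic_fun L S (conf_op F F')"
  unfolding conf_op_def[abs_def]
  by (intro holomorphic_fun_mult holomorphic_fun_sum holomorphic_left_deriv assms)

lemma m_frame: "e \<in> EK \<union> EP \<Longrightarrow> m e e = 1" using EK(4) EP(4) by blast

lemma laplacian_G:
  assumes "holomorphic_fun L S F" "openin T S" "openin (subtopology T G) W" "W \<subseteq> S" "x \<in> W"
    and "\<And>y. y \<in> W \<Longrightarrow> \<phi> y = F y"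
  shows "laplacian L G m \<phi> x = lap_op F x"
proof -
  have "laplacian L G m \<phi> x = (\<Sum>e\<in>EK \<union> EP. complex_of_real (m e e) * left_deriv e (left_deriv e F) x) - left_deriv N F x"
    by (rule laplacian_eq[OF G framed_g br_g frame_g N(1) _ assms]) (simp_all add: N(2) m_frame)
  then show ?thesis by (simp add: lap_op_def m_frame)
qed

lemma conformality_G:
  assumes "holomorphic_fun L S F" "holomorphic_fun L S F'" "openin T S"
    "openin (subtopology T G) W" "W \<subseteq> S" "x \<in> W"
    and "\<And>y. y \<in> W \<Longrightarrow> \<phi> y = F y" "\<And>y. y \<in> W \<Longrightarrow> \<psi> y = F' y"
  shows "conformality L G m \<phi> \<psi> x = conf_op F F' x"
proof -
  have "conformality L G m \<phi> \<psi> x = (\<Sum>e\<in>EK \<union> EP. complex_of_real (m e e) * (left_deriv e F x * left_deriv e F' x))"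
    by (rule conformality_eq[OF G framed_g frame_g assms])
  then show ?thesis by (simp add: conf_op_def m_frame)
qed

text \<open>Each part changes sign for a reason of its own: the vectors of \<open>EK\<close> have
  square -1 in the dual metric, those of \<open>EP\<close> contribute \<open>\<i> * \<i>\<close>,
  and \<open>- N\<close> replaces \<open>N\<close>.\<close>

lemma laplacian_U:
  assumes F: "holomorphic_fun L S F" and S: "openin T S"
    and W: "openin (subtopology T U) W" "W \<subseteq> S" "x \<in> W"
    and eq: "\<And>y. y \<in> W \<Longrightarrow> \<phi> y = F y"
  shows "laplacian L U ms \<phi> x = - lap_op F x"
proof -
  have x: "x \<in> S" "x \<in> carrier L" using W openin_subset[OF S] by auto
  note hol = holomorphic_left_deriv[OF F S]
  have "laplacian L U ms \<phi> x = (\<Sum>e\<in>EK \<union> Jvec ` EP. complex_of_real (ms e e) * left_deriv e (left_deriv e F) x) - left_deriv (- N) F x"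
    by (rule laplacian_eq[OF U framed_u br_u frame_u _ neg_N F S W eq])
      (auto intro: k_u subspace_neg[OF subspace_k] N_k)
  moreover have "left_deriv (Jvec e) (left_deriv (Jvec e) F) x = - left_deriv e (left_deriv e F) x" for e
  proof -
    have "left_deriv (Jvec e) (left_deriv (Jvec e) F) x = \<i> * left_deriv e (left_deriv (Jvec e) F) x" by (rule left_deriv_derivative(2)[OF hol x])
    also have "left_deriv e (left_deriv (Jvec e) F) x = left_deriv e (\<lambda>y. \<i> * left_deriv e F y) x"
      using openin_subset[OF S] by (intro left_deriv_cong[OF S x(1)]) (auto simp: left_deriv_derivative(2)[OF F])
    also have "\<dots> = \<i> * left_deriv e (left_deriv e F) x" by (rule left_deriv_cmult_fun[OF hol x])
    finally show ?thesis by (simp add: mult.assoc[symmetric])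
  qed
  moreover have "left_deriv (- N) F x = - left_deriv N F x" by (rule linear_neg[OF left_deriv_linear[OF F x]])
  ultimately show ?thesis
    by (simp add: lap_op_def sum_u sum_g ms_EK ms_EP sum_negf)
qed

lemma conformality_U:
  assumes F: "holomorphic_fun L S F" "holomorphic_fun L S F'" and S: "openin T S"
    and W: "openin (subtopology T U) W" "W \<subseteq> S" "x \<in> W"
    and eq: "\<And>y. y \<in> W \<Longrightarrow> \<phi> y = F y" "\<And>y. y \<in> W \<Longrightarrow> \<psi> y = F' y"
  shows "conformality L U ms \<phi> \<psi> x = - conf_op F F' x"
proof -
  have x: "x \<in> S" "x \<in> carrier L" using W openin_subset[OF S] by auto
  have "conformality L U ms \<phi> \<psi> x =
      (\<Sum>e\<in>EK \<union> Jvec ` EP. complex_of_real (ms e e) * (left_deriv e F x * left_deriv e F' x))"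
    by (rule conformality_eq[OF U framed_u frame_u F S W eq])
  moreover have "left_deriv (Jvec e) F x * left_deriv (Jvec e) F' x = - (left_deriv e F x * left_deriv e F' x)" for e
  proof -
    have "left_deriv (Jvec e) F x * left_deriv (Jvec e) F' x = (\<i> * \<i>) * (left_deriv e F x * left_deriv e F' x)"
      by (simp only: left_deriv_derivative(2)[OF F(1) x] left_deriv_derivative(2)[OF F(2) x] mult_ac)
    then show ?thesis by simp
  qed
  ultimately show ?thesis
    by (simp add: conf_op_def sum_u sum_g ms_EK ms_EP sum_negf)
qed

text \<open>The identity theorem is applied once with \<open>G\<close> and once with
  \<open>U\<close>: both Lie algebras span that of \<open>L\<close> over the complex numbers, and
  every component of \<open>S\<close> meets both zero sets.\<close>

lemma vanish_iff:
  assumes Q: "holomorphic_fun L S Q" and S: "openin T S"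
    and W: "openin (subtopology T G) W" "W \<subseteq> S"
    and comp: "\<And>C. C \<in> connected_components_of (subtopology T S) \<Longrightarrow> C \<inter> W \<noteq> {} \<and> C \<inter> U \<noteq> {}"
  shows "(\<forall>x\<in>W. Q x = 0) \<longleftrightarrow> (\<forall>x\<in>U \<inter> S. Q x = 0)"
proof
  assume *: "\<forall>x\<in>W. Q x = 0"
  show "\<forall>x\<in>U \<inter> S. Q x = 0"
  proof
    fix x assume x: "x \<in> U \<inter> S"
    show "Q x = 0"
      by (rule identity_theorem[OF G subspace_g g_spans Q S W]) (use * comp x in auto)
  qed
next
  assume *: "\<forall>x\<in>U \<inter> S. Q x = 0"
  have op: "openin (subtopology T U) (U \<inter> S)" using S by (auto simp: openin_subtopology)
  have C: "C \<inter> (U \<inter> S) \<noteq> {}" if "C \<in> connected_components_of (subtopology T S)" for C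
    using comp[OF that] connected_components_of_subset[OF that] by auto
  show "\<forall>x\<in>W. Q x = 0"
  proof
    fix x assume x: "x \<in> W"
    show "Q x = 0"
      by (rule identity_theorem[OF U subspace_u u_spans Q S op _ _ C]) (use * W x in auto)
  qed
qed

text \<open>Both equations say that the one holomorphic function \<open>lap_op F - l * F\<close>
  vanishes, on \<open>W\<close> or on \<open>U \<inter> S\<close>; the sign in
  \<open>laplacian_U\<close> turns \<open>l\<close> into \<open>- l\<close>.\<close>

lemma laplacian_iff:
  assumes F: "holomorphic_fun L S F" and S: "openin T S"
    and W: "openin (subtopology T G) W" "W \<subseteq> S"
    and comp: "\<And>C. C \<in> connected_components_of (subtopology T S) \<Longrightarrow> C \<inter> W \<noteq> {} \<and> C \<inter> U \<noteq> {}"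
    and eq: "\<And>y. y \<in> W \<Longrightarrow> \<phi> y = F y" "\<And>y. y \<in> U \<inter> S \<Longrightarrow> \<phi>' y = F y"
  shows "(\<forall>x\<in>W. laplacian L G m \<phi> x = l * \<phi> x) \<longleftrightarrow>
    (\<forall>x\<in>U \<inter> S. laplacian L U ms \<phi>' x = - l * \<phi>' x)"
proof -
  have op: "openin (subtopology T U) (U \<inter> S)" using S by (auto simp: openin_subtopology)
  have "holomorphic_fun L S (\<lambda>x. lap_op F x - l * F x)"
    by (intro holomorphic_fun_diff holomorphic_fun_mult holomorphic_fun_const holomorphic_lap_op F S)
  from vanish_iff[OF this S W comp] show ?thesis
    using laplacian_G[OF F S W _ eq(1)] laplacian_U[OF F S op _ _ eq(2)] eq by simp
qed

lemma conformality_iff: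
  assumes F: "holomorphic_fun L S F" "holomorphic_fun L S F'" and S: "openin T S"
    and W: "openin (subtopology T G) W" "W \<subseteq> S"
    and comp: "\<And>C. C \<in> connected_components_of (subtopology T S) \<Longrightarrow> C \<inter> W \<noteq> {} \<and> C \<inter> U \<noteq> {}"
    and eq: "\<And>y. y \<in> W \<Longrightarrow> \<phi> y = F y" "\<And>y. y \<in> W \<Longrightarrow> \<psi> y = F' y"
      "\<And>y. y \<in> U \<inter> S \<Longrightarrow> \<phi>' y = F y" "\<And>y. y \<in> U \<inter> S \<Longrightarrow> \<psi>' y = F' y"
  shows "(\<forall>x\<in>W. conformality L G m \<phi> \<psi> x = \<mu> * \<phi> x * \<psi> x) \<longleftrightarrow>
    (\<forall>x\<in>U \<inter> S. conformality L U ms \<phi>' \<psi>' x = - \<mu> * \<phi>' x * \<psi>' x)"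
proof -
  have op: "openin (subtopology T U) (U \<inter> S)" using S by (auto simp: openin_subtopology)
  have "holomorphic_fun L S (\<lambda>x. conf_op F F' x - \<mu> * F x * F' x)"
    by (intro holomorphic_fun_diff holomorphic_fun_mult holomorphic_fun_const holomorphic_conf_op F S)
  from vanish_iff[OF this S W comp] show ?thesis
    using conformality_G[OF F S W _ eq(1,2)] conformality_U[OF F S op _ _ eq(3,4)] eq by simp
qed

end

lemma (in compact_dual) frame_exists:
  "\<exists>EK EP N. compact_dual_frame L G U k p m EK EP N"
proof -
  have inner: "inner_product_on k m" "inner_product_on p m"
    using m_inner k_g p_g unfolding inner_product_on_def by blast+
  obtain EK where EK: "finite EK" "EK \<subseteq> k" "k \<subseteq> span EK" "\<forall>e\<in>EK. m e e = 1"
      "\<forall>e\<in>EK. \<forall>f\<in>EK. e \<noteq> f \<longrightarrow> m e f = 0"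
    using positive_frame_exists[OF subspace_k inner(1)] by (elim exE conjE)
  obtain EP where EP: "finite EP" "EP \<subseteq> p" "p \<subseteq> span EP" "\<forall>e\<in>EP. m e e = 1"
      "\<forall>e\<in>EP. \<forall>f\<in>EP. e \<noteq> f \<longrightarrow> m e f = 0"
    using positive_frame_exists[OF subspace_p inner(2)] by (elim exE conjE)
  \<comment> \<open>A separate frame of \<open>\<gg>\<close>, used only to represent the trace form
    by a vector: \<open>frame_g\<close> belongs to the locale that already presupposes
    \<open>N\<close>.\<close>
  obtain E where E: "finite E" "E \<subseteq> g" "g \<subseteq> span E" "\<forall>e\<in>E. m e e = 1"
      "\<forall>e\<in>E. \<forall>f\<in>E. e \<noteq> f \<longrightarrow> m e f = 0"
    using positive_frame_exists[OF subspace_g m_inner] by (elim exE conjE)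
  have fr: "orthonormal_frame g m E"
    by (rule framed_space.orthonormal_frameI[OF framed_g E(1-3)]) (use E(4,5) in auto)
  have "\<exists>z\<in>g. \<forall>t\<in>g. m z t = (\<Sum>e\<in>EK \<union> EP. m (bracket L t e) e)"
  proof (rule framed_space.riesz[OF framed_g fr])
    fix x y a assume xy: "x \<in> g" "y \<in> g"
    have "m (bracket L (a *\<^sub>R x + y) e) e = a * m (bracket L x e) e + m (bracket L y e) e"
      if "e \<in> EK \<union> EP" for e
    proof -
      have "e \<in> g" using that EK(2) EP(2) k_g p_g by auto
      then show ?thesis using m_bil br_g xy unfolding bilinear_on_def
        by (simp add: linear_add[OF linear_bracket_left] linear_scale[OF linear_bracket_left])
    qed
    then show "(\<Sum>e\<in>EK \<union> EP. m (bracket L (a *\<^sub>R x + y) e) e) =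
        a * (\<Sum>e\<in>EK \<union> EP. m (bracket L x e) e) + (\<Sum>e\<in>EK \<union> EP. m (bracket L y e) e)"
      by (simp add: sum.distrib sum_distrib_left)
  qed
  then obtain N where "N \<in> g" "\<forall>t\<in>g. m N t = (\<Sum>e\<in>EK \<union> EP. m (bracket L t e) e)" by blast
  then have "compact_dual_frame L G U k p m EK EP N"
    by unfold_locales (use EK EP in auto)
  then show ?thesis by blast
qed

theorem theorem13p2:
  fixes L :: "('g, 'n::finite) cx_group"
    and G K U W WC :: "'g set"
    and p :: "(complex ^ 'n) set"
    and m :: "complex ^ 'n \<Rightarrow> complex ^ 'n \<Rightarrow> real"
    and B :: "('g \<Rightarrow> complex) set"
  assumes "is_complexification L G"
    and "\<not> compactin (mtop L) G"
    and "semisimple L (lie_alg L G)"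
    and "maximal_compact_subgroup L G K"
    and "cartan_decomposition L (lie_alg L G) (lie_alg L K) p"
    and "standard_metric (lie_alg L G) (lie_alg L K) p m"
    and "is_compact_dual L (lie_alg L K) p U"
    and "openin (subtopology (mtop L) G) W"
    and "openin (mtop L) WC" and "W \<subseteq> WC"
    and "\<And>C. C \<in> connected_components_of (subtopology (mtop L) WC) \<Longrightarrow> C \<inter> W \<noteq> {} \<and> C \<inter> U \<noteq> {}"
    and "\<And>\<phi>. \<phi> \<in> B \<Longrightarrow> real_analytic_on L G W \<phi>"
    and "\<And>\<phi>. \<phi> \<in> B \<Longrightarrow> \<exists>F. holomorphic_extension L W WC \<phi> F"
  shows "bi_eigenfamily L U (dual_metric (lie_alg L K) p m) (U \<inter> WC) (dual_map L W WC U ` B) \<longleftrightarrow>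
    bi_eigenfamily L G m W B"
proof -
  interpret CD: compact_dual L G U "lie_alg L K" p m
    using assms(1,5-7)
    by (intro compact_dual.intro complex_lie.intro compact_dual_axioms.intro)
      (auto simp only: is_complexification_def is_compact_dual_def)
  obtain EK EP N where "compact_dual_frame L G U (lie_alg L K) p m EK EP N"
    using CD.frame_exists by blast
  then interpret CF: compact_dual_frame L G U "lie_alg L K" p m EK EP N .
  let ?ms = "dual_metric (lie_alg L K) p m" and ?D = "dual_map L W WC U"
  \<comment> \<open>Literally the choice made in \<open>dual_map\<close>, so the dual map is the
    restriction of this very extension.\<close>
  define F where "F \<phi> = (SOME F. holomorphic_extension L W WC \<phi> F)" for \<phi>
  have "holomorphic_extension L W WC \<phi> (F \<phi>)" if "\<phi> \<in> B" for \<phi>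
    unfolding F_def using assms(13)[OF that] by (rule someI_ex)
  then have F: "holomorphic_fun L WC (F \<phi>)" "y \<in> W \<Longrightarrow> \<phi> y = F \<phi> y" if "\<phi> \<in> B" for \<phi> y
    using that by (auto simp: holomorphic_extension_def)
  have D: "y \<in> U \<inter> WC \<Longrightarrow> ?D \<phi> y = F \<phi> y" for \<phi> y
    by (simp add: dual_map_def F_def)
  note lap = CF.laplacian_iff[OF F(1) assms(9,8,10,11) F(2) D]
  note conf = CF.conformality_iff[OF F(1) F(1) assms(9,8,10,11) F(2) F(2) D D]
  \<comment> \<open>Stated for every subfamily of \<open>B\<close>, since the two halves of a
    bi-eigenfamily are transferred separately.\<close>
  have eig: "eigenfamily L U ?ms (U \<inter> WC) (?D ` A) \<longleftrightarrow> eigenfamily L G m W A" if A: "A \<subseteq> B" for A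
  proof -
    define R where "R l \<mu> \<longleftrightarrow> (\<forall>\<phi>\<in>A. \<forall>\<psi>\<in>A. \<forall>x\<in>W.
      laplacian L G m \<phi> x = l * \<phi> x \<and> conformality L G m \<phi> \<psi> x = \<mu> * \<phi> x * \<psi> x)" for l \<mu>
    define R' where "R' l \<mu> \<longleftrightarrow> (\<forall>\<phi>\<in>?D ` A. \<forall>\<psi>\<in>?D ` A. \<forall>x\<in>U \<inter> WC.
      laplacian L U ?ms \<phi> x = l * \<phi> x \<and> conformality L U ?ms \<phi> \<psi> x = \<mu> * \<phi> x * \<psi> x)" for l \<mu>
    \<comment> \<open>The constants are independent of the members of the family, so the sign change
      is uniform and the existential statements agree.\<close>
    have "R l \<mu> \<longleftrightarrow> R' (- l) (- \<mu>)" for l \<mu>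
      unfolding R_def R'_def ball_simps ball_conj_distrib
      using lap conf A by (simp add: subset_iff)
    then have "(\<exists>l \<mu>. R l \<mu>) \<longleftrightarrow> (\<exists>l \<mu>. R' l \<mu>)" by (metis minus_minus)
    then show ?thesis by (simp add: eigenfamily_def R_def R'_def)
  qed
  have mixed: "(\<exists>\<mu>. \<forall>\<phi>\<in>?D ` A. \<forall>\<psi>\<in>?D ` A'. \<forall>x\<in>U \<inter> WC. conformality L U ?ms \<phi> \<psi> x = \<mu> * \<phi> x * \<psi> x) \<longleftrightarrow>
      (\<exists>\<mu>. \<forall>\<phi>\<in>A. \<forall>\<psi>\<in>A'. \<forall>x\<in>W. conformality L G m \<phi> \<psi> x = \<mu> * \<phi> x * \<psi> x)" if A: "A \<subseteq> B" "A' \<subseteq> B" for A A'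
  proof -
    define R where "R \<mu> \<longleftrightarrow> (\<forall>\<phi>\<in>A. \<forall>\<psi>\<in>A'. \<forall>x\<in>W. conformality L G m \<phi> \<psi> x = \<mu> * \<phi> x * \<psi> x)" for \<mu>
    define R' where "R' \<mu> \<longleftrightarrow> (\<forall>\<phi>\<in>?D ` A. \<forall>\<psi>\<in>?D ` A'. \<forall>x\<in>U \<inter> WC.
      conformality L U ?ms \<phi> \<psi> x = \<mu> * \<phi> x * \<psi> x)" for \<mu>
    have "R \<mu> \<longleftrightarrow> R' (- \<mu>)" for \<mu>
      unfolding R_def R'_def ball_simps
      using conf A by (simp add: subset_iff)
    then have "(\<exists>\<mu>. R' \<mu>) \<longleftrightarrow> (\<exists>\<mu>. R \<mu>)" by (metis minus_minus)
    then show ?thesis by (simp add: R_def R'_def)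
  qed
  show ?thesis
  proof
    assume "bi_eigenfamily L U ?ms (U \<inter> WC) (?D ` B)"
    then obtain E1 E2 where E: "E1 \<noteq> {}" "E2 \<noteq> {}" "?D ` B = E1 \<union> E2"
      "eigenfamily L U ?ms (U \<inter> WC) E1" "eigenfamily L U ?ms (U \<inter> WC) E2"
      "\<exists>\<mu>. \<forall>\<phi>\<in>E1. \<forall>\<psi>\<in>E2. \<forall>x\<in>U \<inter> WC. conformality L U ?ms \<phi> \<psi> x = \<mu> * \<phi> x * \<psi> x"
      unfolding bi_eigenfamily_def by blast
    \<comment> \<open>\<open>?D\<close> need not be injective on \<open>B\<close>: functions that
      differ only off \<open>W\<close> have the same extension. The partition is therefore pulled
      back by taking full preimages, which still cover \<open>B\<close> and are mapped onto
      \<open>E1\<close> and \<open>E2\<close>.\<close>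
    define A1 A2 where "A1 = {\<phi> \<in> B. ?D \<phi> \<in> E1}" and "A2 = {\<phi> \<in> B. ?D \<phi> \<in> E2}"
    have A: "A1 \<subseteq> B" "A2 \<subseteq> B" "?D ` A1 = E1" "?D ` A2 = E2" "B = A1 \<union> A2"
      using E(3) by (auto simp: A1_def A2_def)
    with E have "A1 \<noteq> {}" "A2 \<noteq> {}" by auto
    moreover have "eigenfamily L G m W A1" "eigenfamily L G m W A2"
      using E(4,5) eig[OF A(1)] eig[OF A(2)] A(3,4) by simp_all
    moreover note mixed[OF A(1,2), unfolded A(3,4), THEN iffD1, OF E(6)]
    ultimately show "bi_eigenfamily L G m W B"
      unfolding bi_eigenfamily_def using A(5) by (intro exI[of _ A1] exI[of _ A2] conjI)
  next
    assume "bi_eigenfamily L G m W B"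
    then obtain E1 E2 where E: "E1 \<noteq> {}" "E2 \<noteq> {}" "B = E1 \<union> E2"
      "eigenfamily L G m W E1" "eigenfamily L G m W E2"
      "\<exists>\<mu>. \<forall>\<phi>\<in>E1. \<forall>\<psi>\<in>E2. \<forall>x\<in>W. conformality L G m \<phi> \<psi> x = \<mu> * \<phi> x * \<psi> x"
      unfolding bi_eigenfamily_def by blast
    then have sub: "E1 \<subseteq> B" "E2 \<subseteq> B" by auto
    have "?D ` E1 \<noteq> {}" "?D ` E2 \<noteq> {}" "?D ` B = ?D ` E1 \<union> ?D ` E2"
      using E(1-3) by blast+
    moreover have "eigenfamily L U ?ms (U \<inter> WC) (?D ` E1)" "eigenfamily L U ?ms (U \<inter> WC) (?D ` E2)"
      using E(4,5) eig[OF sub(1)] eig[OF sub(2)] by simp_all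
    moreover note mixed[OF sub, THEN iffD2, OF E(6)]
    ultimately show "bi_eigenfamily L U ?ms (U \<inter> WC) (?D ` B)"
      unfolding bi_eigenfamily_def by (intro exI[of _ "?D ` E1"] exI[of _ "?D ` E2"] conjI)
  qed
qed

end
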